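(* For every integer $r \geq 2$ and every integer $n \geq N(r)$, $$0<\log\Bigl(1+\frac{C(r)}{n^{r-1/2}}-\frac{C_1(r)}{n^{r}}\Bigr)<(-1)^{r-1}\Delta^r\log\overline{p}(n)<\log\Bigl(1+\frac{C(r)}{n^{r-1/2}}\Bigr),$$ where $C(r)$, $C_1(r)$ and $N(r)$ are the explicit constants defined in the context.
   Context: An overpartition of a positive integer $n$ is a nonincreasing sequence of positive integers with sum $n$ in which the first occurrence of each number may be overlined. $\overline{p}(n)$ denotes the number of overpartitions of $n$, with $\overline{p}(0)=1$. $\Delta$ is the forward difference operator $\Delta f(n)=f(n+1)-f(n)$ and $\Delta^r$ is its $r$-fold iterate (acting in $n$). $\log$ is the natural logarithm. The rising factorial is $(\alpha)_m=\alpha(\alpha+1)\cdots(\alpha+m-1)$, with $(\alpha)_0=1$. Constants: for an integer $m\ge 1$, $N_0(1)=1$ and $N_0(m)=2m\log m-m\log\log m$ if $m\geq 2$. For an integer $r\geq 2$: $$N_1(r)=\max\Bigl\{85,\ \Bigl\lceil \tfrac{4}{\pi^2}N_0(2r+2)^2\Bigr\rceil\Bigr\},$$ $$C(r)=\frac{\pi}{2}\Bigl(\frac12\Bigr)_{r-1},\qquad C_1(r)=(r-1)!+4r^2C(r),$$ $$C_2(r)=\sum_{k=0}^{2r-2}\frac{1}{(k+1)\pi^{k+1}}\Bigl(\frac{k+1}{2}\Bigr)_r\frac{1}{r^k}+\frac{r}{10^r},$$ $$N_2(r)=\Bigl\lceil\Bigl(\frac{1+C_1(r)}{C(r)}\Bigr)^2\Bigr\rceil,$$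 $$N_3(r)=\max\Bigl\{N_1(r),\ 2r^2,\ \Bigl\lceil\Bigl(\frac{2^{r+1}(C_2(r)+1)}{(r-1)!}\Bigr)^2\Bigr\rceil,\ \Bigl\lceil\Bigl(\frac{2^rC(r)^2}{(r-1)!}\Bigr)^{1/(r-1)}\Bigr\rceil\Bigr\},$$ $$N(r)=\max\{N_2(r),N_3(r)\}.$$ *)

theory Defs
  imports Complex_Main
begin

(* A part is a pair of its size and a flag telling whether it is overlined. *)
definition overpartition :: "nat \<Rightarrow> (nat \<times> bool) list \<Rightarrow> bool" where
  "overpartition n xs \<longleftrightarrow>
     sorted_wrt (\<ge>) (map fst xs) \<and>
     (\<forall>x\<in>set xs. 0 < fst x) \<and>
     sum_list (map fst xs) = n \<and>
     (\<forall>i<length xs. snd (xs ! i) \<longrightarrow> fst (xs ! i) \<notin> fst ` set (take i xs))"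

definition num_overpartitions :: "nat \<Rightarrow> nat" where
  "num_overpartitions n = card {xs. overpartition n xs}"

lemma finite_overpartitions: "finite {xs. overpartition n xs}"
proof -
  have len: "length xs \<le> sum_list (map fst xs)" if "\<forall>x\<in>set xs. 0 < fst x"
    for xs :: "(nat \<times> bool) list"
    using that by (induction xs) auto
  have "{xs. overpartition n xs} \<subseteq> {xs. set xs \<subseteq> {..n} \<times> UNIV \<and> length xs \<le> n}"
  proof (rule subsetI, rule CollectI, rule conjI)
    fix xs assume "xs \<in> {xs. overpartition n xs}"
    then have pos: "\<forall>x\<in>set xs. 0 < fst x" and sum: "sum_list (map fst xs) = n"
      by (auto simp: overpartition_def)
    show "set xs \<subseteq> {..n} \<times> UNIV"
    proof
      fix x assume "x \<in> set xs"
      then have "fst x \<le> n"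
        using member_le_sum_list[of "fst x" "map fst xs"] sum by auto
      then show "x \<in> {..n} \<times> UNIV" by (cases x) auto
    qed
    show "length xs \<le> n" using len[OF pos] sum by simp
  qed
  moreover have "finite {xs. set xs \<subseteq> {..n} \<times> (UNIV :: bool set) \<and> length xs \<le> n}"
    by (rule finite_lists_length_le) auto
  ultimately show ?thesis by (rule finite_subset)
qed

(* The convention that the number of overpartitions of 0 is 1 is not a separate case:
   the empty sequence is counted. *)
lemma num_overpartitions_0: "num_overpartitions 0 = 1"
proof -
  have "{xs. overpartition 0 xs} = {[]}"
  proof (intro equalityI subsetI)
    fix xs assume "xs \<in> {xs. overpartition 0 xs}"
    then show "xs \<in> {[]}" by (cases xs) (auto simp: overpartition_def)
  qed (simp add: overpartition_def)
  then show ?thesis by (simp add: num_overpartitions_def)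
qed

definition fwd_diff :: "(nat \<Rightarrow> real) \<Rightarrow> nat \<Rightarrow> real" where
  "fwd_diff f n = f (n + 1) - f n"

(* N0 is only meaningful for m \<ge> 1; the other constants only for r \<ge> 2. *)
definition N0 :: "nat \<Rightarrow> real" where
  "N0 m = (if m = 1 then 1 else 2 * real m * ln (real m) - real m * ln (ln (real m)))"

definition N1 :: "nat \<Rightarrow> int" where
  "N1 r = max 85 \<lceil>4 / pi\<^sup>2 * (N0 (2 * r + 2))\<^sup>2\<rceil>"

definition C :: "nat \<Rightarrow> real" where
  "C r = pi / 2 * pochhammer (1 / 2) (r - 1)"

definition C1 :: "nat \<Rightarrow> real" where
  "C1 r = fact (r - 1) + 4 * (real r)\<^sup>2 * C r"

definition C2 :: "nat \<Rightarrow> real" where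
  "C2 r = (\<Sum>k = 0..2 * r - 2.
             1 / ((real k + 1) * pi ^ (k + 1)) * pochhammer ((real k + 1) / 2) r * (1 / real r ^ k))
          + real r / 10 ^ r"

definition N2 :: "nat \<Rightarrow> int" where
  "N2 r = \<lceil>((1 + C1 r) / C r)\<^sup>2\<rceil>"

definition N3 :: "nat \<Rightarrow> int" where
  "N3 r = Max {N1 r,
               2 * (int r)\<^sup>2,
               \<lceil>(2 ^ (r + 1) * (C2 r + 1) / fact (r - 1))\<^sup>2\<rceil>,
               \<lceil>(2 ^ r * (C r)\<^sup>2 / fact (r - 1)) powr (1 / (real r - 1))\<rceil>}"

definition N :: "nat \<Rightarrow> int" where
  "N r = max (N2 r) (N3 r)"

end

theory Submission
  imports Defs
    "HOL-Complex_Analysis.Complex_Analysis"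
    "HOL-Real_Asymp.Real_Asymp"
    "HOL-Probability.Distributions"
begin

text \<open>
  Write \<open>P q\<close> for the generating function of the overpartition numbers. It is
  \<open>\<Prod> (1 + q\<^sup>k) / (1 - q\<^sup>k)\<close>, which by Gauss is the reciprocal of \<open>\<theta> q = \<Sum> (-1)\<^sup>j q^(j\<^sup>2)\<close>. The inversion
  formula of \<open>\<theta>\<close>, obtained with Polya from the binomial expansion of \<open>(2 cos x)^(2m)\<close> summed
  over roots of unity, says for \<open>Re t > 0\<close> that \<open>P (exp (-t))\<close> is
  \<open>\<surd>(t/\<pi>)/2 * exp (\<pi>\<^sup>2/(4t))\<close> divided by \<open>\<Sum> exp (-\<pi>\<^sup>2k(k+1)/t)\<close>.

  The coefficient integral is taken along \<open>Re t = 1/\<surd>n\<close>, to the right of the saddle point. There the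
  numerator above approximates \<open>P (exp (-t))\<close> up to \<open>O(exp (\<surd>n/2))\<close> on the whole segment
  \<open>\<bar>Im t\<bar> \<le> \<pi>\<close>, and its product with \<open>exp (n t)\<close> has a primitive in terms of that of the Gaussian. Hence
  the \<open>n\<close>-th number is \<open>exp (\<pi>\<surd>n)/(8n) * (1 - 1/(\<pi>\<surd>n))\<close> up to \<open>O(exp (3\<surd>n/2))\<close>.

  The differences of \<open>\<pi>\<surd>x\<close>, of \<open>ln x\<close> and of the terms of the series of \<open>ln (1 - 1/(\<pi>\<surd>x))\<close> are evaluated by
  the mean value theorem. The first gives \<open>C r / n powr (r - 1/2)\<close> and the second the correction
  \<open>-(r-1)!/n\<^sup>r\<close>; all other contributions are absorbed because \<open>n \<ge> N2 r\<close> forces \<open>\<surd>n \<ge> 4r\<^sup>2\<close>.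
\<close>

section \<open>The generating function\<close>

text \<open>The saddle point of \<open>exp (n t + \<pi>\<^sup>2/(4t))\<close> is
  \<open>t = \<pi>/(2 \<surd>n)\<close>, so the line \<open>Re t = 1/\<surd>n\<close> in fact runs
  to its left. This does no harm, because nothing is estimated by steepest descent: the main term is
  integrated exactly and the line only has to keep the error small. On
  \<open>Re t = c/\<surd>n\<close> the factor \<open>exp (n t)\<close> has size
  \<open>exp (c \<surd>n)\<close>, while the bound for the generating function away from the real
  axis is about \<open>exp (\<surd>n/(2c))\<close>. With \<open>c = 1\<close> the exponents add up
  to 3/2, well below \<pi>. An exponentially small relative error is what the statement demands. The
  quantity to be bounded is itself only of order \<open>n powr (1/2 - r)\<close> with
  \<open>r\<close> arbitrary, so no expansion of fixed order in powers of \<open>1/\<surd>n\<close>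
  could serve all \<open>r\<close>. An exponentially small error can be differenced crudely, at the
  cost of a factor \<open>2^r\<close>. In Polya's argument the angles are
  \<open>\<pi> (k + 1/2)/l\<close>. Their doubles are the arguments of the \<open>l\<close>-th roots
  of -1, and this half step produces the alternating signs of \<open>\<theta>\<close>.\<close>

definition bounded_overparts :: "nat \<Rightarrow> nat \<Rightarrow> (nat \<times> bool) list set" where
  "bounded_overparts K n = {xs. overpartition n xs \<and> (\<forall>x\<in>set xs. fst x \<le> K)}"

text \<open>Removing a head of size \<open>K\<close> leaves a list of this kind: the first
  \<open>K\<close> is gone, so no remaining \<open>K\<close> may be overlined. Together with
  \<open>bounded_overparts\<close> the family is closed under removal of the head, which yields two
  linear relations for two series.\<close>

definition plain_overparts :: "nat \<Rightarrow> nat \<Rightarrow> (nat \<times> bool) list set" where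
  "plain_overparts K n = {xs \<in> bounded_overparts K n. (K, True) \<notin> set xs}"

text \<open>On its own, \<open>overpartition (n - k) ys\<close> would allow the first
  \<open>k\<close> in \<open>ys\<close> to be overlined. In the longer list it is a later
  occurrence, hence the condition on \<open>(k, True)\<close>.\<close>

lemma overpartition_Cons:
  "overpartition n ((k, b) # ys) \<longleftrightarrow>
     0 < k \<and> k \<le> n \<and> overpartition (n - k) ys \<and> (\<forall>y\<in>set ys. fst y \<le> k) \<and> (k, True) \<notin> set ys"
proof -
  have "(\<forall>i<length ((k, b) # ys). snd (((k, b) # ys) ! i) \<longrightarrow>
            fst (((k, b) # ys) ! i) \<notin> fst ` set (take i ((k, b) # ys))) \<longleftrightarrow>
        (\<forall>i<length ys. snd (ys ! i) \<longrightarrow> fst (ys ! i) \<notin> fst ` set (take i ys)) \<and>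
        (\<forall>i<length ys. snd (ys ! i) \<longrightarrow> fst (ys ! i) \<noteq> k)"
    by (auto simp: All_less_Suc2)
  moreover have "(\<forall>i<length ys. snd (ys ! i) \<longrightarrow> fst (ys ! i) \<noteq> k) \<longleftrightarrow> (k, True) \<notin> set ys"
    by (force simp: in_set_conv_nth prod_eq_iff)
  ultimately show ?thesis
    unfolding overpartition_def by auto
qed

lemma finite_bounded_overparts: "finite (bounded_overparts K n)"
  unfolding bounded_overparts_def
  by (rule finite_subset[OF _ finite_overpartitions[of n]]) auto

lemma finite_plain_overparts: "finite (plain_overparts K n)"
  unfolding plain_overparts_def using finite_bounded_overparts by auto

lemma bounded_overparts_subset_plain:
  "bounded_overparts K n \<subseteq> plain_overparts (Suc K) n"
  unfolding plain_overparts_def bounded_overparts_def by force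

text \<open>Sizes never increase along the list, so the head alone decides whether the bound
  \<open>Suc K\<close> is attained.\<close>

lemma Cons_in_bounded_overparts_Suc:
  "x # ys \<in> bounded_overparts (Suc K) n \<longleftrightarrow> x # ys \<in> bounded_overparts K n \<or>
     fst x = Suc K \<and> Suc K \<le> n \<and> ys \<in> plain_overparts (Suc K) (n - Suc K)"
proof (cases x)
  case (Pair k b)
  consider "k \<le> K" | "k = Suc K" | "k > Suc K" by linarith
  then show ?thesis
  proof cases
    case 1
    then have "\<forall>y\<in>set ys. fst y \<le> K" "\<forall>y\<in>set ys. fst y \<le> Suc K" if "\<forall>y\<in>set ys. fst y \<le> k"
      using that by fastforce+
    moreover have "k \<noteq> Suc K" "k \<le> Suc K" using 1 by auto
    ultimately show ?thesis
      unfolding Pair bounded_overparts_def mem_Collect_eq overpartition_Cons list.set ball_simps fst_conv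
      using 1 by argo
  qed (use Pair in \<open>simp_all add: bounded_overparts_def plain_overparts_def overpartition_Cons, metis?\<close>)
qed

lemma bounded_overparts_0: "bounded_overparts 0 n = (if n = 0 then {[]} else {})"
proof -
  have "xs \<in> bounded_overparts 0 n \<longleftrightarrow> xs = [] \<and> n = 0" for xs
    by (cases xs) (auto simp: bounded_overparts_def overpartition_def)
  then show ?thesis by auto
qed

lemma bounded_overparts_Suc:
  "bounded_overparts (Suc K) n = bounded_overparts K n \<union>
     (if Suc K \<le> n then (\<lambda>(b, ys). (Suc K, b) # ys) ` (UNIV \<times> plain_overparts (Suc K) (n - Suc K)) else {})"
    (is "?A = ?B")
proof (rule set_eqI)
  fix xs show "xs \<in> ?A \<longleftrightarrow> xs \<in> ?B"
  proof (cases xs)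
    case Nil
    then show ?thesis by (auto simp: bounded_overparts_def)
  next
    case (Cons x ys)
    then show ?thesis
      by (cases x) (auto simp: Cons_in_bounded_overparts_Suc)
  qed
qed

lemma plain_overparts_Suc:
  "plain_overparts (Suc K) n = bounded_overparts K n \<union>
     (if Suc K \<le> n then (\<lambda>ys. (Suc K, False) # ys) ` plain_overparts (Suc K) (n - Suc K) else {})"
    (is "?A = ?B")
proof (rule set_eqI)
  fix xs
  have bK: "(Suc K, True) \<notin> set xs" if "xs \<in> bounded_overparts K n" for xs
    using that bounded_overparts_subset_plain by (fastforce simp: plain_overparts_def)
  show "xs \<in> ?A \<longleftrightarrow> xs \<in> ?B"
  proof (cases xs)
    case Nil
    have "[] \<in> ?A \<longleftrightarrow> [] \<in> bounded_overparts K n"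
      by (simp add: plain_overparts_def bounded_overparts_def)
    then show ?thesis using Nil by auto
  next
    case (Cons x ys)
    have "xs \<in> ?A \<longleftrightarrow> xs \<in> bounded_overparts (Suc K) n \<and> (Suc K, True) \<notin> set xs"
      by (simp add: plain_overparts_def)
    also have "\<dots> \<longleftrightarrow> xs \<in> bounded_overparts K n \<or>
        x = (Suc K, False) \<and> Suc K \<le> n \<and> ys \<in> plain_overparts (Suc K) (n - Suc K)"
    proof -
      have ys: "ys \<in> plain_overparts (Suc K) (n - Suc K) \<Longrightarrow> (Suc K, True) \<notin> set ys"
        by (simp add: plain_overparts_def)
      have mem: "(Suc K, True) \<in> set (x # ys) \<longleftrightarrow> x = (Suc K, True) \<or> (Suc K, True) \<in> set ys"
        by auto
      have x: "fst x = Suc K \<longleftrightarrow> x = (Suc K, False) \<or> x = (Suc K, True)"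
          "\<not> (x = (Suc K, False) \<and> x = (Suc K, True))"
        by (cases x, cases "snd x", auto)+
      show ?thesis
        unfolding Cons Cons_in_bounded_overparts_Suc using bK[of "x # ys"] ys mem x by argo
    qed
    also have "\<dots> \<longleftrightarrow> xs \<in> ?B" using Cons by auto
    finally show ?thesis .
  qed
qed

lemma bounded_overparts_disjoint:
  "bounded_overparts K n \<inter> (\<lambda>(b, ys). (Suc K, b) # ys) ` X = {}"
  "bounded_overparts K n \<inter> (\<lambda>ys. (Suc K, False) # ys) ` Y = {}"
  by (auto simp: bounded_overparts_def)

text \<open>The factor 2 is the choice of overlining the head, which is the first part of size
  \<open>Suc K\<close>.\<close>

lemma card_bounded_overparts_Suc:
  "card (bounded_overparts (Suc K) n) = card (bounded_overparts K n) +
     (if Suc K \<le> n then 2 * card (plain_overparts (Suc K) (n - Suc K)) else 0)"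
proof -
  let ?f = "\<lambda>(b, ys). (Suc K, b) # ys"
  let ?S = "(UNIV :: bool set) \<times> plain_overparts (Suc K) (n - Suc K)"
  have "inj_on ?f ?S"
    by (rule inj_onI) (auto split: prod.splits)
  then have "card (?f ` ?S) = 2 * card (plain_overparts (Suc K) (n - Suc K))"
    by (simp only: card_image card_cartesian_product card_UNIV_bool)
  moreover have "card (bounded_overparts K n \<union> ?f ` ?S) = card (bounded_overparts K n) + card (?f ` ?S)"
    by (rule card_Un_disjoint)
      (simp_all only: bounded_overparts_disjoint finite_bounded_overparts
         finite_plain_overparts finite_imageI finite_SigmaI finite)
  ultimately show ?thesis
    unfolding bounded_overparts_Suc[of K n] by (simp only: if_split) simp
qed

lemma card_plain_overparts_Suc:
  "card (plain_overparts (Suc K) n) = card (bounded_overparts K n) +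
     (if Suc K \<le> n then card (plain_overparts (Suc K) (n - Suc K)) else 0)"
proof -
  let ?f = "\<lambda>ys. (Suc K, False) # ys"
  let ?S = "plain_overparts (Suc K) (n - Suc K)"
  have "card (?f ` ?S) = card ?S"
    by (rule card_image) (simp add: inj_on_def)
  moreover have "card (bounded_overparts K n \<union> ?f ` ?S) = card (bounded_overparts K n) + card (?f ` ?S)"
    by (rule card_Un_disjoint)
      (simp_all only: bounded_overparts_disjoint finite_bounded_overparts
         finite_plain_overparts finite_imageI)
  ultimately show ?thesis
    unfolding plain_overparts_Suc[of K n] by (simp only: if_split) simp
qed

lemma num_overpartitions_eq_card_bounded:
  assumes "n \<le> K" shows "num_overpartitions n = card (bounded_overparts K n)"
proof -
  have "fst x \<le> K" if "overpartition n xs" "x \<in> set xs" for xs x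
    using that assms member_le_sum_list[of "fst x" "map fst xs"]
    by (auto simp: overpartition_def)
  then show ?thesis
    unfolding num_overpartitions_def bounded_overparts_def by metis
qed

lemma card_bounded_overparts_le: "card (bounded_overparts K n) \<le> num_overpartitions n"
  unfolding num_overpartitions_def bounded_overparts_def
  by (rule card_mono[OF finite_overpartitions]) auto

section \<open>Convergence of the power series and passage to the infinite product\<close>

lemma power_series_shift:
  fixes c :: "nat \<Rightarrow> 'a::{real_normed_field,banach}"
  assumes "(\<lambda>n. c n * z ^ n) sums s"
  shows "(\<lambda>n. (if k \<le> n then c (n - k) else 0) * z ^ n) sums (z ^ k * s)"
proof -
  have "(\<lambda>n. z ^ k * (c n * z ^ n)) sums (z ^ k * s)"
    by (rule sums_mult[OF assms])
  then have "(\<lambda>n. (if k \<le> n + k then c (n + k - k) else 0) * z ^ (n + k)) sums (z ^ k * s)"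
    by (simp add: power_add mult_ac)
  then show ?thesis
    by (subst (asm) sums_zero_iff_shift) auto
qed

text \<open>Formally the series is the given one divided by \<open>1 - x^k\<close>, but that
  presupposes its convergence. The recursion is therefore applied to partial sums: each is at most
  \<open>suminf a\<close> plus \<open>x^k\<close> times itself, and \<open>x^k < 1\<close> lets it
  be solved for a bound.\<close>

lemma summable_plain:
  fixes x :: real
  assumes "0 \<le> x" "x < 1" "summable (\<lambda>n. real (card (bounded_overparts K n)) * x ^ n)"
  shows "summable (\<lambda>n. real (card (plain_overparts (Suc K) n)) * x ^ n)"
proof -
  define k where "k = Suc K"
  define b where "b n = real (card (plain_overparts k n)) * x ^ n" for n
  define a where "a n = real (card (bounded_overparts K n)) * x ^ n" for n
  have b0: "b n \<ge> 0" for n using assms by (simp add: b_def)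
  have xk: "x ^ k < 1" using assms by (cases "x = 0") (auto simp: k_def intro!: power_Suc_less_one simp del: power_Suc)
  have rec: "b n = a n + (if k \<le> n then x ^ k * b (n - k) else 0)" for n
    using card_plain_overparts_Suc[of K n, folded k_def]
    by (auto simp: a_def b_def algebra_simps simp flip: power_add)
  have shifted: "(\<Sum>n<M. if k \<le> n then x ^ k * b (n - k) else 0) \<le> x ^ k * (\<Sum>n<M. b n)" for M
  proof -
    have "(\<Sum>n<M. if k \<le> n then x ^ k * b (n - k) else 0) = (\<Sum>n\<in>{k..<M}. x ^ k * b (n - k))"
      by (rule sum.mono_neutral_cong_right) auto
    also have "\<dots> = (\<Sum>n<M - k. x ^ k * b n)"
      by (rule sum.reindex_bij_witness[of _ "\<lambda>n. n + k" "\<lambda>n. n - k"]) auto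
    also have "\<dots> \<le> (\<Sum>n<M. x ^ k * b n)"
      by (rule sum_mono2) (use b0 assms in auto)
    finally show ?thesis by (simp add: sum_distrib_left)
  qed
  have bound: "(\<Sum>n<M. b n) \<le> suminf a / (1 - x ^ k)" for M
  proof -
    have "(\<Sum>n<M. b n) = (\<Sum>n<M. a n) + (\<Sum>n<M. if k \<le> n then x ^ k * b (n - k) else 0)"
      by (subst rec) (simp add: sum.distrib)
    also have "\<dots> \<le> suminf a + x ^ k * (\<Sum>n<M. b n)"
      by (intro add_mono shifted sum_le_suminf)
        (use assms in \<open>auto simp: a_def\<close>)
    finally show ?thesis using xk by (simp add: field_simps)
  qed
  have "summable b"
    by (rule summableI_nonneg_bounded[OF b0 bound])
  then show ?thesis unfolding b_def k_def .
qed

lemma summable_bounded: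
  fixes x :: real
  assumes "0 \<le> x" "x < 1"
  shows "summable (\<lambda>n. real (card (bounded_overparts K n)) * x ^ n)"
proof (induction K)
  case 0
  have "(\<lambda>n. real (card (bounded_overparts 0 n)) * x ^ n) = (\<lambda>n. if n = 0 then 1 else 0)"
    by (auto simp: bounded_overparts_0)
  then show ?case by simp
next
  case (Suc K)
  have B: "(\<lambda>n. real (card (plain_overparts (Suc K) n)) * x ^ n) sums
      (\<Sum>n. real (card (plain_overparts (Suc K) n)) * x ^ n)"
    using summable_plain[OF assms Suc] by (rule summable_sums)
  have sm: "summable (\<lambda>n. 2 * ((if Suc K \<le> n then real (card (plain_overparts (Suc K) (n - Suc K))) else 0) * x ^ n))"
    by (rule summable_mult[OF sums_summable[OF power_series_shift[OF B]]])
  have "(\<lambda>n. real (card (bounded_overparts (Suc K) n)) * x ^ n) =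
      (\<lambda>n. real (card (bounded_overparts K n)) * x ^ n +
        2 * ((if Suc K \<le> n then real (card (plain_overparts (Suc K) (n - Suc K))) else 0) * x ^ n))"
    by (rule ext) (subst card_bounded_overparts_Suc, simp add: algebra_simps)
  with summable_add[OF Suc sm] show ?case by (simp only:)
qed

text \<open>Let \<open>A\<close> be the series for the bound \<open>K\<close>, \<open>B\<close> the
  plain one for \<open>k = Suc K\<close>. Then \<open>B = A + z^k B\<close>, and the next series is
  \<open>A + 2 z^k B\<close>. Eliminating \<open>B\<close> multiplies \<open>A\<close> by
  \<open>(1 + z^k) / (1 - z^k)\<close>.\<close>

lemma gf_bounded_overparts:
  fixes z :: "'a::{real_normed_field,banach}"
  assumes "norm z < 1"
  shows "(\<lambda>n. of_nat (card (bounded_overparts K n)) * z ^ n) sums (\<Prod>k=1..K. (1 + z ^ k) / (1 - z ^ k))"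
proof (induction K)
  case 0
  have "(\<lambda>n. of_nat (card (bounded_overparts 0 n)) * z ^ n) = (\<lambda>n. if n = 0 then 1 else 0)"
    by (auto simp: bounded_overparts_0)
  then show ?case using sums_single[of 0 "\<lambda>_. 1::'a"] by simp
next
  case (Suc K)
  let ?k = "Suc K"
  let ?a = "\<lambda>n. of_nat (card (bounded_overparts K n)) * z ^ n"
  let ?b = "\<lambda>n. of_nat (card (plain_overparts ?k n)) * z ^ n"
  have "summable (\<lambda>n. norm (?b n))"
    using summable_plain[OF _ assms summable_bounded[OF _ assms, of K]]
    by (simp add: norm_mult norm_power)
  from summable_sums[OF summable_norm_cancel[OF this]] obtain B where B: "?b sums B" ..
  have sh: "(\<lambda>n. (if ?k \<le> n then of_nat (card (plain_overparts ?k (n - ?k))) else 0) * z ^ n)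
      sums (z ^ ?k * B)"
    by (rule power_series_shift[OF B])
  define A' where "A' = (\<Prod>k=1..K. (1 + z ^ k) / (1 - z ^ k))"
  have "?b = (\<lambda>n. ?a n + (if ?k \<le> n then of_nat (card (plain_overparts ?k (n - ?k))) else 0) * z ^ n)"
    by (rule ext) (subst card_plain_overparts_Suc, simp add: algebra_simps)
  with sums_add[OF Suc[folded A'_def] sh] have "?b sums (A' + z ^ ?k * B)"
    by (simp only:)
  then have "B = A' + z ^ ?k * B" by (rule sums_unique2[OF B])
  moreover have "norm (z ^ ?k) < 1"
    using assms power_Suc_le_self[OF norm_ge_zero less_imp_le[OF assms], of K] unfolding norm_power by linarith
  then have nz: "z ^ ?k \<noteq> 1" by auto
  ultimately have B': "A' = B * (1 - z ^ ?k)"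
    unfolding right_diff_distrib by (metis add_diff_cancel_right' mult.commute mult.right_neutral)
  have "(\<lambda>n. of_nat (card (bounded_overparts ?k n)) * z ^ n) =
      (\<lambda>n. ?a n + 2 * ((if ?k \<le> n then of_nat (card (plain_overparts ?k (n - ?k))) else 0) * z ^ n))"
    by (rule ext) (subst card_bounded_overparts_Suc, simp add: algebra_simps)
  with sums_add[OF Suc[folded A'_def] sums_mult[OF sh, of 2]]
  have "(\<lambda>n. of_nat (card (bounded_overparts ?k n)) * z ^ n) sums (A' + 2 * (z ^ ?k * B))"
    by (simp only:)
  also have "A' + 2 * (z ^ ?k * B) = B * (1 + z ^ ?k)"
    unfolding B' by (simp add: algebra_simps del: power_Suc)
  also have "\<dots> = A' * ((1 + z ^ ?k) / (1 - z ^ ?k))"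
    unfolding B' using nz by (simp add: divide_simps mult_ac del: power_Suc)
  also have "\<dots> = (\<Prod>k=1..?k. (1 + z ^ k) / (1 - z ^ k))"
    unfolding A'_def by (subst prod.nat_ivl_Suc', simp, rule mult.commute)
  finally show ?case .
qed

text \<open>Below \<open>M\<close> the coefficients coincide with those of the product of
  \<open>M\<close> factors, so that product bounds the partial sum. Since
  \<open>(1 + a) / (1 - a) = 1 + 2a / (1 - a)\<close>, it is at most the exponential of a geometric
  sum, uniformly in \<open>M\<close>.\<close>

lemma summable_num_overpartitions:
  fixes x :: real
  assumes "0 \<le> x" "x < 1"
  shows "summable (\<lambda>n. real (num_overpartitions n) * x ^ n)"
proof (rule summableI_nonneg_bounded)
  fix M
  have "(\<Sum>n<M. real (num_overpartitions n) * x ^ n) = (\<Sum>n<M. real (card (bounded_overparts M n)) * x ^ n)"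
    by (intro sum.cong refl) (simp add: num_overpartitions_eq_card_bounded)
  also have "\<dots> \<le> (\<Prod>k=1..M. (1 + x ^ k) / (1 - x ^ k))"
  proof -
    have "(\<lambda>n. real (card (bounded_overparts M n)) * x ^ n) sums (\<Prod>k=1..M. (1 + x ^ k) / (1 - x ^ k))"
      using gf_bounded_overparts[of x M] assms by simp
    then have "(\<Prod>k=1..M. (1 + x ^ k) / (1 - x ^ k)) = (\<Sum>n. real (card (bounded_overparts M n)) * x ^ n)"
      by (rule sums_unique)
    moreover have "(\<Sum>n<M. real (card (bounded_overparts M n)) * x ^ n) \<le>
        (\<Sum>n. real (card (bounded_overparts M n)) * x ^ n)"
      by (rule sum_le_suminf[OF summable_bounded[OF assms]]) (use assms in auto)
    ultimately show ?thesis by (simp only:)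
  qed
  also have "\<dots> \<le> (\<Prod>k=1..M. exp (2 * x ^ k / (1 - x)))"
  proof (intro prod_mono conjI)
    fix k assume k: "k \<in> {1..M}"
    have xk: "x ^ k \<le> x" using assms k power_decreasing[of 1 k x] by simp
    show "0 \<le> (1 + x ^ k) / (1 - x ^ k)" using xk assms by auto
    have "(1 + x ^ k) / (1 - x ^ k) = 1 + 2 * x ^ k / (1 - x ^ k)"
      using xk assms by (simp add: field_simps)
    also have "\<dots> \<le> 1 + 2 * x ^ k / (1 - x)"
      using xk assms by (intro add_left_mono divide_left_mono) auto
    also have "\<dots> \<le> exp (2 * x ^ k / (1 - x))" by (rule exp_ge_add_one_self)
    finally show "(1 + x ^ k) / (1 - x ^ k) \<le> exp (2 * x ^ k / (1 - x))" .
  qed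
  also have "\<dots> = exp (2 / (1 - x) * (\<Sum>k=1..M. x ^ k))"
    by (simp add: exp_sum sum_distrib_left)
  also have "\<dots> \<le> exp (2 / (1 - x) * (\<Sum>k. x ^ k))"
    using assms by (intro exp_mono mult_left_mono sum_le_suminf) auto
  finally show "(\<Sum>n<M. real (num_overpartitions n) * x ^ n) \<le> exp (2 / (1 - x) * (\<Sum>k. x ^ k))" .
qed (use assms in auto)

definition overpartition_gf :: "complex \<Rightarrow> complex" where
  "overpartition_gf z = (\<Sum>n. of_nat (num_overpartitions n) * z ^ n)"

lemma overpartition_gf_sums:
  assumes "norm z < 1"
  shows "(\<lambda>n. of_nat (num_overpartitions n) * z ^ n) sums overpartition_gf z"
proof -
  have "summable (\<lambda>n. norm (of_nat (num_overpartitions n) * z ^ n))"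
    using summable_num_overpartitions[OF norm_ge_zero assms]
    by (simp add: norm_mult norm_power)
  then show ?thesis
    unfolding overpartition_gf_def by (rule summable_sums[OF summable_norm_cancel])
qed

text \<open>The \<open>K\<close>-th product has the right coefficients below \<open>K\<close> and
  smaller nonnegative ones beyond, so its distance to the limit is at most the tail of the full
  series at \<open>norm z\<close>.\<close>

lemma overpartition_gf_prod:
  assumes z: "norm z < 1"
  shows "(\<lambda>K. \<Prod>k=1..K. (1 + z ^ k) / (1 - z ^ k)) \<longlonglongrightarrow> overpartition_gf z"
proof -
  let ?p = "\<lambda>n. real (num_overpartitions n) * norm z ^ n"
  have sm: "summable ?p" by (rule summable_num_overpartitions[OF norm_ge_zero z])
  have tail: "(\<lambda>K. \<Sum>n. ?p (n + K)) \<longlonglongrightarrow> 0"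
    using suminf_exist_split2[OF sm] .
  have "norm ((\<Prod>k=1..K. (1 + z ^ k) / (1 - z ^ k)) - overpartition_gf z) \<le> (\<Sum>n. ?p (n + K))" for K
  proof -
    let ?d = "\<lambda>n. of_nat (card (bounded_overparts K n)) * z ^ n - of_nat (num_overpartitions n) * z ^ n"
    have "?d sums ((\<Prod>k=1..K. (1 + z ^ k) / (1 - z ^ k)) - overpartition_gf z)"
      by (intro sums_diff gf_bounded_overparts overpartition_gf_sums z)
    moreover have "?d i = 0" if "i < K" for i
      using that num_overpartitions_eq_card_bounded[of i K] by simp
    ultimately have s: "(\<lambda>n. ?d (n + K)) sums ((\<Prod>k=1..K. (1 + z ^ k) / (1 - z ^ k)) - overpartition_gf z)"
      by (subst sums_zero_iff_shift) auto
    have le: "norm (?d n) \<le> ?p n" for n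
    proof -
      have "?d n = - (of_nat (num_overpartitions n - card (bounded_overparts K n)) * z ^ n)"
        using card_bounded_overparts_le[of K n] by (simp add: of_nat_diff algebra_simps)
      also have "norm \<dots> = real (num_overpartitions n - card (bounded_overparts K n)) * norm z ^ n"
        by (simp add: norm_mult norm_power del: of_nat_diff)
      also have "\<dots> \<le> ?p n" by (intro mult_right_mono) auto
      finally show ?thesis .
    qed
    have "norm (\<Sum>n. ?d (n + K)) \<le> (\<Sum>n. ?p (n + K))"
      by (rule norm_suminf_le) (rule le, rule summable_ignore_initial_segment[OF sm])
    then show ?thesis
      by (simp only: sums_unique[OF s, symmetric])
  qed
  then have "(\<lambda>K. norm ((\<Prod>k=1..K. (1 + z ^ k) / (1 - z ^ k)) - overpartition_gf z)) \<longlonglongrightarrow> 0"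
    by (intro tendsto_sandwich[OF _ _ tendsto_const tail]) auto
  then show ?thesis by (simp add: tendsto_norm_zero_iff LIM_zero_iff)
qed

section \<open>Gauss's product for the alternating theta series\<close>

text \<open>With q-Pochhammer symbols, the weight is
  \<open>(q;q)\<^sub>n\<^sup>2 / ((q;q)\<^sub>n\<^sub>-\<^sub>j (q;q)\<^sub>n\<^sub>+\<^sub>j)\<close>. It vanishes for \<open>j > n\<close> because the truncated
  difference \<open>n - i\<close> is \<open>0\<close> for \<open>i = n\<close>.\<close>

definition gauss_weight :: "real \<Rightarrow> nat \<Rightarrow> nat \<Rightarrow> real" where
  "gauss_weight q n j = (\<Prod>i<j. (1 - q ^ (n - i)) / (1 - q ^ (n + 1 + i)))"

text \<open>Jacobi's theta function with alternating signs at argument zero, a sum over all integers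
  folded at 0.\<close>

definition theta4 :: "real \<Rightarrow> real" where
  "theta4 q = 1 + 2 * (\<Sum>j. (-1) ^ Suc j * q ^ (Suc j)\<^sup>2)"

context
  fixes q :: real
  assumes q: "0 < q" "q < 1"
begin

lemma q_power_less_one: "0 < k \<Longrightarrow> q ^ k < 1"
  using power_strict_decreasing[of 0 k q] q by simp

lemma one_minus_q_power_neq_0: "0 < k \<Longrightarrow> 1 - q ^ k \<noteq> 0"
  using q_power_less_one[of k] by auto

lemma gauss_weight_Suc_right:
  "gauss_weight q n (Suc j) * (1 - q ^ (n + 1 + j)) = gauss_weight q n j * (1 - q ^ (n - j))"
  using one_minus_q_power_neq_0[of "n + 1 + j"] by (simp add: gauss_weight_def)

text \<open>In terms of q-factorials the passage from \<open>n - 1\<close> to \<open>n\<close>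
  changes one factor in each of the four symbols. The relation is multiplied out so that it also
  covers \<open>j = n\<close>, where both sides vanish.\<close>

lemma gauss_weight_pred:
  assumes "0 < n" "j \<le> n"
  shows "gauss_weight q (n - 1) j * (1 - q ^ n)\<^sup>2 = (1 - q ^ (n - j)) * (1 - q ^ (n + j)) * gauss_weight q n j"
  using assms(2)
proof (induction j)
  case 0
  then show ?case by (simp add: gauss_weight_def power2_eq_square)
next
  case (Suc j)
  have e: "n - 1 - j = n - Suc j" "n - 1 + 1 + j = n + j" "n + Suc j = n + 1 + j"
    using assms(1) Suc.prems by auto
  have nz: "1 - q ^ (n + j) \<noteq> 0" "1 - q ^ (n + 1 + j) \<noteq> 0"
    using assms(1) by (intro one_minus_q_power_neq_0; simp)+
  have "gauss_weight q (n - 1) (Suc j) * (1 - q ^ n)\<^sup>2 * (1 - q ^ (n + j)) =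
      (gauss_weight q (n - 1) (Suc j) * (1 - q ^ (n + j))) * (1 - q ^ n)\<^sup>2"
    by (simp only: mult_ac)
  also have "\<dots> = (gauss_weight q (n - 1) j * (1 - q ^ n)\<^sup>2) * (1 - q ^ (n - Suc j))"
    using gauss_weight_Suc_right[of "n - 1" j] unfolding e by (simp only: mult_ac)
  also have "\<dots> = (1 - q ^ (n + j)) * (gauss_weight q n j * (1 - q ^ (n - j))) * (1 - q ^ (n - Suc j))"
    using Suc by (simp only: mult_ac Suc_leD)
  also have "\<dots> = ((1 - q ^ (n - Suc j)) * (1 - q ^ (n + Suc j)) * gauss_weight q n (Suc j)) * (1 - q ^ (n + j))"
    unfolding gauss_weight_Suc_right[symmetric] e by (simp only: mult_ac)
  finally show ?case using nz by simp
qed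

lemma gauss_weight_beyond: "n < j \<Longrightarrow> gauss_weight q n j = 0"
  unfolding gauss_weight_def by (rule prod_zero[OF _ bexI[of _ n]]) auto

lemma gauss_weight_bounds: "0 \<le> gauss_weight q n j" "gauss_weight q n j \<le> 1"
proof -
  have *: "0 \<le> (1 - q ^ (n - i)) / (1 - q ^ (n + 1 + i)) \<and> (1 - q ^ (n - i)) / (1 - q ^ (n + 1 + i)) \<le> 1" for i
  proof -
    have "q ^ (n + 1 + i) \<le> q ^ (n - i)"
      using q by (intro power_decreasing) auto
    moreover have "q ^ (n - i) \<le> 1"
      using q by (intro power_le_one) auto
    moreover have "q ^ (n + 1 + i) < 1" by (rule q_power_less_one) simp
    ultimately show ?thesis by (simp add: divide_simps)
  qed
  show "0 \<le> gauss_weight q n j" "gauss_weight q n j \<le> 1"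
    unfolding gauss_weight_def using * by (auto intro!: prod_nonneg prod_le_1)
qed

lemma gauss_weight_tendsto: "(\<lambda>n. gauss_weight q n j) \<longlonglongrightarrow> 1"
proof -
  have "(\<lambda>n. (1 - q ^ (n - i)) / (1 - q ^ (n + 1 + i))) \<longlonglongrightarrow> (1 - 0) / (1 - 0)" for i
  proof (intro tendsto_intros)
    have "(\<lambda>n. q ^ n) \<longlonglongrightarrow> 0" using q by (intro LIMSEQ_power_zero) auto
    then show "(\<lambda>n. q ^ (n + 1 + i)) \<longlonglongrightarrow> 0" "(\<lambda>n. q ^ (n - i)) \<longlonglongrightarrow> 0"
      by (simp_all only: add.assoc LIMSEQ_ignore_initial_segment)
        (rule LIMSEQ_offset[where k = i], simp)
  qed auto
  then have "(\<lambda>n. \<Prod>i<j. (1 - q ^ (n - i)) / (1 - q ^ (n + 1 + i))) \<longlonglongrightarrow> (\<Prod>i<j. (1 - 0) / (1 - 0))"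
    by (intro tendsto_prod)
  then show ?thesis unfolding gauss_weight_def by simp
qed

text \<open>The discrete primitive witnessing that the two sides of the recurrence below differ by a
  telescoping sum.\<close>

lemma gauss_telescope_step:
  defines "t \<equiv> (\<lambda>n j. (-1) ^ j * q ^ j\<^sup>2 * gauss_weight q n j)"
  defines "d \<equiv> (\<lambda>n j. (-1) ^ j * q ^ (j\<^sup>2 + n + j) * (1 - q ^ (n - j)) * gauss_weight q n j / (1 - q ^ n))"
  assumes "j < n"
  shows "(1 + q ^ n) * t n (Suc j) - (1 - q ^ n) * t (n - 1) (Suc j) = d n (Suc j) - d n j"
proof -
  obtain k where n: "n = Suc (j + k)" using assms(3) less_imp_Suc_add by blast
  define u where "u = q ^ k"
  define v where "v = q ^ (n + 1 + j)"
  define c where "c = (-1) ^ Suc j * q ^ (Suc j)\<^sup>2"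
  define W where "W = gauss_weight q n (Suc j)"
  define y where "y = 1 - q ^ n"
  have y: "y \<noteq> 0" unfolding y_def using n by (intro one_minus_q_power_neq_0) simp
  have uv: "u * v = (q ^ n)\<^sup>2"
    unfolding u_def v_def n power2_eq_square by (simp add: ac_simps flip: power_add)
  have sub: "n - Suc j = k" "n + Suc j = n + 1 + j" "n - j = Suc k" using n by auto
  have pred: "gauss_weight q (n - 1) (Suc j) * y\<^sup>2 = (1 - u) * (1 - v) * W"
    using gauss_weight_pred[of n "Suc j"] n unfolding y_def u_def v_def W_def sub by simp
  have "(-1) ^ j * q ^ (j\<^sup>2 + n + j) * ((1 - q ^ (n - j)) * gauss_weight q n j) = - c * u * (W * (1 - v))"
  proof -
    have "(-1) ^ j * q ^ (j\<^sup>2 + n + j) = - c * u"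
      unfolding c_def u_def n by (simp add: power2_eq_square algebra_simps flip: power_add)
    then show ?thesis
      using gauss_weight_Suc_right[of n j] by (simp add: W_def v_def mult_ac)
  qed
  then have dj: "d n j = - c * u * (1 - v) * W / y"
    unfolding d_def y_def by (simp add: mult_ac)
  have dS: "d n (Suc j) = c * v * (1 - u) * W / y"
    unfolding d_def y_def c_def v_def u_def W_def sub by (simp add: ac_simps flip: power_add)
  have "y * (1 - y + 1) = 1 - u * v"
    unfolding uv y_def by (simp add: power2_eq_square algebra_simps)
  then have h1: "y * (1 + q ^ n) = 1 - u * v"
    by (simp add: y_def add.commute)
  have h2: "t n (Suc j) = c * W" "t (n - 1) (Suc j) = c * gauss_weight q (n - 1) (Suc j)"
    by (simp_all add: t_def c_def W_def)
  have "y * ((1 + q ^ n) * t n (Suc j) - (1 - q ^ n) * t (n - 1) (Suc j)) =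
      (y * (1 + q ^ n)) * (c * W) - c * (gauss_weight q (n - 1) (Suc j) * y\<^sup>2)"
    unfolding h2 by (simp add: y_def power2_eq_square algebra_simps)
  \<comment> \<open>The point of the substitution:
    \<open>(1 - u v) - (1 - u)(1 - v) = v (1 - u) + u (1 - v)\<close>, and the two summands belong
    to \<open>d\<close> at \<open>Suc j\<close> and to minus \<open>d\<close> at
    \<open>j\<close>.\<close>
  also have "\<dots> = c * v * (1 - u) * W + c * u * (1 - v) * W"
    unfolding h1 pred by (simp add: algebra_simps)
  also have "\<dots> = y * (d n (Suc j) - d n j)"
    unfolding dj dS using y by (simp add: field_simps)
  finally have "y * ((1 + q ^ n) * t n (Suc j) - (1 - q ^ n) * t (n - 1) (Suc j)) = y * (d n (Suc j) - d n j)" .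
  then show ?thesis using y by simp
qed

text \<open>A finite form of Gauss's identity. If \<open>S n\<close> denotes the left side,
  telescoping gives \<open>(1 + q^n) S n = (1 - q^n) S (n - 1)\<close>, the recurrence of the
  product.\<close>

lemma gauss_finite:
  "1 + 2 * (\<Sum>j<n. (-1) ^ Suc j * q ^ (Suc j)\<^sup>2 * gauss_weight q n (Suc j)) = (\<Prod>k=1..n. (1 - q ^ k) / (1 + q ^ k))"
proof (induction n)
  case 0
  then show ?case by simp
next
  case (Suc m)
  define n where "n = Suc m"
  define t where "t = (\<lambda>n j. (-1) ^ j * q ^ j\<^sup>2 * gauss_weight q n j)"
  define d where "d = (\<lambda>n j. (-1) ^ j * q ^ (j\<^sup>2 + n + j) * (1 - q ^ (n - j)) * gauss_weight q n j / (1 - q ^ n))"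
  have pos: "1 + q ^ n > 0" using q by (simp add: add_pos_nonneg)
  \<comment> \<open>The sums for \<open>m\<close> and \<open>n = Suc m\<close> may share the range
    \<open>j < n\<close>: the extra term of the former has weight zero.\<close>
  have last: "(\<Sum>j<n. t m (Suc j)) = (\<Sum>j<m. t m (Suc j))"
    unfolding n_def by (simp add: t_def gauss_weight_beyond)
  have "(1 + q ^ n) * (\<Sum>j<n. t n (Suc j)) - (1 - q ^ n) * (\<Sum>j<n. t m (Suc j)) = (\<Sum>j<n. d n (Suc j) - d n j)"
    unfolding sum_distrib_left sum_subtractf[symmetric]
    using gauss_telescope_step[of _ n] by (intro sum.cong refl) (simp add: t_def d_def n_def)
  also have "\<dots> = d n n - d n 0" by (rule sum_lessThan_telescope)
  \<comment> \<open>At \<open>j = n\<close> the factor \<open>1 - q^(n - j)\<close> vanishes, so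
    only \<open>d n 0 = q^n\<close> survives. Doubled, it is exactly what the constant 1 in the sums
    requires.\<close>
  also have "\<dots> = - (q ^ n)"
    using one_minus_q_power_neq_0[of n] by (simp add: d_def gauss_weight_def n_def del: power_Suc)
  finally have "(1 + q ^ n) * (1 + 2 * (\<Sum>j<n. t n (Suc j))) = (1 - q ^ n) * (1 + 2 * (\<Sum>j<m. t m (Suc j)))"
    unfolding last by (simp add: algebra_simps)
  then have "1 + 2 * (\<Sum>j<n. t n (Suc j)) = (1 - q ^ n) / (1 + q ^ n) * (1 + 2 * (\<Sum>j<m. t m (Suc j)))"
    using pos by (simp add: field_simps)
  then show ?case
    unfolding n_def t_def Suc by (subst prod.nat_ivl_Suc') simp_all
qed

text \<open>The weights lie between 0 and 1 and tend to 1, so \<open>q^j\<close> dominates the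
  summands for all \<open>n\<close> and Tannery's theorem applies to the finite identity.\<close>

lemma gauss_product_tendsto: "(\<lambda>n. \<Prod>k=1..n. (1 - q ^ k) / (1 + q ^ k)) \<longlonglongrightarrow> theta4 q"
proof -
  define a where "a = (\<lambda>j n. (-1) ^ Suc j * q ^ (Suc j)\<^sup>2 * gauss_weight q n (Suc j))"
  have "((\<lambda>n. suminf (\<lambda>j. a j n)) \<longlongrightarrow> suminf (\<lambda>j. (-1) ^ Suc j * q ^ (Suc j)\<^sup>2)) sequentially"
  proof (rule tannerys_theorem[THEN conjunct2, THEN conjunct2])
    show "((\<lambda>n. a j n) \<longlongrightarrow> (-1) ^ Suc j * q ^ (Suc j)\<^sup>2) sequentially" for j
      using tendsto_mult[OF tendsto_const[of "(-1) ^ Suc j * q ^ (Suc j)\<^sup>2"] gauss_weight_tendsto[of "Suc j"]]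
      unfolding a_def by (simp only: mult_1_right)
    have "norm (a j n) \<le> q ^ j" for j n
    proof -
      have "norm (a j n) = q ^ (Suc j)\<^sup>2 * gauss_weight q n (Suc j)"
        using q gauss_weight_bounds[of n "Suc j"] by (simp add: a_def abs_mult power_abs)
      also have "\<dots> \<le> q ^ j * 1"
        using q gauss_weight_bounds[of n "Suc j"]
        by (intro mult_mono power_decreasing) (auto simp: power2_eq_square)
      finally show ?thesis by simp
    qed
    then show "\<forall>\<^sub>F (j, n) in at_top \<times>\<^sub>F sequentially. norm (a j n) \<le> q ^ j"
      by (intro always_eventually) auto
    show "summable (\<lambda>j. q ^ j)" using q by simp
  qed simp
  then have "(\<lambda>n. 1 + 2 * (\<Sum>j. a j n)) \<longlonglongrightarrow> theta4 q"
    unfolding theta4_def by (intro tendsto_intros)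
  moreover have "(\<Sum>j. a j n) = (\<Sum>j<n. a j n)" for n
    by (rule suminf_finite) (auto simp: a_def gauss_weight_beyond)
  ultimately show ?thesis
    by (simp only: a_def gauss_finite)
qed

end

section \<open>Polya's proof of the theta inversion formula\<close>

text \<open>The terms \<open>m + d\<close> and \<open>m - d\<close> of the binomial expansion of
  \<open>(cis x + cis (- x))^(2m)\<close> have equal coefficients and opposite frequencies.\<close>

lemma two_cos_power_even:
  fixes x :: real
  shows "(2 * cos x) ^ (2 * m) =
    real (2 * m choose m) + 2 * (\<Sum>d=1..m. real (2 * m choose (m + d)) * cos (2 * real d * x))"
proof -
  define f where "f j = real (2 * m choose j) * cos (2 * (real j - real m) * x)" for j
  have "complex_of_real ((2 * cos x) ^ (2 * m)) = (cis x + cis (- x)) ^ (2 * m)"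
  proof -
    have "cis x + cis (- x) = complex_of_real (2 * cos x)" by (simp add: complex_eq_iff)
    then show ?thesis by simp
  qed
  also have "\<dots> = (\<Sum>j\<le>2 * m. of_nat (2 * m choose j) * cis x ^ j * cis (- x) ^ (2 * m - j))"
    by (rule binomial_ring)
  also have "\<dots> = (\<Sum>j\<le>2 * m. of_nat (2 * m choose j) * cis (2 * (real j - real m) * x))"
  proof (intro sum.cong refl)
    fix j assume "j \<in> {..2 * m}"
    then have "real j * x + real (2 * m - j) * (- x) = 2 * (real j - real m) * x"
      by (simp add: of_nat_diff algebra_simps)
    then have "cis x ^ j * cis (- x) ^ (2 * m - j) = cis (2 * (real j - real m) * x)"
      by (simp only: Complex.DeMoivre cis_mult)
    then show "of_nat (2 * m choose j) * cis x ^ j * cis (- x) ^ (2 * m - j) =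
        of_nat (2 * m choose j) * cis (2 * (real j - real m) * x)"
      by (simp only: mult.assoc)
  qed
  finally have "Re (complex_of_real ((2 * cos x) ^ (2 * m))) =
      Re (\<Sum>j\<le>2 * m. of_nat (2 * m choose j) * cis (2 * (real j - real m) * x))" by (rule arg_cong)
  then have "(2 * cos x) ^ (2 * m) = (\<Sum>j\<le>2 * m. f j)"
    unfolding f_def by (simp only: Re_complex_of_real Re_sum) simp
  also have "{..2 * m} = {m} \<union> ((\<lambda>d. m + d) ` {1..m} \<union> (\<lambda>d. m - d) ` {1..m})"
  proof (rule set_eqI)
    fix j show "j \<in> {..2 * m} \<longleftrightarrow> j \<in> {m} \<union> ((\<lambda>d. m + d) ` {1..m} \<union> (\<lambda>d. m - d) ` {1..m})"
    proof
      assume "j \<in> {..2 * m}"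
      then have "j = m \<or> j = m + (j - m) \<and> j - m \<in> {1..m} \<or> j = m - (m - j) \<and> m - j \<in> {1..m}" by auto
      then show "j \<in> {m} \<union> ((\<lambda>d. m + d) ` {1..m} \<union> (\<lambda>d. m - d) ` {1..m})" by blast
    qed auto
  qed
  also have "(\<Sum>j\<in>{m} \<union> ((\<lambda>d. m + d) ` {1..m} \<union> (\<lambda>d. m - d) ` {1..m}). f j) =
      f m + ((\<Sum>j\<in>(\<lambda>d. m + d) ` {1..m}. f j) + (\<Sum>j\<in>(\<lambda>d. m - d) ` {1..m}. f j))"
    by (subst sum.union_disjoint; (subst sum.union_disjoint)?) auto
  also have "(\<Sum>j\<in>(\<lambda>d. m + d) ` {1..m}. f j) = (\<Sum>d=1..m. f (m + d))"
    by (subst sum.reindex) (auto simp: inj_on_def)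
  also have "(\<Sum>j\<in>(\<lambda>d. m - d) ` {1..m}. f j) = (\<Sum>d=1..m. f (m - d))"
    by (subst sum.reindex) (auto simp: inj_on_def)
  also have "(\<Sum>d=1..m. f (m - d)) = (\<Sum>d=1..m. f (m + d))"
  proof (intro sum.cong refl)
    fix d assume "d \<in> {1..m}"
    then have d: "d \<le> m" by simp
    have "2 * m choose (m - d) = 2 * m choose (2 * m - (m - d))"
      using d by (intro binomial_symmetric) auto
    also have "2 * m - (m - d) = m + d" using d by simp
    finally show "f (m - d) = f (m + d)"
      using d by (simp add: f_def of_nat_diff)
  qed
  finally show ?thesis
    by (simp add: f_def)
qed

text \<open>The numbers \<open>cis (2x)\<close> at these angles are the \<open>l\<close>-th roots of
  -1. Powers with an exponent not divisible by \<open>l\<close> sum to zero, and the exponent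
  \<open>v l\<close> contributes the sign \<open>(-1)^v\<close>. In the first case multiplication by
  \<open>2 sin \<theta>\<close> makes the sum telescope.\<close>

lemma sum_cos_odd_multiples:
  assumes l: "0 < l"
  shows "(\<Sum>k<l. cos (2 * real d * (pi * (real k + 1 / 2) / real l))) =
    (if l dvd d then real l * (-1) ^ (d div l) else 0)"
proof (cases "l dvd d")
  case True
  then obtain v where v: "d = l * v" by blast
  have "cos (2 * real d * (pi * (real k + 1 / 2) / real l)) = (-1) ^ v" for k
  proof -
    have "2 * real d * (pi * (real k + 1 / 2) / real l) = real (v * (2 * k + 1)) * pi"
      using l by (simp add: v field_simps)
    then have "cos (2 * real d * (pi * (real k + 1 / 2) / real l)) = (-1) ^ (v * (2 * k + 1))"
      by (simp only: cos_npi)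
    also have "\<dots> = (-1) ^ v" by (simp add: minus_one_power_iff)
    finally show ?thesis .
  qed
  then show ?thesis using True l by (simp add: v)
next
  case False
  define \<theta> where "\<theta> = pi * real d / real l"
  have s: "sin \<theta> \<noteq> 0"
  proof
    assume "sin \<theta> = 0"
    then obtain i :: int where i: "\<theta> = real_of_int i * pi" using sin_zero_iff_int2 by blast
    then have "real d = real_of_int i * real l" using l by (simp add: \<theta>_def field_simps)
    then have "int d = i * int l" by (metis of_int_eq_iff of_int_mult of_int_of_nat_eq)
    then have "int l dvd int d" by simp
    with False show False by simp
  qed
  have "2 * sin \<theta> * (\<Sum>k<l. cos (2 * real d * (pi * (real k + 1 / 2) / real l))) =
      (\<Sum>k<l. sin (2 * real (Suc k) * \<theta>) - sin (2 * real k * \<theta>))"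
    unfolding sum_distrib_left
  proof (intro sum.cong refl)
    fix k
    have e: "2 * real d * (pi * (real k + 1 / 2) / real l) = (2 * real k + 1) * \<theta>"
      using l by (simp add: \<theta>_def field_simps)
    have "sin (2 * real (Suc k) * \<theta>) = sin ((2 * real k + 1) * \<theta> + \<theta>)"
      "sin (2 * real k * \<theta>) = sin ((2 * real k + 1) * \<theta> - \<theta>)"
      by (simp_all add: algebra_simps)
    then show "2 * sin \<theta> * cos (2 * real d * (pi * (real k + 1 / 2) / real l)) =
        sin (2 * real (Suc k) * \<theta>) - sin (2 * real k * \<theta>)"
      unfolding e sin_add sin_diff by simp
  qed
  also have "\<dots> = sin (2 * real l * \<theta>) - sin (2 * real 0 * \<theta>)"
    by (rule sum_lessThan_telescope)
  also have "2 * real l * \<theta> = real (2 * d) * pi" using l by (simp add: \<theta>_def)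
  then have "sin (2 * real l * \<theta>) = 0" by (simp only: sin_npi)
  finally show ?thesis using s False by simp
qed

text \<open>Only binomial coefficients at distance \<open>v l\<close> from the centre survive the
  summation. Those with \<open>v l > m\<close> are zero, so \<open>v\<close> may run up to
  \<open>m\<close> whatever \<open>l\<close> is.\<close>

lemma cos_power_filter:
  assumes l: "0 < l"
  shows "(\<Sum>k<l. (2 * cos (pi * (real k + 1 / 2) / real l)) ^ (2 * m)) =
    real l * (real (2 * m choose m) + 2 * (\<Sum>v=1..m. (-1) ^ v * real (2 * m choose (m + v * l))))"
proof -
  let ?x = "\<lambda>k. pi * (real k + 1 / 2) / real l"
  let ?b = "\<lambda>d. real (2 * m choose (m + d))"
  let ?h = "\<lambda>d. if l dvd d then (-1) ^ (d div l) * ?b d else (0::real)"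
  have "(\<Sum>k<l. (2 * cos (?x k)) ^ (2 * m)) =
      real l * ?b 0 + 2 * (\<Sum>k<l. \<Sum>d=1..m. ?b d * cos (2 * real d * ?x k))"
    unfolding two_cos_power_even by (simp add: sum.distrib sum_distrib_left)
  also have "(\<Sum>k<l. \<Sum>d=1..m. ?b d * cos (2 * real d * ?x k)) = (\<Sum>d=1..m. ?b d * (\<Sum>k<l. cos (2 * real d * ?x k)))"
    unfolding sum_distrib_left by (rule sum.swap)
  also have "\<dots> = (\<Sum>d=1..m. real l * ?h d)"
    unfolding sum_cos_odd_multiples[OF l] by (intro sum.cong refl) auto
  also have "\<dots> = real l * (\<Sum>d=1..m. ?h d)" by (simp only: sum_distrib_left)
  also have "(\<Sum>d=1..m. ?h d) = (\<Sum>v=1..m. (-1) ^ v * ?b (v * l))"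
  proof -
    have "(\<Sum>d=1..m. ?h d) = (\<Sum>d\<in>{d \<in> {1..m}. l dvd d}. ?h d)"
      by (rule sum.mono_neutral_right) auto
    also have "\<dots> = (\<Sum>v\<in>{v \<in> {1..m}. v * l \<le> m}. (-1) ^ v * ?b (v * l))"
    proof (rule sum.reindex_bij_witness[of _ "\<lambda>v. v * l" "\<lambda>d. d div l"])
      fix d assume "d \<in> {d \<in> {1..m}. l dvd d}"
      then have d: "1 \<le> d" "d \<le> m" "l dvd d" by auto
      from d(3) obtain v where v: "d = v * l" by (metis dvd_def mult.commute)
      show "d div l * l = d" using v l by simp
      have "v \<le> v * l" using l by simp
      then have "v \<le> m" using d v by linarith
      moreover have "1 \<le> v" using d v by (cases v) auto
      ultimately show "d div l \<in> {v \<in> {1..m}. v * l \<le> m}" using d v l by auto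
      show "(-1) ^ (d div l) * ?b (d div l * l) = ?h d" using v l by simp
    next
      fix v assume v: "v \<in> {v \<in> {1..m}. v * l \<le> m}"
      show "v * l div l = v" using l by simp
      show "v * l \<in> {d \<in> {1..m}. l dvd d}" using v l by auto
    qed
    also have "\<dots> = (\<Sum>v=1..m. (-1) ^ v * ?b (v * l))"
      by (rule sum.mono_neutral_left) (auto simp: binomial_eq_0)
    finally show ?thesis .
  qed
  finally show ?thesis by (simp add: algebra_simps)
qed

section \<open>Binomial coefficients near the centre\<close>

lemma central_binomial_tendsto: "(\<lambda>n. sqrt (real n) * (real (2 * n choose n) / 4 ^ n)) \<longlonglongrightarrow> 1 / sqrt pi"
proof -
  define b where "b n = real (2 * n choose n) / 4 ^ n" for n
  have bSuc: "b (Suc n) = b n * (2 * real n + 1) / (2 * real n + 2)" for n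
  proof -
    have bf: "b n = fact (2 * n) / ((fact n)\<^sup>2 * 4 ^ n)" for n
      by (simp add: b_def binomial_fact power2_eq_square mult_2)
    define A D where "A = 2 * real n + 2" and "D = 2 * real n + 1"
    have "2 * Suc n = Suc (Suc (2 * n))" by simp
    then have e1: "fact (2 * Suc n) = A * (D * fact (2 * n))"
      by (simp only: fact_Suc) (simp add: A_def D_def algebra_simps)
    have e2: "(fact (Suc n))\<^sup>2 * 4 ^ Suc n = A\<^sup>2 * ((fact n)\<^sup>2 * 4 ^ n)"
      by (simp add: A_def power2_eq_square algebra_simps)
    have "A \<noteq> 0" unfolding A_def by linarith
    then show ?thesis
      unfolding bf e1 e2 A_def[symmetric] D_def[symmetric] by (simp add: power2_eq_square mult_ac)
  qed
  have wal: "(\<Prod>k=1..n. (4 * real k ^ 2) / (4 * real k ^ 2 - 1)) = 1 / ((b n)\<^sup>2 * (2 * real n + 1))" for n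
  proof (induction n)
    case 0
    then show ?case by (simp add: b_def)
  next
    case (Suc n)
    have pos: "b n > 0" by (simp add: b_def)
    have e: "4 * real (Suc n) ^ 2 - 1 = (2 * real n + 1) * (2 * real n + 3)" "4 * real (Suc n) ^ 2 = (2 * real n + 2)\<^sup>2"
      by (simp_all add: power2_eq_square algebra_simps)
    have "(\<Prod>k=1..Suc n. (4 * real k ^ 2) / (4 * real k ^ 2 - 1)) =
        (2 * real n + 2)\<^sup>2 / ((2 * real n + 1) * (2 * real n + 3)) * (1 / ((b n)\<^sup>2 * (2 * real n + 1)))"
      unfolding Suc[symmetric] e[symmetric] by (subst prod.nat_ivl_Suc') simp_all
    also have "\<dots> = 1 / ((b (Suc n))\<^sup>2 * (2 * real (Suc n) + 1))"
      unfolding bSuc using pos by (simp add: power2_eq_square divide_simps)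
    finally show ?case .
  qed
  \<comment> \<open>Wallis' product is a closed expression in the central binomial coefficient, so
    it determines the limit of \<open>n (b n)^2\<close>.\<close>
  have "(\<lambda>n. 1 / ((b n)\<^sup>2 * (2 * real n + 1))) \<longlonglongrightarrow> pi / 2"
    using wallis unfolding wal .
  then have "(\<lambda>n. inverse (1 / ((b n)\<^sup>2 * (2 * real n + 1)))) \<longlonglongrightarrow> inverse (pi / 2)"
    by (rule tendsto_inverse) simp
  moreover have "(\<lambda>n. real n / (2 * real n + 1)) \<longlonglongrightarrow> 1 / 2" by real_asymp
  ultimately have "(\<lambda>n. inverse (1 / ((b n)\<^sup>2 * (2 * real n + 1))) * (real n / (2 * real n + 1))) \<longlonglongrightarrow> inverse (pi / 2) * (1 / 2)"
    by (rule tendsto_mult)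
  also have "(\<lambda>n. inverse (1 / ((b n)\<^sup>2 * (2 * real n + 1))) * (real n / (2 * real n + 1))) = (\<lambda>n. (sqrt (real n) * b n)\<^sup>2)"
  proof
    fix n :: nat
    have "2 * real n + 1 \<noteq> 0" by linarith
    then show "inverse (1 / ((b n)\<^sup>2 * (2 * real n + 1))) * (real n / (2 * real n + 1)) = (sqrt (real n) * b n)\<^sup>2"
      by (simp add: power_mult_distrib)
  qed
  finally have "(\<lambda>n. sqrt ((sqrt (real n) * b n)\<^sup>2)) \<longlonglongrightarrow> sqrt (inverse (pi / 2) * (1 / 2))"
    by (rule tendsto_real_sqrt)
  moreover have "sqrt ((sqrt (real n) * b n)\<^sup>2) = sqrt (real n) * b n" for n
    by (simp add: b_def)
  ultimately show ?thesis
    by (simp add: b_def real_sqrt_divide real_sqrt_inverse inverse_eq_divide)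
qed

text \<open>The quotient of an off-centre and the central binomial coefficient of order
  \<open>2 * m\<close>. Truncated subtraction makes it vanish for \<open>d > m\<close>.\<close>

definition binomial_decay :: "nat \<Rightarrow> nat \<Rightarrow> real" where
  "binomial_decay m d = (\<Prod>i<d. real (m - i) / real (m + 1 + i))"

lemma binomial_off_center: "real (2 * m choose (m + d)) = real (2 * m choose m) * binomial_decay m d"
proof (induction d)
  case 0
  then show ?case by (simp add: binomial_decay_def)
next
  case (Suc d)
  have "Suc (m + d) * (2 * m choose Suc (m + d)) = (2 * m - (m + d)) * (2 * m choose (m + d))"
    using binomial_absorption[of "m + d" "2 * m"] binomial_absorb_comp[of "2 * m" "m + d"] by simp
  then have "real (m + 1 + d) * real (2 * m choose (m + Suc d)) = real (m - d) * real (2 * m choose (m + d))"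
    by (metis add.commute add_Suc_right diff_diff_left diff_add_inverse mult_2 of_nat_mult plus_1_eq_Suc add.assoc)
  then have "real (2 * m choose (m + Suc d)) = real (2 * m choose (m + d)) * (real (m - d) / real (m + 1 + d))"
    by (simp add: field_simps)
  then show ?case using Suc by (simp add: binomial_decay_def)
qed

lemma sum_odd_numbers: "(\<Sum>i<d. 2 * real i + 1) = (real d)\<^sup>2"
  by (induction d) (simp_all add: power2_eq_square algebra_simps)

lemma binomial_decay_nonneg: "0 \<le> binomial_decay m d"
  unfolding binomial_decay_def by (intro prod_nonneg) auto

lemma binomial_decay_beyond: "m < d \<Longrightarrow> binomial_decay m d = 0"
  unfolding binomial_decay_def by (rule prod_zero[OF _ bexI[of _ m]]) auto

text \<open>Each factor is \<open>1 - (2i + 1) / (m + 1 + i)\<close>, at most an exponential;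
  enlarging the denominators to \<open>m + d\<close> leaves the sum of the first \<open>d\<close>
  odd numbers, which is \<open>d^2\<close>.\<close>

lemma binomial_decay_upper: "binomial_decay m d \<le> exp (- ((real d)\<^sup>2 / (real m + real d)))"
proof -
  have "real (m - i) / real (m + 1 + i) \<le> exp (- ((2 * real i + 1) / (real m + real d)))" if i: "i < d" for i
  proof (cases "i \<le> m")
    case True
    have "real (m - i) / real (m + 1 + i) = 1 + - ((2 * real i + 1) / (real m + 1 + real i))"
      using True by (simp add: field_simps of_nat_diff)
    also have "\<dots> \<le> 1 + - ((2 * real i + 1) / (real m + real d))"
      using i by (intro add_left_mono le_imp_neg_le divide_left_mono) auto
    also have "\<dots> \<le> exp (- ((2 * real i + 1) / (real m + real d)))"
      by (rule exp_ge_add_one_self)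
    finally show ?thesis .
  qed simp
  then have "binomial_decay m d \<le> (\<Prod>i<d. exp (- ((2 * real i + 1) / (real m + real d))))"
    unfolding binomial_decay_def by (intro prod_mono) auto
  also have "\<dots> = exp (- ((real d)\<^sup>2 / (real m + real d)))"
    by (simp flip: exp_sum add: sum_negf sum_divide_distrib[symmetric] sum_odd_numbers)
  finally show ?thesis .
qed

text \<open>The same estimate for the reciprocal factors \<open>1 + (2i + 1) / (m - i)\<close>. For
  \<open>d\<close> small against \<open>m\<close> both bounds are close to
  \<open>exp (- d^2/m)\<close>.\<close>

lemma binomial_decay_lower:
  assumes "d < m"
  shows "exp (- ((real d)\<^sup>2 / (real m - real d))) \<le> binomial_decay m d"
proof -
  have "exp (- ((2 * real i + 1) / (real m - real d))) \<le> real (m - i) / real (m + 1 + i)" if i: "i < d" for i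
  proof -
    have pos: "real m - real i > 0" using i assms by simp
    have "real (m + 1 + i) / real (m - i) = 1 + (2 * real i + 1) / (real m - real i)"
      using i assms pos by (simp add: field_simps of_nat_diff)
    also have "\<dots> \<le> exp ((2 * real i + 1) / (real m - real i))"
      by (rule exp_ge_add_one_self)
    also have "\<dots> \<le> exp ((2 * real i + 1) / (real m - real d))"
      using i assms by (intro exp_mono divide_left_mono) auto
    finally have "real (m + 1 + i) / real (m - i) \<le> exp ((2 * real i + 1) / (real m - real d))" .
    moreover have "real (m - i) > 0" using i assms by simp
    ultimately show ?thesis by (simp add: exp_minus divide_simps mult_ac del: of_nat_diff of_nat_add)
  qed
  then have "(\<Prod>i<d. exp (- ((2 * real i + 1) / (real m - real d)))) \<le> binomial_decay m d"
    unfolding binomial_decay_def by (intro prod_mono) auto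
  moreover have "(\<Prod>i<d. exp (- ((2 * real i + 1) / (real m - real d)))) = exp (- ((real d)\<^sup>2 / (real m - real d)))"
    by (simp flip: exp_sum add: sum_negf sum_divide_distrib[symmetric] sum_odd_numbers)
  ultimately show ?thesis by simp
qed

lemma one_minus_power_tendsto_exp:
  fixes s :: "nat \<Rightarrow> real"
  assumes s: "\<And>n. 0 \<le> s n" "s \<longlonglongrightarrow> 0" and c: "(\<lambda>n. real n * s n) \<longlonglongrightarrow> c"
  shows "(\<lambda>n. (1 - s n) ^ n) \<longlonglongrightarrow> exp (- c)"
proof (rule tendsto_sandwich)
  have ev: "\<forall>\<^sub>F n in sequentially. s n < 1" using s(2) by (rule order_tendstoD) simp
  show "\<forall>\<^sub>F n in sequentially. (1 - s n) ^ n \<le> exp (- (real n * s n))"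
    using ev
  proof eventually_elim
    case (elim n)
    have "(1 - s n) ^ n \<le> exp (- s n) ^ n"
      using exp_ge_add_one_self[of "- s n"] elim by (intro power_mono) auto
    then show ?case by (simp add: exp_of_nat_mult[symmetric])
  qed
  show "\<forall>\<^sub>F n in sequentially. exp (- (real n * s n / (1 - s n))) \<le> (1 - s n) ^ n"
    using ev
  proof eventually_elim
    case (elim n)
    have "1 / (1 - s n) = 1 + s n / (1 - s n)" using elim by (simp add: field_simps)
    also have "\<dots> \<le> exp (s n / (1 - s n))" by (rule exp_ge_add_one_self)
    finally have "exp (- (s n / (1 - s n))) \<le> 1 - s n"
      using elim by (simp add: exp_minus field_simps)
    then have "exp (- (s n / (1 - s n))) ^ n \<le> (1 - s n) ^ n" by (intro power_mono) auto
    then show ?case by (simp add: exp_of_nat_mult[symmetric])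
  qed
  have "(\<lambda>n. exp (- (real n * s n / (1 - s n)))) \<longlonglongrightarrow> exp (- (c / (1 - 0)))"
    by (intro tendsto_intros s c) simp
  then show "(\<lambda>n. exp (- (real n * s n / (1 - s n)))) \<longlonglongrightarrow> exp (- c)" by simp
  show "(\<lambda>n. exp (- (real n * s n))) \<longlonglongrightarrow> exp (- c)" by (intro tendsto_intros c)
qed

text \<open>A weak form of Jordan's inequality. It supplies the summable majorant for the cosine
  sums and a lower bound for \<open>1 - cos y\<close> off the real axis.\<close>

lemma sin_ge_half:
  fixes x :: real
  assumes "0 \<le> x" "x \<le> pi / 2"
  shows "x / 2 \<le> sin x"
proof -
  have "\<bar>sin x - (\<Sum>m<3. sin_coeff m * x ^ m)\<bar> \<le> inverse (fact 3) * \<bar>x\<bar> ^ 3"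
    by (rule Maclaurin_sin_bound)
  moreover have "(\<Sum>m<3. sin_coeff m * x ^ m) = x"
    by (simp add: sin_coeff_def numeral_3_eq_3)
  moreover have "inverse (fact 3) * \<bar>x\<bar> ^ 3 \<le> x / 2"
  proof -
    have "x \<le> 1.6" using assms order_trans[OF pi_approx(2), of "3.15"] by simp
    then have "x * x \<le> 1.6 * 1.6" using assms by (intro mult_mono) auto
    then have "x * (x * x) \<le> x * 3" using assms by (intro mult_left_mono) auto
    then show ?thesis using assms by (simp add: fact_numeral power3_eq_cube)
  qed
  ultimately show ?thesis by linarith
qed

text \<open>The domination may start at some \<open>n\<close>, provided the start does not depend on
  \<open>k\<close>.\<close>

lemma tannery_eventually:
  fixes a :: "nat \<Rightarrow> nat \<Rightarrow> real"
  assumes "\<And>k. (\<lambda>n. a k n) \<longlonglongrightarrow> b k" "\<forall>\<^sub>F n in sequentially. \<forall>k. \<bar>a k n\<bar> \<le> M k" "summable M"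
  shows "(\<lambda>n. \<Sum>k. a k n) \<longlonglongrightarrow> (\<Sum>k. b k)"
proof (rule tannerys_theorem[THEN conjunct2, THEN conjunct2])
  have "\<forall>\<^sub>F x in at_top \<times>\<^sub>F sequentially. True \<and> (\<forall>k. \<bar>a k (snd x)\<bar> \<le> M k)"
    by (rule eventually_prodI[OF _ assms(2)]) simp
  then show "\<forall>\<^sub>F (k, n) in at_top \<times>\<^sub>F sequentially. norm (a k n) \<le> M k"
    by (rule eventually_mono) auto
qed (use assms in auto)

text \<open>The even powers of the cosine are close to 1 near both ends of the interval from 0 to
  \<pi>. The reflection of \<open>x\<close> to \<open>\<pi> - x\<close> moves the second cluster
  onto the first; a limit taken for fixed \<open>k\<close> would miss it otherwise. This is why the
  number of angles is taken even.\<close>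

lemma sum_cos_power_fold:
  "(\<Sum>k<2 * L. (2 * cos (pi * (real k + 1 / 2) / real (2 * L))) ^ (2 * m)) =
     2 * 4 ^ m * (\<Sum>k<L. cos (pi * (real k + 1 / 2) / real (2 * L)) ^ (2 * m))"
proof -
  let ?x = "\<lambda>k. pi * (real k + 1 / 2) / real (2 * L)"
  let ?c = "\<lambda>k. cos (?x k) ^ (2 * m)"
  have refl: "?c (2 * L - Suc k) = ?c k" if "k < L" for k
  proof -
    have "real (2 * L - Suc k) = 2 * real L - real k - 1"
      using that by (simp add: of_nat_diff)
    then have "?x (2 * L - Suc k) = pi - ?x k"
      using that by (simp add: field_simps)
    then show ?thesis by (simp only: cos_pi_minus) simp
  qed
  have "(\<Sum>k<2 * L. ?c k) = (\<Sum>k\<in>{..<L} \<union> {L..<2 * L}. ?c k)"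
    by (rule arg_cong[where f = "sum ?c"]) auto
  also have "\<dots> = (\<Sum>k<L. ?c k) + (\<Sum>k\<in>{L..<2 * L}. ?c k)"
    by (rule sum.union_disjoint) auto
  also have "(\<Sum>k\<in>{L..<2 * L}. ?c k) = (\<Sum>k<L. ?c (2 * L - Suc k))"
    by (rule sum.reindex_bij_witness[of _ "\<lambda>k. 2 * L - Suc k" "\<lambda>k. 2 * L - Suc k"]) auto
  also have "\<dots> = (\<Sum>k<L. ?c k)"
    using refl by (intro sum.cong) auto
  finally have "(\<Sum>k<2 * L. ?c k) = 2 * (\<Sum>k<L. ?c k)" by simp
  then show ?thesis
    by (simp add: power_mult_distrib power_mult sum_distrib_left[symmetric])
qed

section \<open>The scaling limit of the filtered binomial identity\<close>

context
  fixes t :: real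
  assumes t: "0 < t"
begin

text \<open>The number of angles \<open>l = 2 * polya_half m\<close> is close to
  \<open>sqrt (t m)\<close>. With this scaling \<open>exp (- (v l)^2/m)\<close> tends to
  \<open>exp (- t v^2)\<close>, and the \<open>2m\<close>-th power of the cosine at
  \<open>\<pi> (k + 1/2)/l\<close> tends to
  \<open>exp (- \<pi>\<^sup>2 (k + 1/2)\<^sup>2/t)\<close>.\<close>

definition polya_half :: "nat \<Rightarrow> nat" where
  "polya_half m = nat \<lfloor>sqrt (t * real m) / 2\<rfloor>"

definition polya_step :: "nat \<Rightarrow> nat" where
  "polya_step m = 2 * polya_half m"

definition polya_ratio :: "nat \<Rightarrow> real" where
  "polya_ratio m = real (polya_step m) / sqrt (real m)"

definition polya_angle :: "nat \<Rightarrow> nat \<Rightarrow> real" where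
  "polya_angle k m = pi * (real k + 1 / 2) / real (polya_step m)"

lemma polya_step_bounds: "sqrt (t * real m) - 2 \<le> real (polya_step m)" "real (polya_step m) \<le> sqrt (t * real m)" for m
proof -
  have "0 \<le> \<lfloor>sqrt (t * real m) / 2\<rfloor>" using t by simp
  then have "real (polya_half m) = of_int \<lfloor>sqrt (t * real m) / 2\<rfloor>" by (simp add: polya_half_def)
  then show "sqrt (t * real m) - 2 \<le> real (polya_step m)" "real (polya_step m) \<le> sqrt (t * real m)"
    unfolding polya_step_def by linarith+
qed
lemma polya_ratio_tendsto: "polya_ratio \<longlonglongrightarrow> sqrt t"
proof (rule tendsto_sandwich)
  have "(\<lambda>m. sqrt t - 2 / sqrt (real m)) \<longlonglongrightarrow> sqrt t - 0"
    by (intro tendsto_diff tendsto_const) real_asymp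
  then show "(\<lambda>m. sqrt t - 2 / sqrt (real m)) \<longlonglongrightarrow> sqrt t" by simp
  show "\<forall>\<^sub>F m in sequentially. sqrt t - 2 / sqrt (real m) \<le> polya_ratio m"
    using eventually_gt_at_top[of 0]
  proof eventually_elim
    case (elim m)
    then have "sqrt t - 2 / sqrt (real m) = (sqrt (t * real m) - 2) / sqrt (real m)"
      by (simp add: real_sqrt_mult field_simps)
    also have "\<dots> \<le> polya_ratio m"
      unfolding polya_ratio_def using polya_step_bounds(1)[of m] by (intro divide_right_mono) auto
    finally show ?case .
  qed
  show "\<forall>\<^sub>F m in sequentially. polya_ratio m \<le> sqrt t"
    using eventually_gt_at_top[of 0]
  proof eventually_elim
    case (elim m)
    have "polya_ratio m \<le> sqrt (t * real m) / sqrt (real m)"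
      unfolding polya_ratio_def using polya_step_bounds(2)[of m] by (intro divide_right_mono) auto
    also have "\<dots> = sqrt t" using elim by (simp add: real_sqrt_mult)
    finally show ?case .
  qed
qed (rule tendsto_const)
lemma polya_ratio_square_tendsto: "(\<lambda>m. (polya_ratio m)\<^sup>2) \<longlonglongrightarrow> t"
  using tendsto_power[OF polya_ratio_tendsto, of 2] t by simp

lemma eventually_polya_ratio: "\<forall>\<^sub>F m in sequentially. 0 < m \<and> t / 2 < (polya_ratio m)\<^sup>2 \<and> (polya_ratio m)\<^sup>2 < 2 * t"
proof -
  have "\<forall>\<^sub>F m in sequentially. t / 2 < (polya_ratio m)\<^sup>2"
    by (rule order_tendstoD(1)[OF polya_ratio_square_tendsto]) (use t in simp)
  moreover have "\<forall>\<^sub>F m in sequentially. (polya_ratio m)\<^sup>2 < 2 * t"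
    by (rule order_tendstoD(2)[OF polya_ratio_square_tendsto]) (use t in simp)
  ultimately show ?thesis using eventually_gt_at_top[of 0] by eventually_elim auto
qed

lemma polya_ratio_pos:
  assumes "t / 2 < (polya_ratio m)\<^sup>2"
  shows "0 < polya_ratio m" "0 < polya_step m"
proof -
  have "polya_ratio m \<noteq> 0" using assms t by auto
  then show "0 < polya_ratio m" "0 < polya_step m" by (auto simp: polya_ratio_def zero_less_divide_iff)
qed

lemma polya_step_eq: "0 < m \<Longrightarrow> real (polya_step m) = polya_ratio m * sqrt (real m)"
  by (simp add: polya_ratio_def)

lemma polya_step_at_top: "filterlim (\<lambda>m. real (polya_step m)) at_top sequentially"
proof -
  have "filterlim (\<lambda>m. sqrt (real m) * polya_ratio m) at_top sequentially"
    using t by (intro filterlim_at_top_mult_tendsto_pos[OF polya_ratio_tendsto]) (simp, real_asymp)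
  moreover have "\<forall>\<^sub>F m in sequentially. sqrt (real m) * polya_ratio m = real (polya_step m)"
    using eventually_gt_at_top[of 0] by eventually_elim (simp add: polya_step_eq)
  ultimately show ?thesis by (rule filterlim_cong[OF refl refl, THEN iffD1, rotated])
qed

lemma polya_angle_square:
  assumes "0 < m"
  shows "real m * (polya_angle k m)\<^sup>2 = (pi * (real k + 1 / 2))\<^sup>2 / (polya_ratio m)\<^sup>2"
  using assms by (simp add: polya_angle_def polya_step_eq power_divide power_mult_distrib)

text \<open>The power of the cosine is \<open>(1 - sin^2)^m\<close>, and \<open>m sin^2\<close> has
  a limit because \<open>sin h / h\<close> tends to 1. Padding with zeros from
  \<open>polya_half m\<close> on turns the growing sum into a series for Tannery's theorem.\<close>

lemma polya_cos_sum_tendsto: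
  "(\<lambda>m. \<Sum>k. (if k < polya_half m then cos (polya_angle k m) ^ (2 * m) else 0)) \<longlonglongrightarrow> (\<Sum>k. exp (- (pi\<^sup>2 * (real k + 1 / 2)\<^sup>2 / t)))"
proof -
  define a where "a k m = (if k < polya_half m then cos (polya_angle k m) ^ (2 * m) else 0)" for k m
  have "(\<lambda>m. \<Sum>k. a k m) \<longlonglongrightarrow> (\<Sum>k. exp (- (pi\<^sup>2 * (real k + 1 / 2)\<^sup>2 / t)))"
  proof (rule tannery_eventually)
    fix k
    have x0: "polya_angle k \<longlonglongrightarrow> 0"
      unfolding polya_angle_def
      by (rule tendsto_divide_0[OF tendsto_const filterlim_mono[OF polya_step_at_top at_top_le_at_infinity order_refl]])
    have xat: "filterlim (polya_angle k) (at 0) sequentially"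
      unfolding filterlim_at
    proof (intro conjI x0)
      show "\<forall>\<^sub>F m in sequentially. polya_angle k m \<in> UNIV \<and> polya_angle k m \<noteq> 0"
        using eventually_polya_ratio by eventually_elim (use polya_ratio_pos in \<open>force simp: polya_angle_def add_eq_0_iff\<close>)
    qed
    have "((\<lambda>h. sin h / h) \<longlongrightarrow> 1) (at (0::real))"
      using DERIV_sin[of "0::real"] by (simp add: DERIV_def)
    from filterlim_compose[OF this xat]
    have "(\<lambda>m. (sin (polya_angle k m) / polya_angle k m)\<^sup>2 * ((pi * (real k + 1 / 2))\<^sup>2 / (polya_ratio m)\<^sup>2)) \<longlonglongrightarrow> 1\<^sup>2 * ((pi * (real k + 1 / 2))\<^sup>2 / t)"
      by (intro tendsto_intros polya_ratio_square_tendsto) (use t in auto)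
    moreover have "\<forall>\<^sub>F m in sequentially. (sin (polya_angle k m) / polya_angle k m)\<^sup>2 * ((pi * (real k + 1 / 2))\<^sup>2 / (polya_ratio m)\<^sup>2) =
        real m * (sin (polya_angle k m))\<^sup>2"
      using eventually_polya_ratio
    proof eventually_elim
      case (elim m)
      have "polya_angle k m \<noteq> 0" using polya_ratio_pos elim by (force simp: polya_angle_def add_eq_0_iff)
      then show ?case using elim by (simp add: polya_angle_square[symmetric] power_divide)
    qed
    ultimately have ms: "(\<lambda>m. real m * (sin (polya_angle k m))\<^sup>2) \<longlonglongrightarrow> (pi * (real k + 1 / 2))\<^sup>2 / t"
      by (simp add: tendsto_cong)
    have "(\<lambda>m. (sin (polya_angle k m))\<^sup>2) \<longlonglongrightarrow> (sin 0)\<^sup>2"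
      by (intro tendsto_intros x0)
    then have "(\<lambda>m. (1 - (sin (polya_angle k m))\<^sup>2) ^ m) \<longlonglongrightarrow> exp (- ((pi * (real k + 1 / 2))\<^sup>2 / t))"
      by (intro one_minus_power_tendsto_exp ms) auto
    moreover have "\<forall>\<^sub>F m in sequentially. (1 - (sin (polya_angle k m))\<^sup>2) ^ m = a k m"
      using filterlim_at_top_dense[THEN iffD1, OF polya_step_at_top, rule_format, of "2 * real k"]
    proof eventually_elim
      case (elim m)
      then have "k < polya_half m" by (simp add: polya_step_def)
      moreover have "1 - (sin (polya_angle k m))\<^sup>2 = (cos (polya_angle k m))\<^sup>2" by (simp add: cos_squared_eq)
      ultimately show ?case by (simp only: a_def if_True power_mult[symmetric])
    qed
    ultimately show "(\<lambda>m. a k m) \<longlonglongrightarrow> exp (- (pi\<^sup>2 * (real k + 1 / 2)\<^sup>2 / t))"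
      by (simp add: tendsto_cong power_mult_distrib)
  next
    show "\<forall>\<^sub>F m in sequentially. \<forall>k. \<bar>a k m\<bar> \<le> exp (- (pi\<^sup>2 / (8 * t))) ^ k"
      using eventually_polya_ratio
    proof eventually_elim
      case (elim m)
      show ?case
      proof
        fix k
        show "\<bar>a k m\<bar> \<le> exp (- (pi\<^sup>2 / (8 * t))) ^ k"
        proof (cases "k < polya_half m")
          case True
          have "real k + 1 / 2 \<le> real (polya_half m)" using True by linarith
          then have "pi * (real k + 1 / 2) / real (polya_step m) \<le> pi * real (polya_half m) / real (polya_step m)"
            by (intro divide_right_mono mult_left_mono) auto
          also have "\<dots> = pi / 2" using True by (simp add: polya_step_def)
          finally have "polya_angle k m \<le> pi / 2" by (simp add: polya_angle_def)
          moreover have "0 \<le> polya_angle k m" by (simp add: polya_angle_def)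
          ultimately have "polya_angle k m / 2 \<le> sin (polya_angle k m)" by (intro sin_ge_half)
          then have s: "(polya_angle k m / 2)\<^sup>2 \<le> (sin (polya_angle k m))\<^sup>2"
            using \<open>0 \<le> polya_angle k m\<close> by (intro power_mono) auto
          have "(cos (polya_angle k m))\<^sup>2 \<le> exp (- ((polya_angle k m)\<^sup>2 / 4))"
            using exp_ge_add_one_self[of "- ((polya_angle k m)\<^sup>2 / 4)"] s
            by (simp add: cos_squared_eq power_divide)
          then have "((cos (polya_angle k m))\<^sup>2) ^ m \<le> exp (- ((polya_angle k m)\<^sup>2 / 4)) ^ m"
            by (intro power_mono) auto
          also have "\<dots> = exp (- (real m * (polya_angle k m)\<^sup>2 / 4))"
            by (simp add: exp_of_nat_mult[symmetric])
          also have "\<dots> \<le> exp (- (real k * (pi\<^sup>2 / (8 * t))))"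
          proof -
            \<comment> \<open>The rate \<open>\<pi>\<^sup>2/(8 t)\<close> of the majorant collects a
              factor 4 from \<open>sin x \<ge> x/2\<close> and a factor 2 from
              \<open>(polya_ratio m)^2 < 2t\<close>; replacing the square by \<open>k\<close> makes
              the majorant geometric.\<close>
            have "real k \<le> (real k + 1 / 2)\<^sup>2" by (simp add: power2_eq_square algebra_simps)
            then have "pi\<^sup>2 * real k / (2 * t) \<le> pi\<^sup>2 * (real k + 1 / 2)\<^sup>2 / (polya_ratio m)\<^sup>2"
              using elim t polya_ratio_pos[of m] by (intro frac_le mult_left_mono) auto
            also have "\<dots> = real m * (polya_angle k m)\<^sup>2"
              using elim polya_angle_square[of m k] by (simp only: power_mult_distrib)
            finally have "pi\<^sup>2 * real k / (2 * t) / 4 \<le> real m * (polya_angle k m)\<^sup>2 / 4"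
              by (rule divide_right_mono) simp
            moreover have "real k * (pi\<^sup>2 / (8 * t)) = pi\<^sup>2 * real k / (2 * t) / 4" by (simp add: mult.commute)
            ultimately show ?thesis by simp
          qed
          also have "\<dots> = exp (- (pi\<^sup>2 / (8 * t))) ^ k"
            by (simp add: exp_of_nat_mult[symmetric])
          finally show ?thesis using True by (simp add: a_def power_mult)
        qed (simp add: a_def)
      qed
    qed
    show "summable (\<lambda>k. exp (- (pi\<^sup>2 / (8 * t))) ^ k)" using t by simp
  qed
  then show ?thesis unfolding a_def .
qed

lemma polya_step_multiple_square:
  assumes "0 < m"
  shows "(real (v * polya_step m))\<^sup>2 = real m * ((real v)\<^sup>2 * (polya_ratio m)\<^sup>2)"
  using assms by (simp add: polya_step_eq power_mult_distrib)

text \<open>At distance \<open>d = v l\<close> the two bounds for \<open>binomial_decay\<close> read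
  \<open>exp (- d^2/(m \<plusminus> d))\<close>. They have a common limit since \<open>d/m\<close>
  tends to 0. For the majorant, \<open>m + d \<le> 2m\<close> as long as the coefficient is not
  zero.\<close>

lemma polya_binomial_sum_tendsto:
  "(\<lambda>m. \<Sum>j. (-1) ^ Suc j * binomial_decay m (Suc j * polya_step m)) \<longlonglongrightarrow> (\<Sum>j. (-1) ^ Suc j * exp (- t) ^ (Suc j)\<^sup>2)"
proof -
  define b where "b j m = (-1) ^ Suc j * binomial_decay m (Suc j * polya_step m)" for j m
  have "(\<lambda>m. \<Sum>j. b j m) \<longlonglongrightarrow> (\<Sum>j. (-1) ^ Suc j * exp (- t) ^ (Suc j)\<^sup>2)"
  proof (rule tannery_eventually)
    fix j
    define v where "v = Suc j"
    have dm: "(\<lambda>m. real (v * polya_step m) / real m) \<longlonglongrightarrow> 0"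
    proof -
      have "(\<lambda>m. real v * polya_ratio m * (1 / sqrt (real m))) \<longlonglongrightarrow> real v * sqrt t * 0"
        by (intro tendsto_intros polya_ratio_tendsto) real_asymp
      moreover have "real v * polya_ratio m * (1 / sqrt (real m)) = real (v * polya_step m) / real m" for m
        by (simp add: polya_ratio_def)
      ultimately show ?thesis by simp
    qed
    have lim: "(\<lambda>m. exp (- ((real v)\<^sup>2 * (polya_ratio m)\<^sup>2 / (1 + c * (real (v * polya_step m) / real m))))) \<longlonglongrightarrow> exp (- (t * (real v)\<^sup>2))" for c
    proof -
      have "(\<lambda>m. exp (- ((real v)\<^sup>2 * (polya_ratio m)\<^sup>2 / (1 + c * (real (v * polya_step m) / real m))))) \<longlonglongrightarrow> exp (- ((real v)\<^sup>2 * t / (1 + c * 0)))"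
        by (intro tendsto_intros polya_ratio_square_tendsto dm) simp
      then show ?thesis by (simp add: mult.commute)
    qed
    \<comment> \<open>The sign \<open>c = 1\<close> serves the upper bound and \<open>c = -1\<close>
      the lower one.\<close>
    have form: "(real v)\<^sup>2 * (polya_ratio m)\<^sup>2 / (1 + c * (real (v * polya_step m) / real m)) = (real (v * polya_step m))\<^sup>2 / (real m + c * real (v * polya_step m))"
      if "0 < m" for m c
    proof -
      have "real m + c * real (v * polya_step m) = real m * (1 + c * (real (v * polya_step m) / real m))"
        using that by (simp add: field_simps)
      then show ?thesis
        unfolding polya_step_multiple_square[OF that] using that by (simp del: of_nat_mult)
    qed
    have "(\<lambda>m. binomial_decay m (v * polya_step m)) \<longlonglongrightarrow> exp (- (t * (real v)\<^sup>2))"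
    proof (rule tendsto_sandwich[OF _ _ lim[of "-1"] lim[of 1]])
      show "\<forall>\<^sub>F m in sequentially. binomial_decay m (v * polya_step m) \<le> exp (- ((real v)\<^sup>2 * (polya_ratio m)\<^sup>2 / (1 + 1 * (real (v * polya_step m) / real m))))"
        using eventually_gt_at_top[of 0]
      proof eventually_elim
        case (elim m)
        show ?case unfolding form[OF elim] using binomial_decay_upper[of m "v * polya_step m"] by simp
      qed
      show "\<forall>\<^sub>F m in sequentially. exp (- ((real v)\<^sup>2 * (polya_ratio m)\<^sup>2 / (1 + -1 * (real (v * polya_step m) / real m)))) \<le> binomial_decay m (v * polya_step m)"
        using eventually_gt_at_top[of 0] order_tendstoD(2)[OF dm, of 1, simplified]
      proof eventually_elim
        case (elim m)
        then have "v * polya_step m < m" by (simp add: field_simps flip: of_nat_mult)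
        then show ?case unfolding form[OF elim(1)] using binomial_decay_lower[of "v * polya_step m" m] by simp
      qed
    qed
    then have "(\<lambda>m. (-1) ^ v * binomial_decay m (v * polya_step m)) \<longlonglongrightarrow> (-1) ^ v * exp (- (t * (real v)\<^sup>2))"
      by (intro tendsto_intros)
    moreover have "exp (- (t * (real v)\<^sup>2)) = exp (- t) ^ v\<^sup>2"
      by (simp add: exp_of_nat_mult[symmetric] mult.commute)
    ultimately show "(\<lambda>m. b j m) \<longlonglongrightarrow> (-1) ^ Suc j * exp (- t) ^ (Suc j)\<^sup>2"
      unfolding b_def v_def by simp
  next
    show "\<forall>\<^sub>F m in sequentially. \<forall>j. \<bar>b j m\<bar> \<le> exp (- (t / 4)) ^ j"
      using eventually_polya_ratio
    proof eventually_elim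
      case (elim m)
      show ?case
      proof
        fix j
        define d where "d = Suc j * polya_step m"
        have "\<bar>b j m\<bar> = binomial_decay m d"
          using binomial_decay_nonneg[of m d] by (simp add: b_def d_def abs_mult power_abs)
        also have "\<dots> \<le> exp (- (t / 4)) ^ j"
        proof (cases "d \<le> m")
          case True
          have m: "0 < m" "t / 2 \<le> (polya_ratio m)\<^sup>2" using elim by auto
          have "real j * 1 \<le> (real (Suc j))\<^sup>2" by (simp add: power2_eq_square algebra_simps)
          then have "real j * (t / 2) \<le> (real (Suc j))\<^sup>2 * (polya_ratio m)\<^sup>2"
            using m t by (intro mult_mono) auto
          then have "real j * (t / 4) \<le> (real (Suc j))\<^sup>2 * (polya_ratio m)\<^sup>2 / 2"
            by (simp add: mult.commute)
          also have "\<dots> = (real d)\<^sup>2 / (2 * real m)"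
            unfolding d_def polya_step_multiple_square[OF m(1)] using m(1) by simp
          also have "\<dots> \<le> (real d)\<^sup>2 / (real m + real d)"
            using True m by (intro divide_left_mono) auto
          finally have "exp (- ((real d)\<^sup>2 / (real m + real d))) \<le> exp (- (real j * (t / 4)))" by simp
          also have "\<dots> = exp (- (t / 4)) ^ j" by (simp add: exp_of_nat_mult[symmetric])
          finally show ?thesis using binomial_decay_upper[of m d] by linarith
        qed (simp add: binomial_decay_beyond)
        finally show "\<bar>b j m\<bar> \<le> exp (- (t / 4)) ^ j" .
      qed
    qed
    show "summable (\<lambda>j. exp (- (t / 4)) ^ j)" using t by simp
  qed
  then show ?thesis unfolding b_def .
qed

text \<open>Multiplied by \<open>sqrt m / (4^m l)\<close>, the filtered binomial identity has a
  limit on both sides: \<open>theta4\<close> divided by \<open>sqrt pi\<close> on the binomial side,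
  the Gaussian sum times \<open>2 / sqrt t\<close> on the cosine side.\<close>

theorem theta_inversion:
  "theta4 (exp (- t)) = 2 * sqrt (pi / t) * (\<Sum>k. exp (- (pi\<^sup>2 * (real k + 1 / 2)\<^sup>2 / t)))"
proof -
  let ?c = "\<lambda>m. \<Sum>k<polya_half m. cos (polya_angle k m) ^ (2 * m)"
  let ?S = "\<Sum>k. exp (- (pi\<^sup>2 * (real k + 1 / 2)\<^sup>2 / t))"
  have "(\<Sum>k. (if k < polya_half m then cos (polya_angle k m) ^ (2 * m) else 0)) = ?c m" for m
    by (subst suminf_finite[of "{..<polya_half m}"]) auto
  with polya_cos_sum_tendsto have cos_lim: "(\<lambda>m. 2 / polya_ratio m * ?c m) \<longlonglongrightarrow>
      2 / sqrt t * ?S"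
    using t by (intro tendsto_intros polya_ratio_tendsto) auto
  define b where "b j m = (-1) ^ Suc j * binomial_decay m (Suc j * polya_step m)" for j m
  define B where "B m = sqrt (real m) * (real (2 * m choose m) / 4 ^ m)" for m
  have "(\<lambda>m. B m * (1 + 2 * (\<Sum>j. b j m))) \<longlonglongrightarrow> 1 / sqrt pi * (1 + 2 * (\<Sum>j. (-1) ^ Suc j * exp (- t) ^ (Suc j)\<^sup>2))"
    unfolding B_def by (intro tendsto_intros central_binomial_tendsto polya_binomial_sum_tendsto[folded b_def])
  moreover have "\<forall>\<^sub>F m in sequentially. B m * (1 + 2 * (\<Sum>j. b j m)) = 2 / polya_ratio m * ?c m"
    using eventually_polya_ratio
  proof eventually_elim
    case (elim m)
    have m: "0 < m" "0 < polya_step m" using elim polya_ratio_pos by auto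
    let ?b0 = "real (2 * m choose m)"
    have "b j m = 0" if "m \<le> j" for j
    proof -
      have "m < Suc j * 1" using that by simp
      also have "\<dots> \<le> Suc j * polya_step m" using m by (intro mult_le_mono) auto
      finally show ?thesis unfolding b_def by (simp add: binomial_decay_beyond)
    qed
    then have "(\<Sum>j. b j m) = (\<Sum>j<m. b j m)"
      by (intro suminf_finite) auto
    also have "\<dots> = (\<Sum>v=1..m. (-1) ^ v * binomial_decay m (v * polya_step m))"
      unfolding b_def by (rule sum.reindex_bij_witness[of _ "\<lambda>v. v - 1" Suc]) auto
    finally have "?b0 * (1 + 2 * (\<Sum>j. b j m)) = ?b0 + 2 * (\<Sum>v=1..m. (-1) ^ v * real (2 * m choose (m + v * polya_step m)))"
      unfolding binomial_off_center by (simp add: algebra_simps sum_distrib_left)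
    then have "real (polya_step m) * (?b0 * (1 + 2 * (\<Sum>j. b j m))) = 2 * 4 ^ m * ?c m"
      using cos_power_filter[OF m(2), of m] sum_cos_power_fold[of "polya_half m" m] unfolding polya_step_def polya_angle_def by simp
    then have "?b0 * (1 + 2 * (\<Sum>j. b j m)) = 2 * 4 ^ m * ?c m / real (polya_step m)"
      using m by (simp add: field_simps)
    moreover have "B m * (1 + 2 * (\<Sum>j. b j m)) = sqrt (real m) / 4 ^ m * (?b0 * (1 + 2 * (\<Sum>j. b j m)))"
      unfolding B_def by simp
    ultimately have "B m * (1 + 2 * (\<Sum>j. b j m)) =
        sqrt (real m) / 4 ^ m * (2 * 4 ^ m * ?c m / real (polya_step m))"
      by (simp only:)
    also have "\<dots> = 2 / polya_ratio m * ?c m"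
      by (simp add: polya_ratio_def)
    finally show ?case .
  qed
  ultimately have "(\<lambda>m. 2 / polya_ratio m * ?c m) \<longlonglongrightarrow> 1 / sqrt pi * theta4 (exp (- t))"
    by (simp add: tendsto_cong theta4_def)
  with cos_lim have "2 / sqrt t * ?S = 1 / sqrt pi * theta4 (exp (- t))"
    by (rule LIMSEQ_unique)
  then show ?thesis
    using t by (simp add: real_sqrt_divide field_simps)
qed

end

section \<open>The modular transformation of the generating function\<close>

text \<open>The sum of \<open>w^(k(k+1))\<close>, Ramanujan's function \<psi> at \<open>w^2\<close>.
  It is written as a power series with coefficients 0 and 1 so that holomorphy on the disc is
  immediate.\<close>

definition pronic_series :: "complex \<Rightarrow> complex" where
  "pronic_series w = (\<Sum>n. (if n \<in> range (\<lambda>k. k * (k + 1)) then 1 else 0) * w ^ n)"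

lemma pronic_series_sums:
  assumes "norm w < 1"
  shows "(\<lambda>n. (if n \<in> range (\<lambda>k. k * (k + 1)) then 1 else 0) * w ^ n) sums pronic_series w"
proof -
  have "summable (\<lambda>n. (if n \<in> range (\<lambda>k. k * (k + 1)) then 1 else 0) * w ^ n)"
    by (rule summable_comparison_test'[where g = "\<lambda>n. norm w ^ n" and N = 0])
      (use assms in \<open>auto simp: norm_power\<close>)
  then show ?thesis unfolding pronic_series_def by (rule summable_sums)
qed

lemma strict_mono_pronic: "strict_mono (\<lambda>k::nat. k * (k + 1))"
  by (rule strict_monoI_Suc) simp

lemma pronic_series_sums':
  assumes "norm w < 1"
  shows "(\<lambda>k. w ^ (k * (k + 1))) sums pronic_series w"
proof -
  have "(\<lambda>k. (\<lambda>n. (if n \<in> range (\<lambda>k. k * (k + 1)) then 1 else 0) * w ^ n) (k * (k + 1))) sums pronic_series w"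
    using pronic_series_sums[OF assms] by (subst sums_mono_reindex[OF strict_mono_pronic]) auto
  then show ?thesis by simp
qed

lemma pronic_series_holomorphic: "pronic_series holomorphic_on ball 0 1"
  by (rule power_series_holomorphic) (use pronic_series_sums in auto)

lemma overpartition_gf_holomorphic: "overpartition_gf holomorphic_on ball 0 1"
  by (rule power_series_holomorphic) (use overpartition_gf_sums in auto)

text \<open>The exponents are 0, 2, 6 and so on. That 1 is missing makes the error quadratic in
  \<open>w\<close>, more than enough to cancel the growth of \<open>main_part\<close>.\<close>

lemma norm_pronic_series_minus_one:
  assumes "norm w < 1"
  shows "norm (pronic_series w - 1) \<le> (norm w)\<^sup>2 / (1 - norm w)"
proof -
  let ?c = "\<lambda>n. if n \<in> range (\<lambda>k::nat. k * (k + 1)) then 1 else (0::complex)"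
  have "1 \<notin> range (\<lambda>k::nat. k * (k + 1))"
  proof
    assume "1 \<in> range (\<lambda>k::nat. k * (k + 1))"
    then obtain k :: nat where "1 = k * (k + 1)" by auto
    then show False by (cases k) auto
  qed
  moreover have "0 \<in> range (\<lambda>k::nat. k * (k + 1))" by (rule range_eqI[of _ _ 0]) simp
  ultimately have "(\<Sum>n<2. ?c n * w ^ n) = 1" by (simp add: numeral_2_eq_2)
  then have "(\<lambda>n. ?c (n + 2) * w ^ (n + 2)) sums (pronic_series w - 1)"
    using sums_split_initial_segment[OF pronic_series_sums[OF assms], of 2] by simp
  moreover have "(\<lambda>n. (norm w)\<^sup>2 * norm w ^ n) sums ((norm w)\<^sup>2 * (1 / (1 - norm w)))"
    using assms by (intro sums_mult geometric_sums) simp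
  moreover have "norm (?c (n + 2) * w ^ (n + 2)) \<le> (norm w)\<^sup>2 * norm w ^ n" for n
    by (simp add: norm_mult norm_power power_add power2_eq_square)
  ultimately have "norm (pronic_series w - 1) \<le> (norm w)\<^sup>2 * (1 / (1 - norm w))"
    by (metis (no_types, lifting) norm_suminf_le sums_iff)
  then show ?thesis by simp
qed

definition main_part :: "complex \<Rightarrow> complex" where
  "main_part t = csqrt t / (2 * of_real (sqrt pi)) * exp (of_real (pi\<^sup>2 / 4) / t)"

lemma overpartition_gf_theta4:
  assumes "0 < q" "q < 1"
  shows "overpartition_gf (of_real q) * of_real (theta4 q) = 1"
proof -
  have "(\<lambda>K. (\<Prod>k=1..K. (1 + of_real q ^ k) / (1 - of_real q ^ k)) *
      of_real (\<Prod>k=1..K. (1 - q ^ k) / (1 + q ^ k))) \<longlonglongrightarrow>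
      overpartition_gf (of_real q) * of_real (theta4 q)"
    using assms by (intro tendsto_intros overpartition_gf_prod gauss_product_tendsto) auto
  moreover have "(\<Prod>k=1..K. (1 + of_real q ^ k) / (1 - of_real q ^ k)) *
      of_real (\<Prod>k=1..K. (1 - q ^ k) / (1 + q ^ k)) = (1 :: complex)" for K
  proof -
    have "(1 + q ^ k) / (1 - q ^ k) * ((1 - q ^ k) / (1 + q ^ k)) = 1" if "k \<in> {1..K}" for k
    proof -
      have "q ^ k < 1" "0 < q ^ k" using assms that q_power_less_one[of q k] by auto
      then show ?thesis by simp
    qed
    then have "(\<Prod>k=1..K. (1 + q ^ k) / (1 - q ^ k)) * (\<Prod>k=1..K. (1 - q ^ k) / (1 + q ^ k)) = 1"
      unfolding prod.distrib[symmetric] by (rule prod.neutral[OF ballI])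
    then have "of_real ((\<Prod>k=1..K. (1 + q ^ k) / (1 - q ^ k)) * (\<Prod>k=1..K. (1 - q ^ k) / (1 + q ^ k))) = (1 :: complex)"
      by (simp only: of_real_1)
    then show ?thesis by simp
  qed
  ultimately have "(\<lambda>K. 1 :: complex) \<longlonglongrightarrow> overpartition_gf (of_real q) * of_real (theta4 q)"
    by (simp only:)
  then show ?thesis by (simp add: LIMSEQ_const_iff)
qed

lemma modular_transformation_real:
  fixes t :: real
  assumes t: "0 < t"
  shows "overpartition_gf (exp (- of_real t)) * pronic_series (exp (- (of_real (pi\<^sup>2) / of_real t))) = main_part (of_real t)"
proof -
  define w where "w = exp (- (pi\<^sup>2 / t))"
  have w: "0 < w" "w < 1" using t by (auto simp: w_def)
  have sms: "(\<lambda>k. complex_of_real (w ^ (k * (k + 1)))) sums pronic_series (of_real w)"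
    using pronic_series_sums'[of "of_real w"] w by simp
  have S: "(\<lambda>k. w ^ (k * (k + 1))) sums Re (pronic_series (of_real w))"
    using sums_Re[OF sms] by (simp only: Re_complex_of_real)
  have "(\<lambda>k::nat. 0) sums Im (pronic_series (of_real w))"
    using sums_Im[OF sms] by (simp only: Im_complex_of_real)
  then have Im: "Im (pronic_series (of_real w)) = 0"
    by (rule sums_unique2[OF _ sums_zero])
  \<comment> \<open>\<open>(k + 1/2)^2 = k(k + 1) + 1/4\<close>; the quarter is the exponent of the
    main term.\<close>
  have e: "exp (- (pi\<^sup>2 * (real k + 1 / 2)\<^sup>2 / t)) = exp (- (pi\<^sup>2 / (4 * t))) * w ^ (k * (k + 1))" for k
  proof -
    have "w ^ (k * (k + 1)) = exp (real (k * (k + 1)) * - (pi\<^sup>2 / t))"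
      unfolding w_def by (rule exp_of_nat_mult[symmetric])
    then have "exp (- (pi\<^sup>2 / (4 * t))) * w ^ (k * (k + 1)) = exp (- (pi\<^sup>2 / (4 * t)) + real (k * (k + 1)) * - (pi\<^sup>2 / t))"
      by (simp only: exp_add)
    also have "- (pi\<^sup>2 / (4 * t)) + real (k * (k + 1)) * - (pi\<^sup>2 / t) = - (pi\<^sup>2 * (real k + 1 / 2)\<^sup>2 / t)"
      using t by (simp add: field_simps power2_eq_square)
    finally show ?thesis by simp
  qed
  have "(\<Sum>k. exp (- (pi\<^sup>2 * (real k + 1 / 2)\<^sup>2 / t))) = exp (- (pi\<^sup>2 / (4 * t))) * Re (pronic_series (of_real w))"
    unfolding e using sums_mult[OF S] by (simp add: sums_iff)
  then have th: "theta4 (exp (- t)) = 2 * sqrt (pi / t) * exp (- (pi\<^sup>2 / (4 * t))) * Re (pronic_series (of_real w))"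
    using theta_inversion[OF t] by simp
  define c where "c = 2 * sqrt (pi / t) * exp (- (pi\<^sup>2 / (4 * t)))"
  have c: "c > 0" using t by (simp add: c_def)
  have "pronic_series (of_real w) = of_real (Re (pronic_series (of_real w)))"
    using Im by (simp add: complex_eq_iff)
  then have "of_real c * (overpartition_gf (of_real (exp (- t))) * pronic_series (of_real w)) =
      overpartition_gf (of_real (exp (- t))) * of_real (theta4 (exp (- t)))"
    unfolding th c_def[symmetric] by (metis mult.left_commute of_real_mult)
  also have "\<dots> = 1" using t by (intro overpartition_gf_theta4) auto
  finally have "overpartition_gf (of_real (exp (- t))) * pronic_series (of_real w) = of_real (1 / c)"
    using c by (simp add: field_simps)
  also have "1 / c = sqrt t / (2 * sqrt pi) * exp (pi\<^sup>2 / 4 / t)"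
    by (simp add: c_def real_sqrt_divide exp_minus field_simps)
  finally have *: "overpartition_gf (of_real (exp (- t))) * pronic_series (of_real w) =
      of_real (sqrt t / (2 * sqrt pi) * exp (pi\<^sup>2 / 4 / t))" .
  have "exp (of_real (pi\<^sup>2 / 4) / of_real t) = complex_of_real (exp (pi\<^sup>2 / 4 / t))"
    by (simp only: of_real_divide[symmetric] exp_of_real)
  moreover have "csqrt (of_real t) = complex_of_real (sqrt t)"
    using t by (simp only: csqrt_of_real less_imp_le)
  ultimately have "main_part (of_real t) = of_real (sqrt t / (2 * sqrt pi) * exp (pi\<^sup>2 / 4 / t))"
    by (simp only: main_part_def of_real_mult of_real_divide of_real_numeral)
  moreover have "exp (- of_real t) = complex_of_real (exp (- t))"
    by (simp only: of_real_minus[symmetric] exp_of_real)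
  moreover have "exp (- (of_real (pi\<^sup>2) / of_real t)) = complex_of_real w"
    unfolding w_def by (simp only: of_real_minus[symmetric] of_real_divide[symmetric] exp_of_real)
  ultimately show ?thesis using * by (simp only:)
qed

text \<open>Both sides are holomorphic on the right half-plane and agree on the positive reals.
  Written as a product, the identity does not require \<open>pronic_series\<close> to be free of
  zeros.\<close>

theorem modular_transformation:
  assumes t: "0 < Re t"
  shows "overpartition_gf (exp (- t)) * pronic_series (exp (- (of_real (pi\<^sup>2) / t))) = main_part t"
proof -
  let ?S = "{t. 0 < Re t}"
  let ?U = "complex_of_real ` {0<..}"
  define f where "f t = overpartition_gf (exp (- t)) * pronic_series (exp (- (of_real (pi\<^sup>2) / t))) - main_part t" for t
  have S: "t \<noteq> 0" "t \<notin> \<real>\<^sub>\<le>\<^sub>0" if "t \<in> ?S" for t using that by (auto elim!: nonpos_Reals_cases)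
  have w: "norm (exp (- (of_real (pi\<^sup>2) / t))) < 1" if "t \<in> ?S" for t
    using that by (simp add: Re_divide zero_less_divide_iff sum_power2_gt_zero_iff)
  have "overpartition_gf \<circ> (\<lambda>t. exp (- t)) holomorphic_on ?S"
    by (rule holomorphic_on_compose_gen[OF _ overpartition_gf_holomorphic])
      (auto intro!: holomorphic_intros)
  moreover have "pronic_series \<circ> (\<lambda>t. exp (- (of_real (pi\<^sup>2) / t))) holomorphic_on ?S"
    by (rule holomorphic_on_compose_gen[OF _ pronic_series_holomorphic])
      (use w S in \<open>auto intro!: holomorphic_intros\<close>)
  moreover have "main_part holomorphic_on ?S"
    unfolding main_part_def by (intro holomorphic_intros) (use S in auto)
  ultimately have hol: "f holomorphic_on ?S"
    unfolding f_def o_def by (intro holomorphic_intros)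
  have op: "open ?S" by (rule open_halfspace_Re_gt)
  have con: "connected ?S" by (intro convex_connected convex_halfspace_Re_gt)
  have lim: "1 islimpt ?U"
    unfolding islimpt_approachable
  proof (intro allI impI)
    fix e :: real assume "0 < e"
    have "dist (complex_of_real (1 + e / 2)) (complex_of_real 1) = e / 2"
      using \<open>0 < e\<close> by (simp only: dist_of_real) (simp add: dist_real_def)
    moreover have "complex_of_real (1 + e / 2) \<noteq> 1"
      using \<open>0 < e\<close> by (simp only: of_real_eq_1_iff)
    moreover have "complex_of_real (1 + e / 2) \<in> ?U"
      using \<open>0 < e\<close> by (intro imageI) simp
    ultimately show "\<exists>x'\<in>?U. x' \<noteq> 1 \<and> dist x' 1 < e"
      using \<open>0 < e\<close> by (intro bexI[of _ "complex_of_real (1 + e / 2)"]) simp_all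
  qed
  have zero: "f u = 0" if "u \<in> ?U" for u
  proof -
    obtain x where "u = of_real x" "0 < x" using \<open>u \<in> ?U\<close> by auto
    then show ?thesis using modular_transformation_real[of x] by (simp only: f_def diff_self)
  qed
  have "f t = 0"
    by (rule analytic_continuation[OF hol op con _ _ lim zero]) (use t in auto)
  then show ?thesis by (simp add: f_def)
qed

section \<open>Size of the generating function\<close>

text \<open>The logarithm of the left side is the real part of
  \<open>2 (z + z^3/3 + z^5/5 + ...)\<close>. The coefficients are nonnegative, so from the cube on
  each term is at most its value at \<open>norm z\<close>; the linear term is kept exactly and
  yields the exponential factor.\<close>

lemma norm_moebius_le:
  fixes z :: complex
  assumes z: "norm z < 1"
  shows "norm ((1 + z) / (1 - z)) \<le> (1 + norm z) / (1 - norm z) * exp (2 * Re z - 2 * norm z)"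
proof -
  \<comment> \<open>The coefficients of the logarithm with the linear term taken out.\<close>
  define g where "g w n = - ((- w) ^ n) / of_nat n - - ((- (- w)) ^ n) / of_nat n - (if n = 1 then 2 * w else 0)"
    for w :: complex and n
  have g_sums: "g w sums (ln (1 + w) - ln (1 + - w) - 2 * w)" if "norm w < 1" for w
    unfolding g_def using that by (intro sums_diff Ln_series' sums_single[of 1 "\<lambda>_. 2 * w"]) auto
  have g: "g w n = (if odd n \<and> n \<noteq> 1 then 2 * w ^ n / of_nat n else 0)" for w n
    by (auto simp: g_def uminus_power_if)
  let ?r = "complex_of_real (norm z)"
  let ?G = "\<lambda>w. ln (1 + w) - ln (1 + - w) - 2 * w"
  have "Re (?G z) \<le> Re (?G ?r)"
  proof (rule sums_le)
    show "(\<lambda>n. Re (g z n)) sums Re (?G z)" "(\<lambda>n. Re (g ?r n)) sums Re (?G ?r)"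
      by (intro sums_Re g_sums; use z in simp)+
    fix n
    have "Re (g z n) \<le> norm (g z n)" by (rule complex_Re_le_cmod)
    also have "\<dots> = Re (g ?r n)"
    proof (cases "odd n \<and> n \<noteq> 1")
      case True
      then have "g ?r n = of_real (2 * norm z ^ n / real n)" by (simp add: g)
      then show ?thesis using True by (simp add: g norm_mult norm_power norm_divide)
    qed (auto simp: g)
    finally show "Re (g z n) \<le> Re (g ?r n)" .
  qed
  moreover have exp_G: "exp (?G w) = (1 + w) / (1 - w) * exp (- (2 * w))" if "norm w < 1" for w :: complex
  proof -
    have "1 + w \<noteq> 0" "1 + - w \<noteq> 0"
      using that by (auto simp: add_eq_0_iff)
    then show ?thesis by (simp add: exp_diff exp_minus divide_inverse)
  qed
  ultimately have "norm (exp (?G z)) \<le> norm (exp (?G ?r))"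
    by (simp only: norm_exp_eq_Re exp_le_cancel_iff)
  also have "exp (?G ?r) = (1 + ?r) / (1 - ?r) * exp (- (2 * ?r))" using z by (intro exp_G) simp
  also have "\<dots> = of_real ((1 + norm z) / (1 - norm z) * exp (- (2 * norm z)))"
    by (simp flip: exp_of_real)
  also have "norm \<dots> = (1 + norm z) / (1 - norm z) * exp (- (2 * norm z))"
    using z by (simp only: norm_of_real) (simp add: abs_mult)
  finally have "norm ((1 + z) / (1 - z)) * exp (- (2 * Re z)) \<le> (1 + norm z) / (1 - norm z) * exp (- (2 * norm z))"
    unfolding exp_G[OF z] norm_mult norm_exp_eq_Re by simp
  then have "norm ((1 + z) / (1 - z)) * exp (- (2 * Re z)) * exp (2 * Re z) \<le>
      (1 + norm z) / (1 - norm z) * exp (- (2 * norm z)) * exp (2 * Re z)"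
    by (intro mult_right_mono) auto
  moreover have "exp (- (2 * Re z)) * exp (2 * Re z) = 1"
      "exp (- (2 * norm z)) * exp (2 * Re z) = exp (2 * Re z - 2 * norm z)"
    by (simp_all flip: exp_add)
  ultimately show ?thesis
    by (simp only: mult.assoc mult_1_right)
qed

lemma geometric_sum_tendsto:
  fixes q :: "'a::{real_normed_field,banach}"
  assumes "norm q < 1"
  shows "(\<lambda>K. \<Sum>k=1..K. q ^ k) \<longlonglongrightarrow> q / (1 - q)"
proof -
  have "(\<lambda>n. q * q ^ n) sums (q * (1 / (1 - q)))"
    using assms by (intro sums_mult geometric_sums)
  then have "(\<lambda>K. \<Sum>k<K. q ^ Suc k) \<longlonglongrightarrow> q / (1 - q)"
    by (simp add: sums_def)
  moreover have "(\<Sum>k<K. q ^ Suc k) = (\<Sum>k=1..K. q ^ k)" for K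
    by (rule sum.reindex_bij_witness[of _ "\<lambda>k. k - 1" Suc]) auto
  ultimately show ?thesis by simp
qed

text \<open>The linear terms saved in each factor add up to geometric series. All dependence on the
  argument of \<open>q\<close> is thus in the elementary function \<open>q/(1 - q)\<close>, and what
  remains is the value at \<open>norm q\<close>, controlled by the transformation on the
  reals.\<close>

lemma norm_overpartition_gf_le:
  assumes q: "norm q < 1"
  shows "norm (overpartition_gf q) \<le>
    norm (overpartition_gf (of_real (norm q))) * exp (2 * Re (q / (1 - q)) - 2 * (norm q / (1 - norm q)))"
proof -
  let ?Q = "\<lambda>K. \<Prod>k=1..K. (1 + q ^ k) / (1 - q ^ k)"
  let ?R = "\<lambda>K. \<Prod>k=1..K. (1 + complex_of_real (norm q) ^ k) / (1 - complex_of_real (norm q) ^ k)"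
  let ?E = "\<lambda>K. exp (2 * Re (\<Sum>k=1..K. q ^ k) - 2 * (\<Sum>k=1..K. norm q ^ k))"
  show ?thesis
  proof (rule LIMSEQ_le)
    show "(\<lambda>K. norm (?Q K)) \<longlonglongrightarrow> norm (overpartition_gf q)"
      using q by (intro tendsto_norm overpartition_gf_prod)
    show "(\<lambda>K. norm (?R K) *
        ?E K) \<longlonglongrightarrow>
      norm (overpartition_gf (of_real (norm q))) * exp (2 * Re (q / (1 - q)) - 2 * (norm q / (1 - norm q)))"
      using q by (intro tendsto_intros overpartition_gf_prod geometric_sum_tendsto) auto
    have "norm (?Q K) \<le>
        norm (?R K) *
        ?E K" for K
    proof -
      have lt: "norm q ^ k < 1" if "k \<in> {1..K}" for k
      proof -
        have "norm q ^ k \<le> norm q ^ 1" using that q by (intro power_decreasing) auto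
        then show ?thesis using q by simp
      qed
      have "norm (?Q K) = (\<Prod>k=1..K. norm ((1 + q ^ k) / (1 - q ^ k)))"
        by (rule prod_norm[symmetric])
      also have "\<dots> \<le> (\<Prod>k=1..K. (1 + norm q ^ k) / (1 - norm q ^ k) * exp (2 * Re (q ^ k) - 2 * norm q ^ k))"
        using norm_moebius_le[of "q ^ _"] lt by (intro prod_mono) (simp add: norm_power del: norm_divide)
      also have "\<dots> = (\<Prod>k=1..K. (1 + norm q ^ k) / (1 - norm q ^ k)) * exp (\<Sum>k=1..K. 2 * Re (q ^ k) - 2 * norm q ^ k)"
        by (simp only: prod.distrib exp_sum finite_atLeastAtMost)
      also have "(\<Sum>k=1..K. 2 * Re (q ^ k) - 2 * norm q ^ k) = 2 * Re (\<Sum>k=1..K. q ^ k) - 2 * (\<Sum>k=1..K. norm q ^ k)"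
        by (simp add: sum_subtractf sum_distrib_left)
      also have "(\<Prod>k=1..K. (1 + norm q ^ k) / (1 - norm q ^ k)) =
          norm (?R K)"
      proof -
        have "(?R K) =
            of_real (\<Prod>k=1..K. (1 + norm q ^ k) / (1 - norm q ^ k))" by simp
        moreover have "0 \<le> (\<Prod>k=1..K. (1 + norm q ^ k) / (1 - norm q ^ k))"
        proof (rule prod_nonneg)
          fix k assume "k \<in> {1..K}"
          with lt have "norm q ^ k < 1" .
          moreover have "0 \<le> norm q ^ k" by simp
          ultimately show "0 \<le> (1 + norm q ^ k) / (1 - norm q ^ k)" by (intro divide_nonneg_nonneg) linarith+
        qed
        ultimately show ?thesis by (simp only: norm_of_real abs_of_nonneg)
      qed
      finally show ?thesis .
    qed
    then show "\<exists>N. \<forall>K\<ge>N. norm (?Q K) \<le>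
        norm (?R K) *
        ?E K" by blast
  qed
qed

lemma pi_square_bounds: "9.8 \<le> pi\<^sup>2" "pi\<^sup>2 \<le> 10"
proof -
  have "3.14 \<le> pi" by (rule order_trans[OF _ pi_approx(1)]) simp
  then have "3.14 * 3.14 \<le> pi * pi" by (intro mult_mono) auto
  then show "9.8 \<le> pi\<^sup>2" unfolding power2_eq_square by linarith
  have "pi \<le> 3.15" by (rule order_trans[OF pi_approx(2)]) simp
  then have "pi * pi \<le> 3.15 * 3.15" by (intro mult_mono) auto
  then show "pi\<^sup>2 \<le> 10" unfolding power2_eq_square by linarith
qed

lemma norm_main_part:
  "norm (main_part t) = sqrt (norm t) / (2 * sqrt pi) * exp (pi\<^sup>2 / 4 * Re (1 / t))"
proof -
  have "Re (of_real (pi\<^sup>2 / 4) / t) = pi\<^sup>2 / 4 * Re (1 / t)"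
  proof -
    have "of_real (pi\<^sup>2 / 4) / t = of_real (pi\<^sup>2 / 4) * (1 / t)" by simp
    then show ?thesis
      by (simp only: times_complex.sel Re_complex_of_real Im_complex_of_real mult_zero_left diff_zero)
  qed
  then show ?thesis
    unfolding main_part_def norm_mult norm_divide norm_csqrt norm_exp_eq_Re by simp
qed

text \<open>For positive argument \<open>pronic_series\<close> is at least 1, so
  \<open>main_part\<close> is an upper bound; 5/2 exceeds \<open>\<pi>\<^sup>2/4\<close>.\<close>

lemma norm_overpartition_gf_real_le:
  fixes x :: real
  assumes x: "0 < x" "x \<le> 1"
  shows "norm (overpartition_gf (of_real (exp (- x)))) \<le> exp (5 / 2 / x)"
proof -
  define w where "w = exp (- (pi\<^sup>2 / x))"
  have w: "0 < w" "w < 1" using x by (auto simp: w_def)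
  have e: "exp (- of_real x) = complex_of_real (exp (- x))"
    by (simp only: of_real_minus[symmetric] exp_of_real)
  have e': "exp (- (of_real (pi\<^sup>2) / of_real x)) = complex_of_real w"
    unfolding w_def by (simp only: of_real_minus[symmetric] of_real_divide[symmetric] exp_of_real)
  have "1 \<le> Re (pronic_series (of_real w))"
  proof (rule sums_le[of "\<lambda>k. if k = 0 then 1 else 0"])
    show "(\<lambda>k::nat. if k = 0 then 1 else 0 :: real) sums 1"
      using sums_single[of 0 "\<lambda>_. 1 :: real"] by simp
    have "(\<lambda>k. complex_of_real (w ^ (k * (k + 1)))) sums pronic_series (of_real w)"
      using pronic_series_sums'[of "of_real w"] w by simp
    from sums_Re[OF this] show "(\<lambda>k. w ^ (k * (k + 1))) sums Re (pronic_series (of_real w))"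
      by (simp only: Re_complex_of_real)
  qed (use w in auto)
  also have "\<dots> \<le> norm (pronic_series (of_real w))" by (rule complex_Re_le_cmod)
  finally have "norm (overpartition_gf (of_real (exp (- x)))) * 1 \<le>
      norm (overpartition_gf (of_real (exp (- x)))) * norm (pronic_series (of_real w))"
    by (intro mult_left_mono) auto
  also have "\<dots> = norm (main_part (of_real x))"
    using modular_transformation[of "of_real x"] x unfolding e e' by (simp only: norm_mult[symmetric] Re_complex_of_real)
  also have "\<dots> = sqrt x / (2 * sqrt pi) * exp (pi\<^sup>2 / 4 / x)"
    unfolding norm_main_part using x by (simp add: Re_divide power2_eq_square)
  also have "\<dots> \<le> 1 * exp (5 / 2 / x)"
  proof (rule mult_mono)
    have "sqrt x \<le> 1" "1 \<le> sqrt pi" using x pi_gt3 by auto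
    then have "sqrt x \<le> 2 * sqrt pi" by linarith
    then show "sqrt x / (2 * sqrt pi) \<le> 1" by simp
    show "exp (pi\<^sup>2 / 4 / x) \<le> exp (5 / 2 / x)"
      using pi_square_bounds x by (intro exp_mono divide_right_mono) auto
  qed auto
  finally show ?thesis by simp
qed

lemma one_over_exp_minus_one_ge:
  fixes x :: real
  assumes x: "0 < x" "x \<le> 1"
  shows "1 / x - 1 \<le> exp (- x) / (1 - exp (- x))"
proof -
  have "exp x \<le> 1 + x + x\<^sup>2" using x by (intro exp_bound) auto
  then have "exp x - 1 \<le> x * (1 + x)" by (simp add: power2_eq_square algebra_simps)
  moreover have "0 < exp x - 1" using x by simp
  ultimately have "1 / (x * (1 + x)) \<le> 1 / (exp x - 1)"
    by (intro divide_left_mono mult_pos_pos) (use x in auto)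
  moreover have "1 / x - 1 \<le> 1 / (x * (1 + x))"
  proof -
    have "(1 / x - 1) * (x * (1 + x)) = 1 - x\<^sup>2" using x by (simp add: power2_eq_square field_simps)
    also have "\<dots> \<le> 1" by simp
    finally show ?thesis using x by (simp add: pos_le_divide_eq)
  qed
  moreover have "1 / (exp x - 1) = exp (- x) / (1 - exp (- x))"
    by (simp add: exp_minus field_simps)
  ultimately show ?thesis by simp
qed

text \<open>The squared distance of \<open>q\<close> from 1 is
  \<open>(1 - r)^2 + 2r(1 - cos y)\<close>, hence at least \<open>r y^2/4\<close>, while the
  numerator of the real part is at most \<open>r(1 - r) \<le> r x\<close>.\<close>

lemma Re_geometric_le:
  fixes x y :: real
  assumes x: "0 < x" and y: "\<bar>y\<bar> \<le> pi" "y \<noteq> 0"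
  defines "q \<equiv> exp (- Complex x y)"
  shows "Re (q / (1 - q)) \<le> 4 * x / y\<^sup>2"
proof -
  define r where "r = exp (- x)"
  have r: "0 < r" "r < 1" using x by (auto simp: r_def)
  have q: "Re q = r * cos y" "Im q = - r * sin y" by (simp_all add: q_def r_def Re_exp Im_exp)
  have sc: "(sin y)\<^sup>2 = 1 - (cos y)\<^sup>2" by (simp add: sin_squared_eq)
  define d where "d = (Re (1 - q))\<^sup>2 + (Im (1 - q))\<^sup>2"
  have d: "d = (1 - r)\<^sup>2 + 2 * r * (1 - cos y)"
    unfolding d_def by (simp add: q power2_diff power_mult_distrib sc) (simp add: power2_eq_square algebra_simps)
  have "1 - cos y = 2 * (sin (y / 2))\<^sup>2"
    using cos_double_sin[of "y / 2"] by simp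
  moreover have "(\<bar>y\<bar> / 4)\<^sup>2 \<le> (sin (\<bar>y\<bar> / 2))\<^sup>2"
    using sin_ge_half[of "\<bar>y\<bar> / 2"] y by (intro power_mono) auto
  moreover have "(sin (\<bar>y\<bar> / 2))\<^sup>2 = (sin (y / 2))\<^sup>2" by (cases "y \<ge> 0") auto
  ultimately have c: "y\<^sup>2 / 8 \<le> 1 - cos y" by (simp add: power_divide)
  have "2 * r * (y\<^sup>2 / 8) \<le> 2 * r * (1 - cos y)" using c r by (intro mult_left_mono) auto
  then have d_ge: "r * y\<^sup>2 / 4 \<le> d" unfolding d using zero_le_power2[of "1 - r"] by linarith
  have y2: "0 < r * y\<^sup>2 / 4" using r y by simp
  have "Re (q / (1 - q)) = (Re q * Re (1 - q) + Im q * Im (1 - q)) / d"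
    by (simp add: Re_divide d_def)
  also have "Re q * Re (1 - q) + Im q * Im (1 - q) = r * cos y - r\<^sup>2"
    by (simp add: q algebra_simps sc power2_eq_square[symmetric] power_mult_distrib)
       (simp add: sc algebra_simps flip: distrib_left)?
  also have "(r * cos y - r\<^sup>2) / d \<le> (r * (1 - r)) / d"
  proof (rule divide_right_mono)
    have "r * cos y \<le> r * 1" using r by (intro mult_left_mono) auto
    then show "r * cos y - r\<^sup>2 \<le> r * (1 - r)" by (simp add: power2_eq_square algebra_simps)
    show "0 \<le> d" using d_ge y2 by linarith
  qed
  also have "\<dots> \<le> (r * (1 - r)) / (r * y\<^sup>2 / 4)"
    using d_ge y2 r by (intro divide_left_mono mult_pos_pos) auto
  also have "\<dots> = 4 * (1 - r) / y\<^sup>2" using r by simp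
  also have "\<dots> \<le> 4 * x / y\<^sup>2"
    using exp_ge_add_one_self[of "- x"] by (intro divide_right_mono) (auto simp: r_def)
  finally show ?thesis .
qed

text \<open>The segment is cut at \<open>y^2 = 9/s\<close>. Inside, \<open>Re (1/t)\<close> is
  bounded below, \<open>pronic_series\<close> is close to 1 and the error is even bounded. Outside,
  both functions are small separately: the factor at \<open>norm q\<close> is at most
  \<open>exp (5s/2)\<close>, and the loss in the geometric series is about
  \<open>exp (-2s)\<close>.\<close>

lemma overpartition_gf_minus_main_part:
  fixes s y :: real
  assumes s: "16 \<le> s" and y: "\<bar>y\<bar> \<le> pi"
  shows "norm (overpartition_gf (exp (- Complex (1 / s) y)) - main_part (Complex (1 / s) y)) \<le> 23 * exp (s / 2)"
proof -
  define t where "t = Complex (1 / s) y"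
  define X where "X = Re (1 / t)"
  have X: "X = (1 / s) / ((1 / s)\<^sup>2 + y\<^sup>2)" by (simp add: X_def t_def Re_divide)
  have s0: "0 < 1 / s" "1 / s \<le> 1 / 16" using s by (auto simp: field_simps)
  have "norm t \<le> \<bar>1 / s\<bar> + \<bar>y\<bar>" unfolding t_def using cmod_le[of "Complex (1 / s) y"] by simp
  also have "\<dots> \<le> 4" 
  proof -
    have "pi \<le> 63 / 20" by (rule order_trans[OF pi_approx(2)]) simp
    then show ?thesis using s0 y by linarith
  qed
  finally have "sqrt (norm t) \<le> 2" by (simp add: real_le_lsqrt)
  moreover have "1 \<le> sqrt pi" using pi_gt3 by simp
  ultimately have "sqrt (norm t) \<le> 2 * sqrt pi" by linarith
  then have amp: "sqrt (norm t) / (2 * sqrt pi) \<le> 1" by simp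
  have amp0: "0 \<le> sqrt (norm t) / (2 * sqrt pi)" by simp
  have main: "norm (main_part t) = sqrt (norm t) / (2 * sqrt pi) * exp (pi\<^sup>2 / 4 * X)"
    unfolding X_def by (rule norm_main_part)
  show ?thesis
  proof (cases "y\<^sup>2 \<le> 9 / s")
    case True
    define w where "w = exp (- (of_real (pi\<^sup>2) / t))"
    define \<omega> where "\<omega> = norm w"
    have \<omega>: "\<omega> = exp (- (pi\<^sup>2 * X))"
      unfolding \<omega>_def w_def X_def norm_exp_eq_Re by (simp add: Re_divide)
    \<comment> \<open>The number 145/16 is \<open>1/16 + 9\<close>; the term 1/16 is the bound for
      \<open>1/s\<close>.\<close>
    have "(1 / s)\<^sup>2 + y\<^sup>2 \<le> (1 / s) * (1 / 16 + 9)"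
      using True s0 mult_left_mono[OF s0(2), of "1 / s"] by (simp add: power2_eq_square algebra_simps)
    moreover have "0 < (1 / s)\<^sup>2 + y\<^sup>2" using s0 by (intro add_pos_nonneg) auto
    ultimately have "(1 / s) / ((1 / s) * (1 / 16 + 9)) \<le> X"
      unfolding X using s0 by (intro divide_left_mono mult_pos_pos) auto
    then have X_ge: "16 / 145 \<le> X" using s0 by simp
    have "9.8 * (16 / 145) \<le> pi\<^sup>2 * X" using X_ge pi_square_bounds by (intro mult_mono) auto
    then have "exp (- (pi\<^sup>2 * X)) \<le> exp (- 1)" by simp
    also have "exp (- 1 :: real) \<le> 1 / 2"
      using exp_ge_add_one_self[of 1] by (simp add: exp_minus field_simps)
    finally have \<omega>_le: "\<omega> \<le> 1 / 2" unfolding \<omega> .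
    have \<omega>_pos: "0 < \<omega>" unfolding \<omega> by simp
    have "norm (pronic_series w - 1) \<le> \<omega>\<^sup>2 / (1 - \<omega>)"
      unfolding \<omega>_def by (rule norm_pronic_series_minus_one) (use \<omega>_le \<omega>_def in auto)
    also have "\<dots> \<le> \<omega>\<^sup>2 / (1 / 2)"
      using \<omega>_le by (intro divide_left_mono) auto
    finally have p1: "norm (pronic_series w - 1) \<le> 2 * \<omega>\<^sup>2" by simp
    have "\<omega>\<^sup>2 \<le> (1 / 2)\<^sup>2" using \<omega>_le \<omega>_pos by (intro power_mono) auto
    then have "norm (pronic_series w - 1) \<le> 1 / 2" using p1 by (simp add: power2_eq_square)
    then have p2: "1 / 2 \<le> norm (pronic_series w)"
      using norm_triangle_ineq4[of "pronic_series w" "pronic_series w - 1"] by simp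
    have mod: "overpartition_gf (exp (- t)) * pronic_series w = main_part t"
      unfolding w_def using s0 by (intro modular_transformation) (simp add: t_def)
    have "pronic_series w * (overpartition_gf (exp (- t)) - main_part t) = main_part t * (1 - pronic_series w)"
      by (simp add: mod[symmetric] algebra_simps)
    then have "norm (pronic_series w) * norm (overpartition_gf (exp (- t)) - main_part t) =
        norm (main_part t) * norm (pronic_series w - 1)"
      by (metis norm_mult norm_minus_commute)
    also have "\<dots> \<le> norm (main_part t) * (2 * \<omega>\<^sup>2)" using p1 by (intro mult_left_mono) auto
    also have "\<dots> = sqrt (norm t) / (2 * sqrt pi) * (2 * exp (pi\<^sup>2 / 4 * X - 2 * (pi\<^sup>2 * X)))"
    proof -
      have "exp (pi\<^sup>2 / 4 * X) * (exp (- (pi\<^sup>2 * X)))\<^sup>2 = exp (pi\<^sup>2 / 4 * X - 2 * (pi\<^sup>2 * X))"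
        by (simp only: power2_eq_square[of "exp _"] exp_add[symmetric]) simp
      then show ?thesis unfolding main \<omega> by (simp only: mult.assoc mult.left_commute[of _ 2])
    qed
    also have "\<dots> \<le> 1 * (2 * 1)"
    proof (intro mult_mono amp)
      have "0 \<le> pi\<^sup>2 * X" using X_ge by simp
      then show "exp (pi\<^sup>2 / 4 * X - 2 * (pi\<^sup>2 * X)) \<le> 1" by (simp add: mult.commute)
    qed auto
    finally have "norm (pronic_series w) * norm (overpartition_gf (exp (- t)) - main_part t) \<le> 2" by simp
    moreover have "1 / 2 * norm (overpartition_gf (exp (- t)) - main_part t) \<le>
        norm (pronic_series w) * norm (overpartition_gf (exp (- t)) - main_part t)"
      using p2 by (intro mult_right_mono) auto
    ultimately have "norm (overpartition_gf (exp (- t)) - main_part t) \<le> 23 * 1" by simp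
    also have "\<dots> \<le> 23 * exp (s / 2)" using s by (intro mult_left_mono) auto
    finally show ?thesis by (simp only: t_def)
  next
    case False
    then have y2: "9 / s < y\<^sup>2" by simp
    then have y0: "y \<noteq> 0" "0 < y\<^sup>2" using s by (auto intro: less_trans[of 0 "9 / s"])
    define q where "q = exp (- t)"
    have nq: "norm q = exp (- (1 / s))" by (simp add: q_def t_def norm_exp_eq_Re)
    have "9 / s = 9 * (1 / s)" by simp
    then have "1 / s \<le> y\<^sup>2 / 9" using y2 by linarith
    then have "(1 / s) / y\<^sup>2 \<le> (y\<^sup>2 / 9) / y\<^sup>2" by (rule divide_right_mono) simp
    then have sy: "(1 / s) / y\<^sup>2 \<le> 1 / 9" using y0 by simp
    have "Re (q / (1 - q)) \<le> 4 * (1 / s) / y\<^sup>2"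
      unfolding q_def t_def by (rule Re_geometric_le) (use s0 y y0 in auto)
    moreover have "4 * (1 / s) / y\<^sup>2 = 4 * ((1 / s) / y\<^sup>2)" by simp
    ultimately have re: "Re (q / (1 - q)) \<le> 4 / 9" using sy by linarith
    have "norm (overpartition_gf q) \<le> norm (overpartition_gf (of_real (norm q))) * exp (2 * Re (q / (1 - q)) - 2 * (norm q / (1 - norm q)))"
      by (rule norm_overpartition_gf_le) (use s0 nq in auto)
    also have "\<dots> \<le> exp (5 / 2 / (1 / s)) * exp (2 * (4 / 9) - 2 * (1 / (1 / s) - 1))"
      unfolding nq using s0 re one_over_exp_minus_one_ge[of "1 / s"]
      by (intro mult_mono norm_overpartition_gf_real_le exp_mono) auto
    \<comment> \<open>The exponents are \<open>5s/2\<close>, \<open>8/9\<close> from the bound 4/9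
      on the real part, and \<open>-2(s - 1)\<close>.\<close>
    also have "\<dots> = exp (s / 2 + 26 / 9)" by (simp flip: exp_add)
    also have "\<dots> = exp (s / 2) * exp (26 / 9)" by (rule exp_add)
    also have "\<dots> \<le> exp (s / 2) * 21"
    proof (intro mult_left_mono)
      have "exp (26 / 9 :: real) \<le> exp 1 ^ 3" by (simp flip: exp_of_nat_mult)
      also have "\<dots> \<le> 2.75 ^ 3" using e_less_272 by (intro power_mono) auto
      finally show "exp (26 / 9 :: real) \<le> 21" by (simp add: power3_eq_cube)
    qed auto
    finally have P: "norm (overpartition_gf q) \<le> 21 * exp (s / 2)" by simp
    have "X \<le> (1 / s) / y\<^sup>2" unfolding X using s0 y0 by (intro divide_left_mono mult_pos_pos add_nonneg_pos) auto
    with sy have "X \<le> 1 / 9" by linarith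
    moreover have "0 \<le> X" unfolding X using s0 by (intro divide_nonneg_nonneg add_nonneg_nonneg) auto
    ultimately have "pi\<^sup>2 * X \<le> 10 * (1 / 9)" using pi_square_bounds by (intro mult_mono) auto
    moreover have "pi\<^sup>2 / 4 * X = pi\<^sup>2 * X / 4" by simp
    ultimately have "exp (pi\<^sup>2 / 4 * X) \<le> exp (s / 2)" using s by (intro exp_mono) linarith
    then have "norm (main_part t) \<le> 1 * exp (s / 2)"
      unfolding main by (intro mult_mono amp) auto
    with P have "norm (overpartition_gf q) + norm (main_part t) \<le> 23 * exp (s / 2)"
      using exp_gt_zero[of "s / 2"] by linarith
    then show ?thesis
      using norm_triangle_ineq4[of "overpartition_gf q" "main_part t"] unfolding q_def t_def by linarith
  qed
qed

section \<open>A primitive of the Gaussian\<close>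

text \<open>The integral of \<open>exp (u^2)\<close> from 0 to \<open>z\<close>, that is
  \<open>sqrt pi / 2\<close> times the imaginary error function.\<close>

definition gaussian_primitive :: "complex \<Rightarrow> complex" where
  "gaussian_primitive = (SOME J. (\<forall>z. (J has_field_derivative exp (z\<^sup>2)) (at z)) \<and> J 0 = 0)"

lemma gaussian_primitive_exists:
  "(\<forall>z. (gaussian_primitive has_field_derivative exp (z\<^sup>2)) (at z)) \<and> gaussian_primitive 0 = 0"
proof -
  let ?P = "\<lambda>J. (\<forall>z::complex. (J has_field_derivative exp (z\<^sup>2)) (at z)) \<and> J 0 = 0"
  have fd: "(\<lambda>z. exp (z\<^sup>2)) field_differentiable at z" for z :: complex
    unfolding field_differentiable_def by (rule exI) (auto intro!: derivative_eq_intros)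
  have "\<exists>g :: complex \<Rightarrow> complex. \<forall>z\<in>UNIV. (g has_field_derivative exp (z\<^sup>2)) (at z within UNIV)"
  proof (rule holomorphic_convex_primitive[of UNIV "{}" "\<lambda>z. exp (z\<^sup>2)"])
    show "continuous_on UNIV (\<lambda>z::complex. exp (z\<^sup>2))" by (intro continuous_intros)
    fix g :: "complex \<Rightarrow> complex"
    assume "\<And>z. z \<in> UNIV \<Longrightarrow> (g has_field_derivative exp (z\<^sup>2)) (at z within UNIV)"
    then have "(g has_field_derivative exp (z\<^sup>2)) (at z)" for z by simp
    then show "\<exists>g :: complex \<Rightarrow> complex. \<forall>z\<in>UNIV. (g has_field_derivative exp (z\<^sup>2)) (at z within UNIV)"
      by (intro exI[of _ g]) simp
  qed (auto intro: fd)
  then obtain g :: "complex \<Rightarrow> complex" where g: "\<And>z. (g has_field_derivative exp (z\<^sup>2)) (at z)" by auto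
  have "((\<lambda>z. g z - g 0) has_field_derivative exp (z\<^sup>2)) (at z)" for z
    using DERIV_diff[OF g[of z] DERIV_const[of "g 0"]] by simp
  then have "?P (\<lambda>z. g z - g 0)" by simp
  then have "?P (SOME J. ?P J)" by (rule someI[where P = ?P])
  then show ?thesis unfolding gaussian_primitive_def .
qed

lemma gaussian_primitive_deriv: "(gaussian_primitive has_field_derivative exp (z\<^sup>2)) (at z)"
  using gaussian_primitive_exists by blast

lemma gaussian_primitive_0: "gaussian_primitive 0 = 0"
  using gaussian_primitive_exists by blast

lemma gaussian_primitive_minus: "gaussian_primitive (- z) = - gaussian_primitive z"
proof -
  have "((\<lambda>z. gaussian_primitive z + gaussian_primitive (- z)) has_field_derivative 0) (at z)" for z
    by (rule derivative_eq_intros gaussian_primitive_deriv DERIV_chain2[OF gaussian_primitive_deriv] refl | simp)+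
  then have "\<exists>c. \<forall>z\<in>UNIV. gaussian_primitive z + gaussian_primitive (- z) = c"
    by (intro has_field_derivative_zero_constant) auto
  then obtain c where c: "\<And>z. gaussian_primitive z + gaussian_primitive (- z) = c" by auto
  from c[of z] c[of 0] show ?thesis
    by (simp add: gaussian_primitive_0 eq_neg_iff_add_eq_0 add.commute)
qed

lemma gaussian_integral_tendsto: "((\<lambda>v. integral {0..v} (\<lambda>u. exp (- u\<^sup>2))) \<longlongrightarrow> sqrt pi / 2) at_top"
proof -
  let ?f = "\<lambda>x::real. indicator {0..} x *\<^sub>R exp (- x\<^sup>2)"
  have int: "integrable lborel ?f" and val: "integral\<^sup>L lborel ?f = sqrt pi / 2"
    using gaussian_moment_0 by (simp_all add: has_bochner_integral_iff)
  have "((\<lambda>y. \<integral>x. indicator {..y} x *\<^sub>R ?f x \<partial>lborel) \<longlongrightarrow> sqrt pi / 2) at_top"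
    using tendsto_integral_at_top[OF sets_lborel int] unfolding val .
  moreover have "(\<integral>x. indicator {..y} x *\<^sub>R ?f x \<partial>lborel) = integral {0..y} (\<lambda>u. exp (- u\<^sup>2))" for y
  proof -
    have "set_integrable lborel {0..y} (\<lambda>u::real. exp (- u\<^sup>2))"
      by (intro borel_integrable_atLeastAtMost' continuous_intros)
    then have "integral {0..y} (\<lambda>u. exp (- u\<^sup>2)) = (LINT u:{0..y}|lborel. exp (- u\<^sup>2))"
      by (rule set_borel_integral_eq_integral(2)[symmetric])
    also have "\<dots> = (\<integral>x. indicator {..y} x *\<^sub>R ?f x \<partial>lborel)"
      unfolding set_lebesgue_integral_def by (intro Bochner_Integration.integral_cong) (auto simp: indicator_def)
    finally show ?thesis by simp
  qed
  ultimately show ?thesis by simp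
qed

lemma gaussian_primitive_vertical_deriv:
  "((\<lambda>u. gaussian_primitive (Complex x (y + u))) has_vector_derivative \<i> * exp ((Complex x (y + u))\<^sup>2)) (at u within A)"
proof -
  have "((\<lambda>u. Complex x y + \<i> * of_real u) has_vector_derivative \<i> * 1) (at u within A)"
    by (auto intro!: derivative_eq_intros)
  then have "((\<lambda>u. Complex x (y + u)) has_vector_derivative \<i>) (at u within A)"
    by (simp add: complex_eq_iff has_vector_derivative_def Complex_eq algebra_simps)
  from field_vector_diff_chain_within[OF this has_field_derivative_at_within[OF gaussian_primitive_deriv]]
  show ?thesis by (simp add: o_def)
qed

lemma gaussian_primitive_imaginary:
  assumes "0 \<le> v"
  shows "gaussian_primitive (Complex 0 v) = \<i> * of_real (integral {0..v} (\<lambda>u. exp (- u\<^sup>2)))"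
proof -
  have "((\<lambda>u. \<i> * exp ((Complex 0 (0 + u))\<^sup>2)) has_integral
      gaussian_primitive (Complex 0 (0 + v)) - gaussian_primitive (Complex 0 (0 + 0))) {0..v}"
    using assms by (intro fundamental_theorem_of_calculus gaussian_primitive_vertical_deriv)
  moreover have "exp ((Complex 0 u)\<^sup>2) = complex_of_real (exp (- u\<^sup>2))" for u
  proof -
    have "(Complex 0 u)\<^sup>2 = of_real (- u\<^sup>2)" by (simp add: complex_eq_iff power2_eq_square)
    then show ?thesis by (simp only: exp_of_real)
  qed
  moreover have "Complex 0 0 = 0" by (simp add: complex_eq_iff)
  ultimately have "((\<lambda>u. \<i> * complex_of_real (exp (- u\<^sup>2))) has_integral gaussian_primitive (Complex 0 v)) {0..v}"
    by (simp add: gaussian_primitive_0)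
  moreover have "((\<lambda>u. \<i> * complex_of_real (exp (- u\<^sup>2))) has_integral
      \<i> * of_real (integral {0..v} (\<lambda>u. exp (- u\<^sup>2)))) {0..v}"
  proof (intro has_integral_mult_right has_integral_of_real integrable_integral)
    show "(\<lambda>u::real. exp (- u\<^sup>2)) integrable_on {0..v}"
      by (intro integrable_continuous_real continuous_intros)
  qed
  ultimately show ?thesis by (rule has_integral_unique)
qed

lemma gaussian_primitive_imaginary_tendsto:
  "((\<lambda>v. gaussian_primitive (Complex 0 v)) \<longlongrightarrow> \<i> * of_real (sqrt pi / 2)) at_top"
proof -
  have "((\<lambda>v. \<i> * complex_of_real (integral {0..v} (\<lambda>u. exp (- u\<^sup>2)))) \<longlongrightarrow> \<i> * of_real (sqrt pi / 2)) at_top"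
    by (intro tendsto_intros gaussian_integral_tendsto)
  moreover have "\<forall>\<^sub>F v in at_top. \<i> * complex_of_real (integral {0..v} (\<lambda>u. exp (- u\<^sup>2))) = gaussian_primitive (Complex 0 v)"
    using eventually_ge_at_top[of 0] by eventually_elim (simp add: gaussian_primitive_imaginary)
  ultimately show ?thesis by (rule Lim_transform_eventually)
qed

lemma norm_exp_square: "norm (exp ((Complex x y)\<^sup>2)) = exp (x\<^sup>2 - y\<^sup>2)"
  by (simp add: norm_exp_eq_Re power2_eq_square)

text \<open>On the horizontal segment from the imaginary axis the integrand is at most
  \<open>exp (x^2 - v^2)\<close>, so every vertical line inherits the limit from the imaginary axis,
  where it is the half Gaussian integral.\<close>

lemma gaussian_primitive_tendsto:
  "((\<lambda>v. gaussian_primitive (Complex x v)) \<longlongrightarrow> \<i> * of_real (sqrt pi / 2)) at_top"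
proof -
  have le: "norm (gaussian_primitive (Complex x v) - gaussian_primitive (Complex 0 v)) \<le> exp (x\<^sup>2 - v\<^sup>2) * \<bar>x\<bar>" for v
  proof -
    have "norm (gaussian_primitive (Complex x v) - gaussian_primitive (Complex 0 v)) \<le>
        exp (x\<^sup>2 - v\<^sup>2) * norm (Complex x v - Complex 0 v)"
    proof (rule field_differentiable_bound[where S = "closed_segment (Complex x v) (Complex 0 v)"])
      fix z assume "z \<in> closed_segment (Complex x v) (Complex 0 v)"
      then obtain u where u: "0 \<le> u" "u \<le> 1" "z = (1 - u) *\<^sub>R Complex x v + u *\<^sub>R Complex 0 v"
        by (auto simp: closed_segment_def)
      have z: "z = Complex ((1 - u) * x) v" using u(3) by (simp add: complex_eq_iff algebra_simps)
      have "((1 - u) * x)\<^sup>2 \<le> 1 * x\<^sup>2"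
        unfolding power_mult_distrib using u by (intro mult_right_mono) (auto simp: power_le_one)
      then show "norm (exp (z\<^sup>2)) \<le> exp (x\<^sup>2 - v\<^sup>2)" unfolding z norm_exp_square by simp
    qed (auto intro: has_field_derivative_at_within gaussian_primitive_deriv)
    moreover have "norm (Complex x v - Complex 0 v) = \<bar>x\<bar>" by (simp add: cmod_def)
    ultimately show ?thesis by simp
  qed
  have "((\<lambda>v. exp (x\<^sup>2 - v\<^sup>2) * \<bar>x\<bar>) \<longlongrightarrow> 0) at_top" by real_asymp
  then have "((\<lambda>v. gaussian_primitive (Complex x v) - gaussian_primitive (Complex 0 v)) \<longlongrightarrow> 0) at_top"
    by (rule Lim_null_comparison[OF always_eventually[OF allI[OF le]]])
  from tendsto_add[OF this gaussian_primitive_imaginary_tendsto] show ?thesis by simp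
qed

text \<open>The difference is the integral of \<open>exp (u^2)\<close> along the vertical ray
  upwards from \<open>z\<close>. For \<open>Im z \<ge> 0\<close> the integrand at height \<tau>
  above \<open>z\<close> is at most its value at \<open>z\<close> times
  \<open>exp (- \<tau>^2)\<close>, and the half Gaussian integral is below 1.\<close>

lemma gaussian_primitive_upper:
  assumes "0 \<le> Im z"
  shows "norm (gaussian_primitive z - \<i> * of_real (sqrt pi / 2)) \<le> norm (exp (z\<^sup>2))"
proof -
  obtain x y where z: "z = Complex x y" by (cases z)
  have y: "0 \<le> y" using assms z by simp
  let ?J = "gaussian_primitive"
  \<comment> \<open>A real primitive of the majorant: along the imaginary axis the derivative of
    \<open>gaussian_primitive\<close> is \<open>\<i>\<close> times the real Gaussian.\<close>
  let ?K = "\<lambda>\<tau>. exp (x\<^sup>2 - y\<^sup>2) * Im (?J (Complex 0 (0 + \<tau>)))"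
  have dJ: "((\<lambda>\<tau>. ?J (Complex x (y + \<tau>))) has_vector_derivative \<i> * exp ((Complex x (y + \<tau>))\<^sup>2)) (at \<tau> within A)" for x y \<tau> A
    by (rule gaussian_primitive_vertical_deriv)
  have dK: "(?K has_vector_derivative exp (x\<^sup>2 - y\<^sup>2) * exp (- \<tau>\<^sup>2)) (at \<tau> within A)" for \<tau> A
  proof -
    have "((\<lambda>\<tau>. Im (?J (Complex 0 (0 + \<tau>)))) has_vector_derivative Im (\<i> * exp ((Complex 0 (0 + \<tau>))\<^sup>2))) (at \<tau> within A)"
      by (rule bounded_linear.has_vector_derivative[OF bounded_linear_Im dJ])
    moreover have "Im (\<i> * exp ((Complex 0 (0 + \<tau>))\<^sup>2)) = exp (- \<tau>\<^sup>2)"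
      by (simp add: Re_exp power2_eq_square)
    ultimately show ?thesis by (simp add: has_real_derivative_iff_has_vector_derivative[symmetric] DERIV_cmult)
  qed
  have bound: "norm (?J (Complex x (y + \<tau>)) - ?J z) \<le> exp (x\<^sup>2 - y\<^sup>2) * 1" if \<tau>: "0 < \<tau>" "norm (?J (Complex 0 \<tau>)) \<le> 1" for \<tau>
  proof -
    have "norm (?J (Complex x (y + \<tau>)) - ?J (Complex x (y + 0))) \<le> ?K \<tau> - ?K 0"
    proof (rule differentiable_bound_general[OF \<tau>(1)])
      show "continuous_on {0..\<tau>} (\<lambda>\<tau>. ?J (Complex x (y + \<tau>)))" "continuous_on {0..\<tau>} ?K"
        by (rule continuous_on_vector_derivative, rule dJ) (rule continuous_on_vector_derivative, rule dK)
      fix \<tau>' assume t: "0 < \<tau>'" "\<tau>' < \<tau>"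
      show "norm (\<i> * exp ((Complex x (y + \<tau>'))\<^sup>2)) \<le> exp (x\<^sup>2 - y\<^sup>2) * exp (- \<tau>'\<^sup>2)"
      proof -
        have "y\<^sup>2 + \<tau>'\<^sup>2 \<le> (y + \<tau>')\<^sup>2" using y t by (simp add: power2_sum)
        then show ?thesis unfolding norm_mult norm_exp_square exp_add[symmetric] by simp
      qed
    qed (rule dJ dK)+
    also have "?K \<tau> - ?K 0 = exp (x\<^sup>2 - y\<^sup>2) * Im (?J (Complex 0 \<tau>))"
    proof -
      have "Complex 0 0 = 0" by (simp add: complex_eq_iff)
      then show ?thesis by (simp add: gaussian_primitive_0)
    qed
    also have "\<dots> \<le> exp (x\<^sup>2 - y\<^sup>2) * 1"
      using abs_Im_le_cmod[of "?J (Complex 0 \<tau>)"] \<tau>(2) by (intro mult_left_mono) auto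
    finally show ?thesis by (simp add: z)
  qed
  have "norm (\<i> * of_real (sqrt pi / 2) - ?J z) \<le> exp (x\<^sup>2 - y\<^sup>2) * 1"
  proof (rule tendsto_upperbound)
    have "filterlim (\<lambda>\<tau>. y + \<tau>) at_top at_top"
      by (intro filterlim_tendsto_add_at_top[OF tendsto_const] filterlim_ident)
    from filterlim_compose[OF gaussian_primitive_tendsto this]
    show "((\<lambda>\<tau>. norm (?J (Complex x (y + \<tau>)) - ?J z)) \<longlongrightarrow> norm (\<i> * of_real (sqrt pi / 2) - ?J z)) at_top"
      by (intro tendsto_intros)
    have "sqrt pi < 2" using pi_less_4 real_sqrt_less_mono[of pi 4] by simp
    then have "norm (\<i> * complex_of_real (sqrt pi / 2)) < 1" by (simp add: norm_mult)
    then have "\<forall>\<^sub>F \<tau> in at_top. norm (?J (Complex 0 \<tau>)) < 1"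
      by (rule order_tendstoD(2)[OF tendsto_norm[OF gaussian_primitive_imaginary_tendsto]])
    then show "\<forall>\<^sub>F \<tau> in at_top. norm (?J (Complex x (y + \<tau>)) - ?J z) \<le> exp (x\<^sup>2 - y\<^sup>2) * 1"
      using eventually_gt_at_top[of 0] by eventually_elim (use bound in auto)
  qed simp
  then show ?thesis unfolding z norm_exp_square by (simp add: norm_minus_commute)
qed

lemma gaussian_primitive_half_plane:
  assumes "\<delta> \<in> {1, -1}" "0 \<le> \<delta> * Im z"
  shows "norm (gaussian_primitive z - of_real \<delta> * (\<i> * of_real (sqrt pi / 2))) \<le> norm (exp (z\<^sup>2))"
proof (cases "\<delta> = 1")
  case True
  then show ?thesis using gaussian_primitive_upper[of z] assms by simp
next
  case False
  then have \<delta>: "\<delta> = -1" using assms by simp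
  have "norm (gaussian_primitive (- z) - \<i> * of_real (sqrt pi / 2)) \<le> norm (exp ((- z)\<^sup>2))"
    using assms \<delta> by (intro gaussian_primitive_upper) simp
  moreover have "gaussian_primitive (- z) - \<i> * of_real (sqrt pi / 2) = - (gaussian_primitive z - of_real \<delta> * (\<i> * of_real (sqrt pi / 2)))"
    unfolding \<delta> gaussian_primitive_minus by simp
  ultimately show ?thesis by (simp only: norm_minus_cancel power2_minus)
qed

lemma norm_gaussian_primitive_le: "norm (gaussian_primitive z) \<le> 1 + norm (exp (z\<^sup>2))"
proof -
  define \<delta> :: real where "\<delta> = (if 0 \<le> Im z then 1 else -1)"
  have "norm (gaussian_primitive z - of_real \<delta> * (\<i> * of_real (sqrt pi / 2))) \<le> norm (exp (z\<^sup>2))"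
    by (rule gaussian_primitive_half_plane) (auto simp: \<delta>_def)
  moreover have "sqrt pi < 2" using pi_less_4 real_sqrt_less_mono[of pi 4] by simp
  then have "norm (of_real \<delta> * (\<i> * complex_of_real (sqrt pi / 2))) \<le> 1"
    by (simp add: norm_mult \<delta>_def)
  ultimately show ?thesis
    using norm_triangle_sub[of "gaussian_primitive z" "of_real \<delta> * (\<i> * of_real (sqrt pi / 2))"] by linarith
qed

section \<open>The coefficient integral\<close>

lemma exp_int_contour_integral:
  "((\<lambda>t. exp (of_int m * t)) has_contour_integral (if m = 0 then 2 * of_real pi * \<i> else 0))
     (linepath (Complex \<sigma> (- pi)) (Complex \<sigma> pi))"
proof (cases "m = 0")
  case True
  have "Complex \<sigma> pi - Complex \<sigma> (- pi) = 2 * of_real pi * \<i>" by (simp add: complex_eq_iff)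
  with has_contour_integral_const_linepath[of 1 "Complex \<sigma> pi" "Complex \<sigma> (- pi)"] show ?thesis
    by (simp only: True of_int_0 mult_zero_left exp_zero mult_1 if_True refl)
next
  case False
  let ?F = "\<lambda>t. exp (of_int m * t) / of_int m"
  have "(?F has_field_derivative exp (of_int m * t)) (at t within UNIV)" for t :: complex
    using False by (auto intro!: derivative_eq_intros)
  from contour_integral_primitive[OF this, of "linepath (Complex \<sigma> (- pi)) (Complex \<sigma> pi)"]
  have "((\<lambda>t. exp (of_int m * t)) has_contour_integral ?F (Complex \<sigma> pi) - ?F (Complex \<sigma> (- pi)))
      (linepath (Complex \<sigma> (- pi)) (Complex \<sigma> pi))" by simp
  moreover have "exp (of_int m * Complex \<sigma> pi) = exp (of_int m * Complex \<sigma> (- pi))"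
    unfolding exp_eq by (rule exI[of _ m]) (simp add: complex_eq_iff)
  ultimately show ?thesis using False by simp
qed

lemma vertical_segment:
  assumes "t \<in> closed_segment (Complex \<sigma> (- pi)) (Complex \<sigma> pi)"
  obtains y where "t = Complex \<sigma> y" "\<bar>y\<bar> \<le> pi"
proof -
  from assms obtain u where u: "0 \<le> u" "u \<le> 1" "t = (1 - u) *\<^sub>R Complex \<sigma> (- pi) + u *\<^sub>R Complex \<sigma> pi"
    by (auto simp: closed_segment_def)
  have "t = Complex \<sigma> ((2 * u - 1) * pi)" using u(3) by (simp add: complex_eq_iff algebra_simps)
  moreover have "\<bar>(2 * u - 1) * pi\<bar> \<le> 1 * pi"
    unfolding abs_mult using u by (intro mult_mono) auto
  ultimately show thesis using that by simp
qed

text \<open>The segment is one period of \<open>exp (- t)\<close>, along which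
  \<open>norm (exp (- t))\<close> has the constant value \<open>exp (- \<sigma>)\<close>. The power
  series converges uniformly there and orthogonality of the exponentials singles out one
  coefficient.\<close>

lemma num_overpartitions_contour_integral:
  assumes \<sigma>: "0 < \<sigma>"
  shows "((\<lambda>t. overpartition_gf (exp (- t)) * exp (of_nat n * t)) has_contour_integral
    2 * of_real pi * \<i> * of_nat (num_overpartitions n)) (linepath (Complex \<sigma> (- pi)) (Complex \<sigma> pi))"
proof -
  let ?p = "2 * of_real pi * \<i> * of_nat (num_overpartitions n) :: complex"
  let ?f = "\<lambda>t. overpartition_gf (exp (- t)) * exp (of_nat n * t)"
  let ?\<gamma> = "linepath (Complex \<sigma> (- pi)) (Complex \<sigma> pi)"
  define g where "g k t = of_nat (num_overpartitions k) * exp (- t) ^ k * exp (of_nat n * t)" for k and t :: complex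
  define f where "f M t = (\<Sum>k<M. g k t)" for M t
  have g: "g k t = of_nat (num_overpartitions k) * exp (of_int (int n - int k) * t)" for k t
  proof -
    have "exp (- t) ^ k = exp (of_nat k * - t)" by (rule exp_of_nat_mult[symmetric])
    moreover have "of_nat k * - t + of_nat n * t = of_int (int n - int k) * t" by (simp add: algebra_simps)
    ultimately show ?thesis unfolding g_def mult.assoc by (simp only: exp_add[symmetric])
  qed
  have f_int: "(f M has_contour_integral
      (\<Sum>k<M. of_nat (num_overpartitions k) * (if int n - int k = 0 then 2 * of_real pi * \<i> else 0))) ?\<gamma>" for M
    unfolding f_def g by (intro has_contour_integral_sum has_contour_integral_lmul exp_int_contour_integral) auto
  have val: "contour_integral ?\<gamma> (f M) = ?p" if "n < M" for M
  proof -
    have "(\<Sum>k<M. of_nat (num_overpartitions k) * (if int n - int k = 0 then 2 * of_real pi * \<i> else 0)) =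
        (\<Sum>k<M. if k = n then of_nat (num_overpartitions n) * (2 * of_real pi * \<i>) else (0::complex))"
      by (intro sum.cong) auto
    also have "\<dots> = ?p"
      using that by (simp add: sum.delta)
    finally show ?thesis using contour_integral_unique[OF f_int[of M]] by simp
  qed
  have ul: "uniform_limit (path_image ?\<gamma>) f (\<lambda>t. suminf (\<lambda>k. g k t)) sequentially"
    unfolding f_def
  proof (rule Weierstrass_m_test)
    fix k t assume "t \<in> path_image ?\<gamma>"
    then obtain y where t: "t = Complex \<sigma> y" by (auto elim: vertical_segment)
    show "norm (g k t) \<le> real (num_overpartitions k) * exp (- \<sigma>) ^ k * exp (real n * \<sigma>)"
      unfolding g_def t norm_mult norm_power norm_exp_eq_Re norm_of_nat by simp
  next
    show "summable (\<lambda>k. real (num_overpartitions k) * exp (- \<sigma>) ^ k * exp (real n * \<sigma>))"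
      using \<sigma> by (intro summable_mult2 summable_num_overpartitions) auto
  qed
  have sums: "suminf (\<lambda>k. g k t) = overpartition_gf (exp (- t)) * exp (of_nat n * t)" if "t \<in> path_image ?\<gamma>" for t
  proof -
    from that obtain y where "t = Complex \<sigma> y" by (auto elim: vertical_segment)
    then have "norm (exp (- t)) < 1" using \<sigma> by (simp add: norm_exp_eq_Re)
    from sums_mult2[OF overpartition_gf_sums[OF this]] show ?thesis
      unfolding g_def by (simp add: sums_iff)
  qed
  have ul': "uniform_limit (path_image ?\<gamma>) f ?f sequentially"
    using ul uniform_limit_cong'[of "path_image ?\<gamma>" f f "\<lambda>t. suminf (\<lambda>k. g k t)"] sums by auto
  have ev: "\<forall>\<^sub>F M in sequentially. f M contour_integrable_on ?\<gamma>"
    using has_contour_integral_integrable[OF f_int] by (intro always_eventually allI)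
  have vd: "norm (vector_derivative ?\<gamma> (at x)) \<le> norm (Complex \<sigma> pi - Complex \<sigma> (- pi))" for x
    by (simp add: vector_derivative_linepath_at)
  note lim = contour_integral_uniform_limit[OF ev ul' vd valid_path_linepath trivial_limit_sequentially]
  have "(\<lambda>M. contour_integral ?\<gamma> (f M)) \<longlonglongrightarrow> ?p"
  proof (rule tendsto_eventually)
    show "\<forall>\<^sub>F M in sequentially. contour_integral ?\<gamma> (f M) = ?p"
      using eventually_gt_at_top[of n] by eventually_elim (rule val)
  qed
  with lim(2) have "contour_integral ?\<gamma> ?f =
      ?p"
    by (rule LIMSEQ_unique)
  with has_contour_integral_integral[OF lim(1)] show ?thesis by (simp only:)
qed

section \<open>The asymptotic formula\<close>

context
  fixes s :: real
  assumes s: "16 \<le> s"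
begin

definition main_exp :: "complex \<Rightarrow> complex" where
  "main_exp t = exp (of_real (s\<^sup>2) * t + of_real ((pi / 2)\<^sup>2) / t)"

definition main_branch :: "real \<Rightarrow> complex \<Rightarrow> complex" where
  "main_branch \<epsilon> t = exp (- of_real (\<epsilon> * (pi * s))) *
     gaussian_primitive (of_real s * csqrt t + of_real (\<epsilon> * (pi / 2)) / csqrt t)"

text \<open>Completing the square, \<open>s\<^sup>2 t + (\<pi>/2)\<^sup>2/t = (s \<surd>t \<plusminus> (\<pi>/2)/\<surd>t)\<^sup>2 \<mp> \<pi> s\<close>, so the main part times
  \<open>exp (s\<^sup>2 t)\<close> has a primitive in terms of the Gaussian one.\<close>

definition main_primitive :: "complex \<Rightarrow> complex" where
  "main_primitive t = (csqrt t * main_exp t + of_real (pi / 2 - 1 / (2 * s)) * main_branch (-1) t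
      - of_real (pi / 2 + 1 / (2 * s)) * main_branch 1 t) / of_real (2 * s\<^sup>2 * sqrt pi)"

lemma complete_square:
  assumes "t \<noteq> 0" "\<epsilon>\<^sup>2 = 1"
  shows "exp (- of_real (\<epsilon> * (pi * s))) * exp ((of_real s * csqrt t + of_real (\<epsilon> * (pi / 2)) / csqrt t)\<^sup>2) = main_exp t"
proof -
  define w where "w = csqrt t"
  have w: "w \<noteq> 0" "w\<^sup>2 = t" using assms by (auto simp: w_def)
  have "(of_real s * w + of_real (\<epsilon> * (pi / 2)) / w)\<^sup>2 =
      of_real (s\<^sup>2) * w\<^sup>2 + of_real (\<epsilon>\<^sup>2) * of_real ((pi / 2)\<^sup>2) / w\<^sup>2 + of_real (\<epsilon> * (pi * s))"
    using w(1) by (simp add: power2_sum power_mult_distrib power_divide)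
  then show ?thesis
    unfolding main_exp_def w_def[symmetric] exp_add[symmetric] assms(2) w(2) by simp
qed

lemma main_branch_deriv:
  assumes t: "0 < Re t" and \<epsilon>: "\<epsilon>\<^sup>2 = 1"
  shows "(main_branch \<epsilon> has_field_derivative
    main_exp t * (of_real s / (2 * csqrt t) - of_real (\<epsilon> * (pi / 2)) / (2 * csqrt t * t))) (at t)"
proof -
  define w where "w = csqrt t"
  let ?d = "of_real s * inverse (2 * w) + (0 * w - of_real (\<epsilon> * (pi / 2)) * inverse (2 * w)) / (w * w)"
  let ?g = "exp ((of_real s * csqrt t + of_real (\<epsilon> * (pi / 2)) / csqrt t)\<^sup>2)"
  have t0: "t \<noteq> 0" "t \<notin> \<real>\<^sub>\<le>\<^sub>0" using t by (auto elim!: nonpos_Reals_cases)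
  have w: "w \<noteq> 0" "w\<^sup>2 = t" using t0 by (auto simp: w_def)
  have dw: "(csqrt has_field_derivative inverse (2 * w)) (at t)"
    unfolding w_def by (rule has_field_derivative_csqrt[OF t0(2)])
  have "((\<lambda>t. of_real s * csqrt t + of_real (\<epsilon> * (pi / 2)) / csqrt t) has_field_derivative
      ?d) (at t)"
    unfolding w_def
    by (intro DERIV_add DERIV_cmult DERIV_divide DERIV_const dw[unfolded w_def]) (use t0 in auto)
  from DERIV_cmult[OF DERIV_chain2[OF gaussian_primitive_deriv this], of "exp (- of_real (\<epsilon> * (pi * s)))"]
  have "(main_branch \<epsilon> has_field_derivative exp (- of_real (\<epsilon> * (pi * s))) *
      (?g *
        ?d)) (at t)"
    unfolding main_branch_def .
  also have "exp (- of_real (\<epsilon> * (pi * s))) *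
      (?g *
        ?d) =
      main_exp t * ?d"
    by (simp only: mult.assoc[of "exp _" "exp _", symmetric] complete_square[OF t0(1) \<epsilon>])
  also have "?d =
      of_real s / (2 * w) - of_real (\<epsilon> * (pi / 2)) / (2 * w * t)"
    unfolding w(2)[symmetric] by (simp add: inverse_eq_divide power2_eq_square)
  finally show ?thesis unfolding w_def .
qed

text \<open>Write \<open>w\<close> for \<open>csqrt t\<close>, \<open>E\<close> for
  \<open>main_exp t\<close> and \<open>a = pi/2\<close>. The derivative of \<open>w E\<close> is the
  wanted \<open>s^2 w E\<close> plus \<open>E/(2w) - a^2 E/w^3\<close>. The branches have
  derivatives \<open>E (s/(2w) \<plusminus> a/(2w^3))\<close>, and the coefficients
  \<open>a - 1/(2s)\<close> and \<open>-(a + 1/(2s))\<close> are the solution of the two equations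
  that remove the surplus.\<close>

lemma main_primitive_deriv:
  assumes t: "0 < Re t"
  shows "(main_primitive has_field_derivative main_part t * exp (of_real (s\<^sup>2) * t)) (at t)"
proof -
  define w where "w = csqrt t"
  define E where "E = main_exp t"
  define a where "a = complex_of_real (pi / 2)"
  define \<sigma> where "\<sigma> = complex_of_real s"
  define d where "d = complex_of_real (2 * s\<^sup>2 * sqrt pi)"
  have t0: "t \<noteq> 0" "t \<notin> \<real>\<^sub>\<le>\<^sub>0" using t by (auto elim!: nonpos_Reals_cases)
  have w: "w \<noteq> 0" "t = w\<^sup>2" using t0 by (auto simp: w_def)
  have \<sigma>: "\<sigma> \<noteq> 0" using s by (simp add: \<sigma>_def)
  have d: "d \<noteq> 0" "d = 2 * \<sigma>\<^sup>2 * of_real (sqrt pi)" using s by (simp_all add: d_def \<sigma>_def)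
  have c: "of_real (pi / 2 - 1 / (2 * s)) = a - 1 / (2 * \<sigma>)" "of_real (pi / 2 + 1 / (2 * s)) = a + 1 / (2 * \<sigma>)"
    by (simp_all add: a_def \<sigma>_def)
  have dw: "(csqrt has_field_derivative inverse (2 * w)) (at t)"
    unfolding w_def by (rule has_field_derivative_csqrt[OF t0(2)])
  have "((\<lambda>t. of_real (s\<^sup>2) * t + of_real ((pi / 2)\<^sup>2) / t) has_field_derivative
      of_real (s\<^sup>2) * 1 + (0 * t - of_real ((pi / 2)\<^sup>2) * 1) / (t * t)) (at t)"
    by (intro DERIV_add DERIV_cmult DERIV_divide DERIV_const DERIV_ident t0)
  from DERIV_chain2[OF DERIV_exp this]
  have dE: "(main_exp has_field_derivative E * (of_real (s\<^sup>2) * 1 + (0 * t - of_real ((pi / 2)\<^sup>2) * 1) / (t * t))) (at t)"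
    unfolding main_exp_def[abs_def] E_def .
  let ?b = "(inverse (2 * w) * main_exp t + E * (of_real (s\<^sup>2) * 1 + (0 * t - of_real ((pi / 2)\<^sup>2) * 1) / (t * t)) * csqrt t
       + of_real (pi / 2 - 1 / (2 * s)) * (main_exp t * (of_real s / (2 * csqrt t) - of_real (-1 * (pi / 2)) / (2 * csqrt t * t)))
       - of_real (pi / 2 + 1 / (2 * s)) * (main_exp t * (of_real s / (2 * csqrt t) - of_real (1 * (pi / 2)) / (2 * csqrt t * t))))"
  have "(main_primitive has_field_derivative
      ?b / d) (at t)"
    unfolding main_primitive_def[abs_def] d_def
    by (intro DERIV_cdivide DERIV_diff DERIV_add DERIV_cmult DERIV_mult dw dE main_branch_deriv t) auto
  moreover have "?b =
      \<sigma>\<^sup>2 * (w * E)"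
  proof -
    have r: "of_real (s\<^sup>2) = \<sigma>\<^sup>2" "of_real ((pi / 2)\<^sup>2) = a\<^sup>2" "of_real (-1 * (pi / 2)) = - a" "of_real (1 * (pi / 2)) = a"
      "complex_of_real s = \<sigma>"
      by (simp_all add: \<sigma>_def a_def)
    have "inverse (2 * w) * E + E * (\<sigma>\<^sup>2 * 1 + (0 * w\<^sup>2 - a\<^sup>2 * 1) / (w\<^sup>2 * w\<^sup>2)) * w
       + (a - 1 / (2 * \<sigma>)) * (E * (\<sigma> / (2 * w) - - a / (2 * w * w\<^sup>2)))
       - (a + 1 / (2 * \<sigma>)) * (E * (\<sigma> / (2 * w) - a / (2 * w * w\<^sup>2))) = \<sigma>\<^sup>2 * (w * E)"
      using w(1) \<sigma> by (simp add: field_simps power2_eq_square)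
    then show ?thesis
      unfolding r c E_def[symmetric] w_def[symmetric] unfolding w(2) .
  qed
  moreover have "\<sigma>\<^sup>2 * (w * E) / d = main_part t * exp (of_real (s\<^sup>2) * t)"
  proof -
    have "exp (of_real (pi\<^sup>2 / 4) / t) * exp (of_real (s\<^sup>2) * t) = E"
      by (simp add: E_def main_exp_def power_divide add.commute flip: exp_add)
    then have "main_part t * exp (of_real (s\<^sup>2) * t) = w / (2 * of_real (sqrt pi)) * E"
      by (simp only: main_part_def w_def mult.assoc)
    then show ?thesis unfolding d(2) using \<sigma> by simp
  qed
  ultimately show ?thesis by simp
qed

text \<open>At the ends of the segment \<open>main_exp\<close> has size about \<open>exp s\<close>.
  The only large term is the branch with sign -1, whose prefactor is \<open>exp (pi s)\<close>;
  there the Gaussian primitive is replaced by its limit in the half-plane of the endpoint. The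
  factor \<open>1 - 1/(pi s)\<close> is the branch coefficient \<open>pi/2 - 1/(2s)\<close> divided
  by \<open>pi/2\<close>.\<close>

lemma main_primitive_endpoint:
  assumes \<delta>: "\<delta> \<in> {1, -1}"
  shows "norm (main_primitive (Complex (1 / s) (\<delta> * pi)) -
    of_real \<delta> * (\<i> * of_real (pi / (8 * s\<^sup>2) * (1 - 1 / (pi * s)) * exp (pi * s)))) \<le> exp s"
proof -
  define t where "t = Complex (1 / s) (\<delta> * pi)"
  define w where "w = csqrt t"
  define e where "e = norm (main_exp t)"
  have s0: "0 < 1 / s" "1 / s \<le> 1 / 16" using s by (auto simp: field_simps)
  have pi: "3 < pi" "pi \<le> 63 / 20" using pi_gt3 order_trans[OF pi_approx(2), of "63 / 20"] by auto
  have t0: "0 < Re t" "t \<noteq> 0" using s0 by (auto simp: t_def complex_eq_iff)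
  have "norm t \<le> \<bar>Re t\<bar> + \<bar>Im t\<bar>" by (rule cmod_le)
  also have "\<dots> = 1 / s + pi" using s0 \<delta> by (auto simp: t_def)
  also have "\<dots> \<le> 4" using s0 pi by linarith
  finally have nw: "norm w \<le> 2" by (simp add: w_def real_le_lsqrt)
  have ww: "w\<^sup>2 = t" "w \<noteq> 0" using t0 by (auto simp: w_def)
  have Rew: "0 < Re w"
  proof -
    have "Re w \<noteq> 0"
    proof
      assume "Re w = 0"
      then have "Re (w\<^sup>2) \<le> 0" by (simp add: power2_eq_square)
      then show False using ww t0 by simp
    qed
    moreover have "0 \<le> Re w" unfolding w_def by (rule Re_csqrt)
    ultimately show ?thesis by simp
  qed
  \<comment> \<open>The root has positive real part, so its imaginary part has the sign \<delta> of
    that of \<open>t\<close>.\<close>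
  have "Im (w\<^sup>2) = 2 * Re w * Im w" by (simp add: power2_eq_square)
  then have "2 * Re w * (\<delta> * Im w) = \<delta> * (\<delta> * pi)" unfolding ww by (simp add: t_def)
  also have "\<dots> = pi" using \<delta> by auto
  finally have "0 < 2 * Re w * (\<delta> * Im w)" using pi by simp
  then have Imw: "0 < \<delta> * Im w" using Rew by (simp add: zero_less_mult_iff)
  have e: "e \<le> 3 * exp s"
  proof -
    have "Re (1 / t) = (1 / s) / ((1 / s)\<^sup>2 + pi\<^sup>2)"
      using \<delta> by (auto simp: t_def Re_divide)
    also have "\<dots> \<le> (1 / s) / pi\<^sup>2"
      using s0 by (intro divide_left_mono mult_pos_pos add_nonneg_pos) auto
    finally have "(pi / 2)\<^sup>2 * Re (1 / t) \<le> (pi / 2)\<^sup>2 * ((1 / s) / pi\<^sup>2)" by (intro mult_left_mono) auto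
    also have "\<dots> \<le> 1" using s0 by (simp add: power_divide)
    finally have b: "(pi / 2)\<^sup>2 * Re (1 / t) \<le> 1" .
    have "Re (of_real (s\<^sup>2) * t + of_real ((pi / 2)\<^sup>2) / t) = s\<^sup>2 * Re t + (pi / 2)\<^sup>2 * Re (1 / t)"
    proof -
      have "of_real ((pi / 2)\<^sup>2) / t = of_real ((pi / 2)\<^sup>2) * (1 / t)" by simp
      then show ?thesis
        by (simp only: plus_complex.sel times_complex.sel Re_complex_of_real Im_complex_of_real mult_zero_left diff_zero)
    qed
    also have "s\<^sup>2 * Re t = s" using s by (simp add: t_def power2_eq_square)
    finally have "e = exp (s + (pi / 2)\<^sup>2 * Re (1 / t))"
      unfolding e_def main_exp_def norm_exp_eq_Re by simp
    also have "\<dots> \<le> exp (s + 1)" using b by simp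
    also have "\<dots> = exp s * exp 1" by (rule exp_add)
    also have "\<dots> \<le> exp s * 3" using exp_le by (intro mult_left_mono) auto
    finally show ?thesis by simp
  qed
  have branch: "exp (- (\<epsilon> * (pi * s))) * norm (exp ((of_real s * w + of_real (\<epsilon> * (pi / 2)) / w)\<^sup>2)) = e"
    if "\<epsilon>\<^sup>2 = 1" for \<epsilon>
    using arg_cong[OF complete_square[OF t0(2) that], of norm]
    unfolding e_def w_def norm_mult norm_exp_eq_Re by simp
  define c where "c = of_real \<delta> * (\<i> * complex_of_real (sqrt pi / 2))"
  have B: "norm (main_branch (-1) t - of_real (exp (pi * s)) * c) \<le> e"
  proof -
    let ?z = "of_real s * w + of_real (-1 * (pi / 2)) / w"
    \<comment> \<open>Inversion reverses the sign of the imaginary part and so does the minus in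
      front: both summands of \<open>?z\<close> lie in the same half-plane.\<close>
    have "Im ?z = s * Im w + pi / 2 * (Im w / (norm w)\<^sup>2)"
    proof -
      have a: "Im (inverse w) = - (Im w / (norm w)\<^sup>2)"
        unfolding cmod_power2 by simp
      have b: "Im ?z = s * Im w + -1 * (pi / 2) * Im (inverse w)"
        by (simp only: divide_inverse[of "of_real _" w] plus_complex.sel times_complex.sel Re_complex_of_real
            Im_complex_of_real mult_zero_left add_0_right)
      show ?thesis unfolding b a by simp
    qed
    then have z: "\<delta> * Im ?z = (\<delta> * Im w) * (s + pi / 2 / (norm w)\<^sup>2)"
      by (simp only: distrib_left times_divide_eq_left times_divide_eq_right mult_ac)
    have "0 \<le> s + pi / 2 / (norm w)\<^sup>2" using s by simp
    then have "0 \<le> \<delta> * Im ?z"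
      unfolding z by (rule mult_nonneg_nonneg[OF less_imp_le[OF Imw]])
    then have "norm (gaussian_primitive ?z - c) \<le> norm (exp (?z\<^sup>2))"
      unfolding c_def by (rule gaussian_primitive_half_plane[OF \<delta>])
    then have "exp (pi * s) * norm (gaussian_primitive ?z - c) \<le> exp (pi * s) * norm (exp (?z\<^sup>2))"
      by (intro mult_left_mono) auto
    also have "\<dots> = e" using branch[of "-1"] by simp
    also have "exp (pi * s) * norm (gaussian_primitive ?z - c) = norm (main_branch (-1) t - of_real (exp (pi * s)) * c)"
    proof -
      have "exp (- complex_of_real (-1 * (pi * s))) = of_real (exp (pi * s))"
        by (simp only: of_real_minus[symmetric] exp_of_real) simp
      then have "main_branch (-1) t - of_real (exp (pi * s)) * c = of_real (exp (pi * s)) * (gaussian_primitive ?z - c)"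
        unfolding main_branch_def w_def by (simp only: right_diff_distrib)
      then show ?thesis by (simp add: norm_mult)
    qed
    finally show ?thesis .
  qed
  have A: "norm (main_branch 1 t) \<le> 1 + e"
  proof -
    let ?z = "of_real s * w + of_real (1 * (pi / 2)) / w"
    have "norm (main_branch 1 t) = exp (- (1 * (pi * s))) * norm (gaussian_primitive ?z)"
      unfolding main_branch_def w_def norm_mult norm_exp_eq_Re by simp
    also have "\<dots> \<le> exp (- (1 * (pi * s))) * (1 + norm (exp (?z\<^sup>2)))"
      by (intro mult_left_mono norm_gaussian_primitive_le) auto
    also have "\<dots> = exp (- (1 * (pi * s))) + e"
      using branch[of 1] by (simp only: distrib_left power_one mult_1_right)
    also have "\<dots> \<le> 1 + e" using s by simp
    finally show ?thesis .
  qed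
  define D where "D = 2 * s\<^sup>2 * sqrt pi"
  have "256 \<le> s\<^sup>2" using s power_mono[of 16 s 2] by simp
  moreover have "1 \<le> sqrt pi" using pi by simp
  ultimately have "256 * 1 \<le> s\<^sup>2 * sqrt pi" by (intro mult_mono) auto
  then have D: "512 \<le> D" by (simp add: D_def mult.commute)
  define k where "k = pi / 2 - 1 / (2 * s)"
  define k' where "k' = pi / 2 + 1 / (2 * s)"
  have k: "\<bar>k\<bar> \<le> 2" "\<bar>k'\<bar> \<le> 2"
  proof -
    have "1 / (2 * s) = (1 / s) / 2" by simp
    then show "\<bar>k\<bar> \<le> 2" "\<bar>k'\<bar> \<le> 2" unfolding k_def k'_def using s0 pi by linarith+
  qed
  have "of_real D * (main_primitive t - of_real (k * exp (pi * s) / D) * c) =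
      w * main_exp t + of_real k * (main_branch (-1) t - of_real (exp (pi * s)) * c) - of_real k' * main_branch 1 t"
    using D unfolding main_primitive_def D_def[symmetric] k_def[symmetric] k'_def[symmetric] w_def[symmetric]
    by (simp add: field_simps)
  then have "D * norm (main_primitive t - of_real (k * exp (pi * s) / D) * c) =
      norm (w * main_exp t + of_real k * (main_branch (-1) t - of_real (exp (pi * s)) * c) - of_real k' * main_branch 1 t)"
    using D by (metis abs_of_nonneg norm_mult norm_of_real order_trans zero_le_numeral)
  also have "\<dots> \<le> norm (w * main_exp t) + norm (of_real k * (main_branch (-1) t - of_real (exp (pi * s)) * c)) + norm (of_real k' * main_branch 1 t)"
    by (intro order_trans[OF norm_triangle_ineq4] add_mono norm_triangle_ineq order_refl)
  also have "\<dots> \<le> 2 * e + 2 * e + 2 * (1 + e)"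
    unfolding norm_mult norm_of_real e_def[symmetric]
    by (intro add_mono mult_mono nw k A B) (auto simp: e_def)
  also have "\<dots> \<le> 512 * exp s"
  proof -
    have "1 \<le> exp s" using s by simp
    then have "6 * e + 2 * 1 \<le> 6 * (3 * exp s) + 2 * exp s"
      using e by (intro add_mono mult_left_mono) auto
    also have "\<dots> \<le> 512 * exp s" by simp
    finally show ?thesis by simp
  qed
  also have "\<dots> \<le> D * exp s" using D by (intro mult_right_mono) auto
  finally have "norm (main_primitive t - of_real (k * exp (pi * s) / D) * c) \<le> exp s"
    using D by simp
  moreover have "of_real (k * exp (pi * s) / D) * c = of_real \<delta> * (\<i> * of_real (pi / (8 * s\<^sup>2) * (1 - 1 / (pi * s)) * exp (pi * s)))"
  proof -
    have "k * exp (pi * s) / D * (sqrt pi / 2) = pi / (8 * s\<^sup>2) * (1 - 1 / (pi * s)) * exp (pi * s)"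
      using s pi by (simp add: k_def D_def field_simps power2_eq_square)
    then show ?thesis unfolding c_def by (metis (no_types, lifting) mult.left_commute of_real_mult)
  qed
  ultimately show ?thesis by (simp only: t_def)
qed

end

text \<open>The two endpoints contribute opposite multiples of the same value, so their difference
  doubles it. On the segment \<open>exp (n t)\<close> has norm \<open>exp s\<close>, which turns the
  error \<open>exp (s/2)\<close> into \<open>exp (3/2 * s)\<close>. The endpoint errors account for
  the step from 23 to 24.\<close>

lemma num_overpartitions_asymptotic:
  fixes n :: nat
  defines "s \<equiv> sqrt (real n)"
  assumes s: "16 \<le> s"
  shows "\<bar>real (num_overpartitions n) - exp (pi * s) / (8 * real n) * (1 - 1 / (pi * s))\<bar> \<le> 24 * exp (3 / 2 * s)"
proof -
  let ?p = "2 * of_real pi * \<i> * of_nat (num_overpartitions n) :: complex"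
  let ?a = "Complex (1 / s) (- pi)" and ?b = "Complex (1 / s) pi"
  let ?\<gamma> = "linepath ?a ?b"
  have n: "real n = s\<^sup>2" by (simp add: s_def)
  define h where "h t = overpartition_gf (exp (- t)) * exp (of_nat n * t) - main_part t * exp (of_real (s\<^sup>2) * t)" for t
  define I where "I = main_primitive s ?b - main_primitive s ?a"
  have "((\<lambda>t. main_part t * exp (of_real (s\<^sup>2) * t)) has_contour_integral I) ?\<gamma>"
  proof -
    have "(main_primitive s has_field_derivative main_part t * exp (of_real (s\<^sup>2) * t)) (at t within {t. 0 < Re t})"
      if "t \<in> {t. 0 < Re t}" for t
      using main_primitive_deriv[OF s] that by (auto intro: has_field_derivative_at_within)
    moreover have "path_image ?\<gamma> \<subseteq> {t. 0 < Re t}"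
      using s by (auto elim!: vertical_segment)
    ultimately show ?thesis
      using contour_integral_primitive[of "{t. 0 < Re t}" "main_primitive s" _ ?\<gamma>] by (simp add: I_def)
  qed
  moreover have "((\<lambda>t. overpartition_gf (exp (- t)) * exp (of_nat n * t)) has_contour_integral
      ?p) ?\<gamma>"
    using s by (intro num_overpartitions_contour_integral) simp
  ultimately have h_int: "(h has_contour_integral ?p - I) ?\<gamma>"
    unfolding h_def by (intro has_contour_integral_diff)
  have "norm (?p - I) \<le> 23 * exp (s / 2) * exp s * norm (?b - ?a)"
  proof (rule has_contour_integral_bound_linepath[OF h_int])
    fix t assume "t \<in> closed_segment ?a ?b"
    then obtain y where t: "t = Complex (1 / s) y" "\<bar>y\<bar> \<le> pi" by (rule vertical_segment)
    have "h t = (overpartition_gf (exp (- t)) - main_part t) * exp (of_real (s\<^sup>2) * t)"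
      unfolding h_def n[symmetric] by (simp add: algebra_simps)
    moreover have "norm (exp (of_real (s\<^sup>2) * t)) = exp s"
      using s unfolding norm_exp_eq_Re t by (simp add: power2_eq_square)
    ultimately have "norm (h t) = norm (overpartition_gf (exp (- t)) - main_part t) * exp s"
      by (simp add: norm_mult)
    also have "\<dots> \<le> 23 * exp (s / 2) * exp s"
      unfolding t(1) by (intro mult_right_mono overpartition_gf_minus_main_part s t) auto
    finally show "norm (h t) \<le> 23 * exp (s / 2) * exp s" .
  qed auto
  moreover have "norm (?b - ?a) = 2 * pi"
  proof -
    have "?b - ?a = of_real (2 * pi) * \<i>" by (simp add: complex_eq_iff)
    then show ?thesis by (simp add: norm_mult)
  qed
  moreover have "exp (s / 2) * exp s = exp (3 / 2 * s)" by (simp flip: exp_add)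
  ultimately have 1: "norm (?p - I) \<le> 23 * exp (3 / 2 * s) * (2 * pi)"
    by (simp only: mult.assoc)
  define K where "K = pi / (8 * s\<^sup>2) * (1 - 1 / (pi * s)) * exp (pi * s)"
  have "norm (main_primitive s ?b - \<i> * of_real K) \<le> exp s"
    using main_primitive_endpoint[OF s, of 1] by (simp add: K_def)
  moreover have "norm (main_primitive s ?a + \<i> * of_real K) \<le> exp s"
    using main_primitive_endpoint[OF s, of "-1"] by (simp add: K_def)
  ultimately have 2: "norm (I - 2 * (\<i> * of_real K)) \<le> 2 * exp s"
    using norm_triangle_ineq4[of "main_primitive s ?b - \<i> * of_real K" "main_primitive s ?a + \<i> * of_real K"]
    by (simp add: I_def algebra_simps)
  have "norm (?p - 2 * (\<i> * of_real K)) \<le>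
      23 * exp (3 / 2 * s) * (2 * pi) + 2 * exp s"
    using norm_triangle_ineq[of "?p - I" "I - 2 * (\<i> * of_real K)"] 1 2 by simp
  also have "?p - 2 * (\<i> * of_real K) =
      \<i> * of_real (2 * pi * (real (num_overpartitions n) - K / pi))"
    using pi_neq_zero by (simp add: algebra_simps)
  also have "norm \<dots> = 2 * pi * \<bar>real (num_overpartitions n) - K / pi\<bar>"
    by (simp only: norm_mult norm_of_real abs_mult) simp
  finally have "2 * pi * \<bar>real (num_overpartitions n) - K / pi\<bar> \<le> 23 * exp (3 / 2 * s) * (2 * pi) + 2 * exp s" .
  also have "\<dots> \<le> 2 * pi * (24 * exp (3 / 2 * s))"
  proof -
    have "exp s * 1 \<le> exp (3 / 2 * s) * pi" using s pi_gt3 by (intro mult_mono) auto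
    then show ?thesis by (simp add: algebra_simps)
  qed
  finally have "\<bar>real (num_overpartitions n) - K / pi\<bar> \<le> 24 * exp (3 / 2 * s)" by simp
  moreover have "K / pi = exp (pi * s) / (8 * real n) * (1 - 1 / (pi * s))"
    unfolding K_def n by simp
  ultimately show ?thesis by simp
qed

section \<open>Finite differences\<close>

lemma fwd_diff_funpow_add:
  "(fwd_diff ^^ r) (\<lambda>m. f m + g m) n = (fwd_diff ^^ r) f n + (fwd_diff ^^ r) g n"
proof (induction r arbitrary: n)
  case (Suc r)
  show ?case by (simp add: fwd_diff_def[of "(fwd_diff ^^ r) _"] Suc)
qed simp

lemma fwd_diff_funpow_cmult:
  "(fwd_diff ^^ r) (\<lambda>m. c * f m) n = c * (fwd_diff ^^ r) f n"
proof (induction r arbitrary: n)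
  case (Suc r)
  show ?case by (simp add: fwd_diff_def[of "(fwd_diff ^^ r) _"] Suc algebra_simps)
qed simp

lemma fwd_diff_funpow_const:
  assumes "0 < r"
  shows "(fwd_diff ^^ r) (\<lambda>m. c) n = 0"
proof -
  have "(fwd_diff ^^ Suc k) (\<lambda>m. c) n = 0" for k n
    by (induction k arbitrary: n) (simp_all add: fwd_diff_def[abs_def])
  then show ?thesis using assms by (cases r) auto
qed

lemma fwd_diff_funpow_sums:
  assumes "\<And>m. n \<le> m \<Longrightarrow> (\<lambda>j. h j m) sums L m"
  shows "(\<lambda>j. (fwd_diff ^^ r) (h j) n) sums (fwd_diff ^^ r) L n"
proof -
  have "n \<le> m \<Longrightarrow> (\<lambda>j. (fwd_diff ^^ r) (h j) m) sums (fwd_diff ^^ r) L m" for m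
  proof (induction r arbitrary: m)
    case (Suc r)
    then show ?case
      using sums_diff[OF Suc.IH[of "m + 1"] Suc.IH[of m]]
      by (simp add: fwd_diff_def[of "(fwd_diff ^^ r) _"])
  qed (use assms in simp)
  then show ?thesis by simp
qed

lemma abs_fwd_diff_funpow_le:
  assumes "\<And>m. n \<le> m \<Longrightarrow> \<bar>g m\<bar> \<le> B"
  shows "\<bar>(fwd_diff ^^ r) g n\<bar> \<le> 2 ^ r * B"
proof -
  have "n \<le> m \<Longrightarrow> \<bar>(fwd_diff ^^ r) g m\<bar> \<le> 2 ^ r * B" for m
  proof (induction r arbitrary: m)
    case (Suc r)
    have "\<bar>(fwd_diff ^^ r) g (m + 1)\<bar> \<le> 2 ^ r * B" "\<bar>(fwd_diff ^^ r) g m\<bar> \<le> 2 ^ r * B"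
      using Suc by simp_all
    then have "\<bar>(fwd_diff ^^ r) g (m + 1) - (fwd_diff ^^ r) g m\<bar> \<le> 2 * (2 ^ r * B)"
      by linarith
    then show ?case by (simp add: fwd_diff_def[of "(fwd_diff ^^ r) _"])
  qed (use assms in simp)
  then show ?thesis by simp
qed

text \<open>The induction hypothesis is applied to the differences
  \<open>D k (x + 1) - D k x\<close>, which again form a chain of derivatives; one ordinary mean
  value step finishes. The point stays in the window from \<open>n\<close> to
  \<open>n + r\<close>.\<close>

lemma fwd_diff_funpow_mean_value:
  fixes D :: "nat \<Rightarrow> real \<Rightarrow> real"
  assumes "\<And>k x. k < r \<Longrightarrow> real n \<le> x \<Longrightarrow> (D k has_real_derivative D (Suc k) x) (at x)"
  shows "\<exists>\<xi>. real n \<le> \<xi> \<and> \<xi> \<le> real n + real r \<and> (fwd_diff ^^ r) (\<lambda>m. D 0 (real m)) n = D r \<xi>"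
  using assms
proof (induction r arbitrary: D)
  case 0
  then show ?case by (intro exI[of _ "real n"]) simp
next
  case (Suc r)
  define D' where "D' k x = D k (x + 1) - D k x" for k x
  have "(D' k has_real_derivative D' (Suc k) x) (at x)" if "k < r" "real n \<le> x" for k x
  proof -
    have "((\<lambda>x. D k (x + 1)) has_real_derivative D (Suc k) (x + 1) * 1) (at x)"
      by (rule DERIV_chain2[OF Suc.prems]) (use that in \<open>auto intro!: derivative_eq_intros\<close>)
    then show ?thesis
      unfolding D'_def using Suc.prems[of k x] that by (intro DERIV_diff) auto
  qed
  from Suc.IH[of D', OF this] obtain \<xi> where
    \<xi>: "real n \<le> \<xi>" "\<xi> \<le> real n + real r" "(fwd_diff ^^ r) (\<lambda>m. D' 0 (real m)) n = D' r \<xi>" by auto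
  have "\<exists>z. \<xi> < z \<and> z < \<xi> + 1 \<and> D r (\<xi> + 1) - D r \<xi> = (\<xi> + 1 - \<xi>) * D (Suc r) z"
    by (rule MVT2) (use Suc.prems \<xi> in auto)
  then obtain z where z: "\<xi> < z" "z < \<xi> + 1" "D r (\<xi> + 1) - D r \<xi> = D (Suc r) z" by auto
  have "fwd_diff (\<lambda>m. D 0 (real m)) = (\<lambda>m. D' 0 (real m))"
    by (auto simp: fwd_diff_def D'_def add.commute)
  then have "(fwd_diff ^^ Suc r) (\<lambda>m. D 0 (real m)) n = D' r \<xi>"
    using \<xi>(3) by (simp only: funpow_Suc_right o_def)
  with z \<xi> show ?case by (intro exI[of _ z]) (auto simp: D'_def)
qed

lemma fwd_diff_powr:
  assumes "0 < n"
  shows "\<exists>\<xi>. real n \<le> \<xi> \<and> \<xi> \<le> real n + real r \<and>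
    (fwd_diff ^^ r) (\<lambda>m. real m powr a) n = (\<Prod>i<r. a - real i) * \<xi> powr (a - real r)"
proof -
  define D where "D k x = (\<Prod>i<k. a - real i) * x powr (a - real k)" for k and x :: real
  have "(D k has_real_derivative D (Suc k) x) (at x)" if "real n \<le> x" for k x
  proof -
    have "0 < x" using that assms by simp
    from DERIV_cmult[OF has_real_derivative_powr[OF this, of "a - real k"], of "\<Prod>i<k. a - real i"]
    show ?thesis unfolding D_def[abs_def] by (simp add: mult.assoc algebra_simps)
  qed
  from fwd_diff_funpow_mean_value[of r n D, OF this] show ?thesis by (simp add: D_def)
qed

lemma fwd_diff_ln:
  assumes "0 < n" "0 < r"
  shows "\<exists>\<xi>. real n \<le> \<xi> \<and> \<xi> \<le> real n + real r \<and>
    (fwd_diff ^^ r) (\<lambda>m. ln (real m)) n = (-1) ^ (r - 1) * fact (r - 1) / \<xi> ^ r"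
proof -
  define D where "D k x = (if k = 0 then ln x else (-1) ^ (k - 1) * fact (k - 1) / x ^ k)" for k and x :: real
  have "(D k has_real_derivative D (Suc k) x) (at x)" if "real n \<le> x" for k x
  proof -
    have x: "0 < x" using that assms by simp
    show ?thesis
    proof (cases k)
      case 0
      then show ?thesis using DERIV_ln_divide[OF x] by (simp add: D_def[abs_def])
    next
      case (Suc j)
      have "((\<lambda>x. (-1) ^ j * fact j / x ^ Suc j) has_real_derivative
          (0 * x ^ Suc j - (-1) ^ j * fact j * (real (Suc j) * x ^ j)) / (x ^ Suc j * x ^ Suc j)) (at x)"
        using DERIV_pow[of "Suc j" x] x by (intro DERIV_divide DERIV_const) auto
      also have "(0 * x ^ Suc j - (-1) ^ j * fact j * (real (Suc j) * x ^ j)) / (x ^ Suc j * x ^ Suc j) =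
          (-1) ^ Suc j * fact (Suc j) / x ^ Suc (Suc j)"
        using x by (simp add: field_simps)
      finally show ?thesis unfolding Suc D_def[abs_def] by simp
    qed
  qed
  from fwd_diff_funpow_mean_value[of r n D, OF this] show ?thesis using assms by (simp add: D_def)
qed

lemma prod_descending_eq_pochhammer: "(\<Prod>i<r. - a - real i) = (-1) ^ r * pochhammer a r"
  by (induction r) (simp_all add: pochhammer_Suc algebra_simps)

text \<open>Together with the factor \<pi> of the leading term this is the origin of the constant
  \<open>C r\<close>.\<close>

lemma prod_half_descending:
  assumes "0 < r"
  shows "(\<Prod>i<r. 1 / 2 - real i) = (-1) ^ (r - 1) * (pochhammer (1 / 2) (r - 1) / 2)"
proof -
  obtain k where r: "r = Suc k" using assms by (cases r) auto
  have "(\<Prod>i<k. 1 / 2 - real (Suc i)) = (\<Prod>i<k. - (1 / 2) - real i)"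
    by (intro prod.cong refl) simp
  then have "(\<Prod>i<Suc k. 1 / 2 - real i) = 1 / 2 * (\<Prod>i<k. - (1 / 2) - real i)"
    by (simp only: prod.lessThan_Suc_shift) simp
  then show ?thesis by (simp add: r prod_descending_eq_pochhammer)
qed

lemma pochhammer_half_bounds: "1 / 2 \<le> pochhammer (1 / 2 :: real) (Suc k)" "pochhammer (1 / 2 :: real) (Suc k) \<le> fact (Suc k) / 2"
proof (induction k)
  case (Suc k)
  have e: "pochhammer (1 / 2 :: real) (Suc (Suc k)) = pochhammer (1 / 2) (Suc k) * (1 / 2 + real (Suc k))"
    by (rule pochhammer_Suc)
  {
    case 1
    have "1 / 2 * 1 \<le> pochhammer (1 / 2 :: real) (Suc k) * (1 / 2 + real (Suc k))"
      using Suc by (intro mult_mono) auto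
    then show ?case unfolding e by simp
  next
    case 2
    have "pochhammer (1 / 2 :: real) (Suc k) * (1 / 2 + real (Suc k)) \<le> fact (Suc k) / 2 * real (Suc (Suc k))"
      using Suc by (intro mult_mono) auto
    then show ?case unfolding e by (simp add: algebra_simps)
  }
qed simp_all

text \<open>Consecutive terms of the series of the correction differ by a half step in this
  argument; rounding it up to a full step gives a telescoping quotient.\<close>

lemma pochhammer_shift_half:
  fixes x :: real
  assumes "0 < x"
  shows "pochhammer (x + 1 / 2) r \<le> pochhammer x r * ((x + real r) / x)"
proof -
  have "pochhammer (x + 1 / 2) r \<le> pochhammer (x + 1) r"
    unfolding pochhammer_prod using assms by (intro prod_mono) auto
  also have "\<dots> = pochhammer x r * ((x + real r) / x)"
  proof -
    have "x * pochhammer (x + 1) r = pochhammer x r * (x + real r)"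
      by (metis pochhammer_rec pochhammer_Suc)
    then show ?thesis using assms by (simp add: field_simps)
  qed
  finally show ?thesis .
qed

section \<open>Differences of the logarithm of the main term\<close>

context
  fixes r n :: nat
  assumes r: "2 \<le> r" and n_ge: "4 * (real r)\<^sup>2 \<le> sqrt (real n)"
begin

lemma sqrt_n_ge: "16 \<le> sqrt (real n)"
proof -
  have "2\<^sup>2 \<le> (real r)\<^sup>2" using r by (intro power_mono) auto
  then show ?thesis using n_ge by simp
qed

lemma n_pos: "0 < n"
  using sqrt_n_ge by (cases n) auto

lemma r_square_over_n: "(real r)\<^sup>2 / real n \<le> 1 / 64"
proof -
  have "16 * (4 * (real r)\<^sup>2) \<le> sqrt (real n) * sqrt (real n)"
    using n_ge sqrt_n_ge by (intro mult_mono) auto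
  then show ?thesis using n_pos by (simp add: field_simps)
qed

text \<open>By Bernoulli's inequality, not knowing the mean value point more precisely than up to
  \<open>r\<close> costs at most the relative amount \<open>r^2/n\<close>.\<close>

lemma shrink_power: "1 - (real r)\<^sup>2 / real n \<le> (real n / (real n + real r)) ^ r"
proof -
  have "1 - (real r)\<^sup>2 / real n \<le> 1 + real r * (- (real r / (real n + real r)))"
    using n_pos by (simp add: power2_eq_square divide_left_mono)
  also have "\<dots> \<le> (1 + - (real r / (real n + real r))) ^ r"
    using n_pos by (intro Bernoulli_inequality) (simp add: field_simps)
  also have "1 + - (real r / (real n + real r)) = real n / (real n + real r)"
    using n_pos by (simp add: field_simps)
  finally show ?thesis .
qed

lemma fwd_diff_sqrt_bounds:
  defines "T \<equiv> (-1) ^ (r - 1) * (fwd_diff ^^ r) (\<lambda>m. pi * sqrt (real m)) n"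
  shows "T \<le> C r * sqrt (real n) / real n ^ r"
    and "C r * sqrt (real n) / real n ^ r * (1 - (real r)\<^sup>2 / real n) \<le> T"
proof -
  have sq: "(\<lambda>m. sqrt (real m)) = (\<lambda>m. real m powr (1 / 2))" by (simp add: powr_half_sqrt)
  obtain \<xi> where \<xi>: "real n \<le> \<xi>" "\<xi> \<le> real n + real r"
    "(fwd_diff ^^ r) (\<lambda>m. sqrt (real m)) n = (\<Prod>i<r. 1 / 2 - real i) * \<xi> powr (1 / 2 - real r)"
    using fwd_diff_powr[OF n_pos, of r "1 / 2"] unfolding sq by blast
  have "\<xi> powr (1 / 2 - real r) = sqrt \<xi> / \<xi> ^ r"
    using \<xi>(1) n_pos by (simp add: powr_diff powr_half_sqrt powr_realpow)
  moreover have "(-1) ^ (r - 1) * ((-1) ^ (r - 1) * x) = x" for x :: real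
    by (simp flip: mult.assoc power_mult_distrib)
  ultimately have T: "T = C r * (sqrt \<xi> / \<xi> ^ r)"
    unfolding T_def fwd_diff_funpow_cmult \<xi>(3) using r
    by (simp add: prod_half_descending C_def mult.assoc mult.left_commute[of "(-1) ^ (r - 1)"])
  have C0: "0 \<le> C r" by (simp add: C_def pochhammer_nonneg)
  have form: "sqrt x / x ^ r = 1 / (sqrt x * x ^ (r - 1))" if "0 < x" for x :: real
  proof -
    have "x ^ r = sqrt x * (sqrt x * x ^ (r - 1))" using r that by (simp flip: power_Suc mult.assoc)
    moreover have "sqrt x / (sqrt x * (sqrt x * x ^ (r - 1))) = 1 / (sqrt x * x ^ (r - 1))"
      by (rule nonzero_divide_mult_cancel_left) (use that in simp)
    ultimately show ?thesis by (simp only:)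
  qed
  have "1 / (sqrt \<xi> * \<xi> ^ (r - 1)) \<le> 1 / (sqrt (real n) * real n ^ (r - 1))"
    using \<xi>(1) n_pos by (intro divide_left_mono mult_mono power_mono mult_pos_pos) auto
  then have "sqrt \<xi> / \<xi> ^ r \<le> sqrt (real n) / real n ^ r" using \<xi>(1) n_pos by (simp only: form)
  then have "C r * (sqrt \<xi> / \<xi> ^ r) \<le> C r * (sqrt (real n) / real n ^ r)" using C0 by (rule mult_left_mono)
  then show "T \<le> C r * sqrt (real n) / real n ^ r" unfolding T by simp
  \<comment> \<open>The numerator is estimated at \<open>n\<close> and the denominator at
    \<open>n + r\<close>, so only the power needs the Bernoulli bound.\<close>
  have "sqrt (real n) / real n ^ r * (1 - (real r)\<^sup>2 / real n) \<le> sqrt (real n) / real n ^ r * (real n / (real n + real r)) ^ r"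
    by (intro mult_left_mono shrink_power) auto
  also have "\<dots> = sqrt (real n) / (real n + real r) ^ r"
    using n_pos by (simp add: power_divide)
  also have "\<dots> \<le> sqrt \<xi> / \<xi> ^ r"
    using \<xi> n_pos by (intro frac_le power_mono) auto
  finally have "C r * (sqrt (real n) / real n ^ r * (1 - (real r)\<^sup>2 / real n)) \<le> C r * (sqrt \<xi> / \<xi> ^ r)"
    using C0 by (rule mult_left_mono)
  then show "C r * sqrt (real n) / real n ^ r * (1 - (real r)\<^sup>2 / real n) \<le> T"
    unfolding T by (simp add: mult.assoc)
qed

lemma fwd_diff_ln_bounds:
  defines "T \<equiv> (-1) ^ (r - 1) * (fwd_diff ^^ r) (\<lambda>m. ln (real m)) n"
  shows "T \<le> fact (r - 1) / real n ^ r" and "fact (r - 1) / real n ^ r * (63 / 64) \<le> T"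
proof -
  obtain \<xi> where \<xi>: "real n \<le> \<xi>" "\<xi> \<le> real n + real r"
    "(fwd_diff ^^ r) (\<lambda>m. ln (real m)) n = (-1) ^ (r - 1) * fact (r - 1) / \<xi> ^ r"
    using fwd_diff_ln[OF n_pos, of r] r by auto
  have T: "T = fact (r - 1) / \<xi> ^ r"
    unfolding T_def \<xi>(3) by (simp flip: mult.assoc power_mult_distrib)
  show "T \<le> fact (r - 1) / real n ^ r"
    unfolding T using \<xi>(1) n_pos by (intro divide_left_mono power_mono mult_pos_pos) auto
  have "fact (r - 1) / real n ^ r * (63 / 64) \<le> fact (r - 1) / real n ^ r * (real n / (real n + real r)) ^ r"
    using shrink_power r_square_over_n by (intro mult_left_mono) auto
  also have "\<dots> = fact (r - 1) / (real n + real r) ^ r"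
    using n_pos by (simp add: power_divide)
  also have "\<dots> \<le> T"
    unfolding T using \<xi> n_pos by (intro divide_left_mono power_mono mult_pos_pos) auto
  finally show "fact (r - 1) / real n ^ r * (63 / 64) \<le> T" .
qed

lemma ln_one_minus_sums:
  fixes x :: real
  assumes "0 < x" "x < 1"
  shows "(\<lambda>j. - (x ^ Suc j / real (Suc j))) sums ln (1 - x)"
proof -
  have "(\<lambda>j. - ((- (- x)) ^ j) / real j) sums ln (1 + - x)"
    using assms by (intro ln_series') auto
  then have "(\<lambda>j. - (x ^ j) / real j) sums ln (1 - x)" by simp
  from sums_Suc_iff[of "\<lambda>j. - (x ^ j) / real j" "ln (1 - x)", THEN iffD2] this show ?thesis by simp
qed

text \<open>The logarithmic series is a sum of negative multiples of negative half-integral or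
  integral powers. The signed difference of each term is nonnegative, which settles the lower bound.
  For the upper one the terms fall at least as fast as powers of 1/8.\<close>

lemma fwd_diff_correction_bounds:
  defines "T \<equiv> (-1) ^ (r - 1) * (fwd_diff ^^ r) (\<lambda>m. ln (1 - 1 / (pi * sqrt (real m)))) n"
  shows "0 \<le> T" and "T \<le> fact (r - 1) / 10 / real n ^ r"
proof -
  define s where "s = sqrt (real n)"
  have s: "16 \<le> s" "4 * (real r)\<^sup>2 \<le> s" "s\<^sup>2 = real n" using sqrt_n_ge n_ge by (auto simp: s_def)
  define h where "h j m = - (1 / (real (Suc j) * pi ^ Suc j)) * real m powr (- (real (Suc j) / 2))" for j and m :: nat
  have "(\<lambda>j. h j m) sums ln (1 - 1 / (pi * sqrt (real m)))" if m: "n \<le> m" for m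
  proof -
    have m0: "0 < real m" using m n_pos by simp
    have "16 \<le> sqrt (real m)" using order_trans[OF sqrt_n_ge, of "sqrt (real m)"] m by simp
    then have "3 * 16 \<le> pi * sqrt (real m)" using pi_gt3 by (intro mult_mono) auto
    then have "1 < pi * sqrt (real m)" by linarith
    then have "0 < 1 / (pi * sqrt (real m))" "1 / (pi * sqrt (real m)) < 1" by auto
    from ln_one_minus_sums[OF this] show ?thesis
    proof (rule sums_cong[THEN iffD1, rotated])
      fix j
      have "real m powr (- (real (Suc j) / 2)) = 1 / (sqrt (real m)) ^ Suc j"
      proof -
        have "(sqrt (real m)) ^ Suc j = (real m powr (1 / 2)) powr real (Suc j)"
          using m0 by (subst powr_realpow) (simp_all add: powr_half_sqrt)
        also have "\<dots> = real m powr (real (Suc j) / 2)" by (simp add: powr_powr)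
        finally show ?thesis by (simp add: powr_minus_divide)
      qed
      then show "- ((1 / (pi * sqrt (real m))) ^ Suc j / real (Suc j)) = h j m"
        by (simp add: h_def power_divide power_mult_distrib mult_ac)
    qed
  qed
  then have "(\<lambda>j. (fwd_diff ^^ r) (h j) n) sums (fwd_diff ^^ r) (\<lambda>m. ln (1 - 1 / (pi * sqrt (real m)))) n"
    by (rule fwd_diff_funpow_sums)
  from sums_mult[OF this, of "(-1) ^ (r - 1)"]
  have sums: "(\<lambda>j. (-1) ^ (r - 1) * (fwd_diff ^^ r) (h j) n) sums T" unfolding T_def .
  define b where "b j = pochhammer (real (Suc j) / 2) r / (real (Suc j) * (pi * s) ^ Suc j)" for j
  have summand: "0 \<le> (-1) ^ (r - 1) * (fwd_diff ^^ r) (h j) n \<and>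
      (-1) ^ (r - 1) * (fwd_diff ^^ r) (h j) n \<le> b j / real n ^ r" for j
  proof -
    define \<alpha> where "\<alpha> = real (Suc j) / 2"
    obtain \<xi> where \<xi>: "real n \<le> \<xi>"
      "(fwd_diff ^^ r) (\<lambda>m. real m powr (- \<alpha>)) n = (\<Prod>i<r. - \<alpha> - real i) * \<xi> powr (- \<alpha> - real r)"
      using fwd_diff_powr[OF n_pos, of r "- \<alpha>"] by blast
    have p: "0 \<le> pochhammer \<alpha> r" by (simp add: pochhammer_nonneg \<alpha>_def)
    have "(-1) ^ (r - 1) * (fwd_diff ^^ r) (h j) n =
        - ((-1) ^ (r - 1) * (-1) ^ r) * (pochhammer \<alpha> r / (real (Suc j) * pi ^ Suc j) * \<xi> powr (- \<alpha> - real r))"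
      unfolding h_def[abs_def] fwd_diff_funpow_cmult \<alpha>_def[symmetric] \<xi>(2) prod_descending_eq_pochhammer by simp
    also have "- ((-1) ^ (r - 1) * (-1) ^ r) = (1 :: real)"
      using r by (cases r) (simp_all flip: power_mult_distrib)
    finally have e: "(-1) ^ (r - 1) * (fwd_diff ^^ r) (h j) n =
        pochhammer \<alpha> r / (real (Suc j) * pi ^ Suc j) * \<xi> powr (- \<alpha> - real r)" by simp
    have "\<xi> powr (- \<alpha> - real r) \<le> real n powr (- \<alpha> - real r)"
    proof (rule powr_mono2')
      have "0 \<le> \<alpha>" by (simp add: \<alpha>_def)
      then show "- \<alpha> - real r \<le> 0" by simp
    qed (use \<xi>(1) n_pos in auto)
    also have "\<dots> = 1 / (s ^ Suc j * real n ^ r)"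
    proof -
      have "real n powr \<alpha> = s ^ Suc j"
      proof -
        have "s ^ Suc j = (real n powr (1 / 2)) powr real (Suc j)"
          unfolding s_def using n_pos by (subst powr_realpow) (simp_all add: powr_half_sqrt)
        also have "\<dots> = real n powr \<alpha>" by (simp add: powr_powr \<alpha>_def)
        finally show ?thesis by simp
      qed
      then show ?thesis using n_pos by (simp add: powr_diff powr_minus_divide powr_realpow)
    qed
    finally have "pochhammer \<alpha> r / (real (Suc j) * pi ^ Suc j) * \<xi> powr (- \<alpha> - real r) \<le>
        pochhammer \<alpha> r / (real (Suc j) * pi ^ Suc j) * (1 / (s ^ Suc j * real n ^ r))"
      using p by (intro mult_left_mono) auto
    also have "\<dots> = b j / real n ^ r"
      by (simp add: b_def \<alpha>_def power_mult_distrib mult_ac)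
    finally show ?thesis unfolding e using p by simp
  qed
  \<comment> \<open>The ratio of consecutive bounds is at most \<open>(1 + 2r)/(pi s)\<close>;
    \<open>pi s \<ge> 12 r^2\<close> makes it 1/8 from \<open>r = 2\<close> on.\<close>
  have "2 * real r \<le> (real r)\<^sup>2"
    unfolding power2_eq_square by (rule mult_right_mono) (use r in auto)
  then have "8 * (1 + 2 * real r) \<le> 3 * (4 * (real r)\<^sup>2)" using r by simp
  also have "\<dots> \<le> pi * s" using s pi_gt3 by (intro mult_mono) auto
  finally have ps: "8 * (1 + 2 * real r) \<le> pi * s" .
  have ps0: "0 < pi * s" using s by simp
  have b0: "0 \<le> b j" for j
    unfolding b_def using s by (intro divide_nonneg_nonneg pochhammer_nonneg mult_nonneg_nonneg zero_le_power) auto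
  have step: "b (Suc j) \<le> b j * (1 / 8)" for j
  proof -
    define x where "x = real (Suc j) / 2"
    have x: "0 < x" by (simp add: x_def)
    have "real (Suc (Suc j)) / 2 = x + 1 / 2" by (simp add: x_def add_divide_distrib)
    then have "b (Suc j) = pochhammer (x + 1 / 2) r / (real (Suc (Suc j)) * (pi * s) ^ Suc (Suc j))"
      by (simp only: b_def)
    also have "\<dots> \<le> (pochhammer x r * ((x + real r) / x)) / (real (Suc j) * (pi * s) ^ Suc (Suc j))"
      using x ps0 by (intro frac_le pochhammer_shift_half mult_right_mono mult_nonneg_nonneg pochhammer_nonneg) auto
    also have "\<dots> = b j * (((x + real r) / x) / (pi * s))"
      by (simp add: b_def x_def mult_ac)
    also have "\<dots> \<le> b j * (1 / 8)"
    proof (rule mult_left_mono[OF _ b0])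
      have "(x + real r) / x \<le> 1 + 2 * real r"
        using x by (simp add: x_def field_simps)
      also have "\<dots> \<le> 1 / 8 * (pi * s)" using ps by simp
      finally show "((x + real r) / x) / (pi * s) \<le> 1 / 8"
        by (simp only: pos_divide_le_eq[OF ps0])
    qed
    finally show ?thesis .
  qed
  have bj: "b j \<le> b 0 * (1 / 8) ^ j" for j
  proof (induction j)
    case (Suc j)
    have "b (Suc j) \<le> b j * (1 / 8)" by (rule step)
    also have "\<dots> \<le> b 0 * (1 / 8) ^ j * (1 / 8)" using Suc by (intro mult_right_mono) auto
    finally show ?case by simp
  qed simp
  have geom: "(\<lambda>j. b 0 * (1 / 8) ^ j / real n ^ r) sums (b 0 * (1 / (1 - 1 / 8)) / real n ^ r)"
    by (intro sums_divide sums_mult geometric_sums) simp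
  have le: "(-1) ^ (r - 1) * (fwd_diff ^^ r) (h j) n \<le> b 0 * (1 / 8) ^ j / real n ^ r" for j
    using conjunct2[OF summand[of j]] by (rule order_trans) (rule divide_right_mono[OF bj], simp)
  have "T \<le> b 0 * (1 / (1 - 1 / 8)) / real n ^ r"
    by (rule sums_le[OF le sums geom])
  \<comment> \<open>\<open>pi s \<ge> 8r\<close> gives 1/16 for the initial term, and 8/7 of it is
    1/14.\<close>
  also have "b 0 * (1 / (1 - 1 / 8)) \<le> fact (r - 1) / 10"
  proof -
    obtain k where k: "r = Suc k" using r by (cases r) auto
    have "b 0 = pochhammer (1 / 2) r / (pi * s)" by (simp add: b_def)
    also have "\<dots> \<le> (fact r / 2) / (8 * real r)"
      unfolding k using pochhammer_half_bounds(2)[of k] ps k by (intro frac_le) auto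
    also have "\<dots> = fact (r - 1) / 16" using r by (simp add: fact_reduce)
    finally have "b 0 \<le> fact (r - 1) / 16" .
    moreover have "0 \<le> (fact (r - 1) :: real)" by simp
    moreover have "b 0 * (1 / (1 - 1 / 8)) = 8 / 7 * b 0" by simp
    ultimately show ?thesis by linarith
  qed
  finally show "T \<le> fact (r - 1) / 10 / real n ^ r" by (simp add: divide_right_mono)
  show "0 \<le> T" by (rule sums_le[OF _ sums_zero sums]) (use summand in blast)
qed

end

text \<open>Both the exponent \<open>2r + 2\<close> and the base grow. In \<open>u = sqrt s\<close>
  one has \<open>r \<le> u/2\<close>, so all factors can be bounded by exponentials of at most
  quadratic size in \<open>u\<close>. The rate 164/100 is 3.14 minus 3/2, the gap between main term
  and error.\<close>

lemma exponential_dominates: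
  fixes s :: real
  assumes r: "2 \<le> r" and s: "4 * (real r)\<^sup>2 \<le> s"
  shows "2 ^ r * 768 * s ^ (2 * r + 2) \<le> exp (164 / 100 * s) / 2"
proof -
  define u where "u = sqrt s"
  have s0: "0 \<le> s" using s order_trans[of 0 "4 * (real r)\<^sup>2" s] by simp
  have u2: "u\<^sup>2 = s" "0 \<le> u" using s0 by (auto simp: u_def)
  have "sqrt ((2 * real r)\<^sup>2) \<le> u" unfolding u_def using s by (intro real_sqrt_le_mono) (simp add: power_mult_distrib)
  moreover have "sqrt ((2 * real r)\<^sup>2) = 2 * real r" by (subst real_sqrt_abs) simp
  ultimately have ru: "2 * real r \<le> u" by (simp only:)
  then have u4: "4 \<le> u" using r by simp
  have two: "(2::real) \<le> exp (25 / 36)"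
  proof -
    have "(2::real) = exp (ln 2)" by simp
    also have "\<dots> \<le> exp (25 / 36)" using ln2_le_25_over_36 by (intro exp_mono)
    finally show ?thesis .
  qed
  \<comment> \<open>The tangent at \<open>u = 4\<close>. Raised to the power
    \<open>4r + 4 \<le> 2u + 4\<close> it uses only \<open>s/2\<close> of the available
    exponent.\<close>
  have "u \<le> 4 * exp (u / 4 - 1)"
    using exp_ge_add_one_self[of "u / 4 - 1"] by simp
  then have "u ^ (4 * r + 4) \<le> (4 * exp (u / 4 - 1)) ^ (4 * r + 4)"
    using u2 by (intro power_mono) auto
  also have "\<dots> = 4 ^ (4 * r + 4) * exp (real (4 * r + 4) * (u / 4 - 1))"
    unfolding power_mult_distrib by (simp only: exp_of_nat_mult)
  finally have pow: "u ^ (4 * r + 4) \<le> 4 ^ (4 * r + 4) * exp (real (4 * r + 4) * (u / 4 - 1))" .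
  have "s ^ (2 * r + 2) = u ^ (4 * r + 4)"
    unfolding u2(1)[symmetric] power_mult[symmetric] by (rule arg_cong[where f = "\<lambda>k. u ^ k"]) simp
  then have "2 ^ r * 768 * s ^ (2 * r + 2) * 2 \<le> 2 ^ r * 768 * (4 ^ (4 * r + 4) * exp (real (4 * r + 4) * (u / 4 - 1))) * 2"
    using pow by simp
  also have "\<dots> = (2 ^ r * 1536 * 4 ^ (4 * r + 4)) * exp (real (4 * r + 4) * (u / 4 - 1))" by simp
  also have "\<dots> \<le> exp (25 / 36) ^ (9 * r + 19) * exp (real (4 * r + 4) * (u / 4 - 1))"
  proof (rule mult_right_mono)
    have "(4::real) ^ (4 * r + 4) = 2 ^ (8 * r + 8)"
    proof -
      have "(4::real) ^ (4 * r + 4) = (2 ^ 2) ^ (4 * r + 4)" by simp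
      also have "\<dots> = 2 ^ (2 * (4 * r + 4))" by (simp only: power_mult)
      finally show ?thesis by (simp add: algebra_simps)
    qed
    \<comment> \<open>1536 is rounded up to \<open>2^11\<close>, and \<open>9r + 19\<close> collects
      \<open>r\<close>, 11 and \<open>8r + 8\<close>.\<close>
    then have "2 ^ r * 1536 * 4 ^ (4 * r + 4) \<le> (2 ^ r * 2 ^ 11 * 2 ^ (8 * r + 8) :: real)" by simp
    also have "\<dots> = 2 ^ (9 * r + 19)"
      unfolding power_add[symmetric] by (rule arg_cong[where f = "\<lambda>k. 2 ^ k"]) simp
    also have "\<dots> \<le> exp (25 / 36) ^ (9 * r + 19)" using two by (intro power_mono) auto
    finally show "2 ^ r * 1536 * 4 ^ (4 * r + 4) \<le> (exp (25 / 36) ^ (9 * r + 19) :: real)" .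
  qed simp
  also have "\<dots> = exp (real (9 * r + 19) * (25 / 36) + real (4 * r + 4) * (u / 4 - 1))"
    by (simp only: exp_add exp_of_nat_mult)
  also have "\<dots> \<le> exp (164 / 100 * s)"
  proof (rule exp_mono)
    have "real (4 * r + 4) * (u / 4 - 1) \<le> (2 * u + 4) * (u / 4 - 1)"
      using ru u4 by (intro mult_right_mono) auto
    also have "\<dots> = s / 2 - u - 4" unfolding u2(1)[symmetric] by (simp add: power2_eq_square algebra_simps)
    finally have 1: "real (4 * r + 4) * (u / 4 - 1) \<le> s / 2 - u - 4" .
    have "real (9 * r + 19) * (25 / 36) \<le> (9 / 2 * u + 19) * (25 / 36)" using ru by simp
    moreover have "4 * u \<le> s" unfolding u2(1)[symmetric] power2_eq_square using u4 by (intro mult_right_mono) auto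
    ultimately show "real (9 * r + 19) * (25 / 36) + real (4 * r + 4) * (u / 4 - 1) \<le> 164 / 100 * s"
      using 1 u4 by argo
  qed
  finally show ?thesis by simp
qed

section \<open>The logarithm of the overpartition function\<close>

lemma abs_ln_one_plus_le:
  fixes x :: real
  assumes "\<bar>x\<bar> \<le> 1 / 2"
  shows "\<bar>ln (1 + x)\<bar> \<le> 2 * \<bar>x\<bar>"
proof -
  have "\<bar>ln (1 + x) - x\<bar> \<le> 2 * x\<^sup>2"
    using abs_ln_one_plus_x_minus_x_bound[OF assms] .
  moreover have "x\<^sup>2 \<le> \<bar>x\<bar> * (1 / 2)"
    unfolding power2_eq_square abs_mult_self_eq[symmetric, of x] using assms by (intro mult_left_mono) auto
  ultimately show ?thesis by linarith
qed

text \<open>The main term is at least \<open>exp (pi s)/(16 s^2)\<close> because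
  \<open>1 - 1/(pi s) \<ge> 1/2\<close>. The relative error therefore carries the constant
  \<open>24 * 16 = 384\<close>, which the logarithm doubles.\<close>

lemma ln_num_overpartitions:
  fixes m :: nat
  defines "s \<equiv> sqrt (real m)"
  assumes s: "16 \<le> s" and small: "768 * s\<^sup>2 * exp (- (164 / 100 * s)) \<le> 1"
  shows "\<bar>ln (real (num_overpartitions m)) - (pi * s - ln 8 - ln (real m) + ln (1 - 1 / (pi * s)))\<bar>
    \<le> 768 * s\<^sup>2 * exp (- (164 / 100 * s))"
proof -
  define c where "c = 1 - 1 / (pi * s)"
  define X where "X = exp (pi * s) / (8 * real m) * c"
  define d where "d = (real (num_overpartitions m) - X) / X"
  have m: "real m = s\<^sup>2" by (simp add: s_def)
  have m0: "0 < real m" unfolding m using s by simp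
  have "3 * 16 \<le> pi * s" using s pi_gt3 by (intro mult_mono) auto
  then have "1 / (pi * s) \<le> 1 / 2" by (intro divide_left_mono) auto
  then have c: "1 / 2 \<le> c" by (simp add: c_def)
  have X0: "0 < X" unfolding X_def using c m0 by simp
  have "exp (pi * s) / (8 * real m) * (1 / 2) \<le> X" unfolding X_def using c m0 by (intro mult_left_mono) auto
  then have X_ge: "exp (pi * s) / (16 * s\<^sup>2) \<le> X" by (simp add: m)
  have pi: "314 / 100 \<le> pi" by (rule order_trans[OF _ pi_approx(1)]) simp
  have "\<bar>d\<bar> = \<bar>real (num_overpartitions m) - X\<bar> / X" using X0 by (simp add: d_def)
  also have "\<dots> \<le> 24 * exp (3 / 2 * s) / (exp (pi * s) / (16 * s\<^sup>2))"
  proof (rule frac_le)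
    show "\<bar>real (num_overpartitions m) - X\<bar> \<le> 24 * exp (3 / 2 * s)"
      using num_overpartitions_asymptotic[of m] s unfolding X_def c_def s_def by simp
    show "0 < exp (pi * s) / (16 * s\<^sup>2)" using s by (intro divide_pos_pos) auto
  qed (use X_ge in auto)
  also have "\<dots> = 384 * s\<^sup>2 * exp (3 / 2 * s - pi * s)"
    by (simp add: exp_diff)
  also have "\<dots> \<le> 384 * s\<^sup>2 * exp (- (164 / 100 * s))"
  proof -
    have "314 / 100 * s \<le> pi * s" using pi s by (intro mult_right_mono) auto
    then show ?thesis by (intro mult_left_mono exp_mono) auto
  qed
  finally have d: "\<bar>d\<bar> \<le> 384 * s\<^sup>2 * exp (- (164 / 100 * s))" .
  then have d_half: "\<bar>d\<bar> \<le> 1 / 2" using small by linarith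
  have p: "real (num_overpartitions m) = X * (1 + d)"
    using X0 by (simp add: d_def field_simps)
  have "ln (real (num_overpartitions m)) = ln X + ln (1 + d)"
    unfolding p using X0 d_half by (intro ln_mult_pos) auto
  also have "ln X = pi * s - ln 8 - ln (real m) + ln c"
    unfolding X_def using m0 c by (simp add: ln_mult_pos ln_div)
  finally have "\<bar>ln (real (num_overpartitions m)) - (pi * s - ln 8 - ln (real m) + ln c)\<bar> = \<bar>ln (1 + d)\<bar>"
    by simp
  also have "\<dots> \<le> 2 * \<bar>d\<bar>" using d_half by (rule abs_ln_one_plus_le)
  also have "\<dots> \<le> 768 * s\<^sup>2 * exp (- (164 / 100 * s))" using d by simp
  finally show ?thesis by (simp only: c_def)
qed

text \<open>The factor \<open>2^r\<close> in the denominator pays for an \<open>r\<close>-fold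
  difference, after which \<open>1/(2 n^r)\<close> is left.\<close>

lemma ln_num_overpartitions_error:
  assumes r: "2 \<le> r" and m: "4 * (real r)\<^sup>2 \<le> sqrt (real m)"
  shows "\<bar>ln (real (num_overpartitions m)) -
      (pi * sqrt (real m) - ln 8 - ln (real m) + ln (1 - 1 / (pi * sqrt (real m))))\<bar> \<le> 1 / (2 * 2 ^ r * real m ^ r)"
proof -
  define s where "s = sqrt (real m)"
  have s: "16 \<le> s" using sqrt_n_ge[OF r m] by (simp add: s_def)
  have m2: "real m = s\<^sup>2" by (simp add: s_def)
  define E where "E = exp (164 / 100 * s)"
  have E: "0 < E" by (simp add: E_def)
  have "2 ^ r * 768 * s ^ (2 * r + 2) \<le> E / 2"
    unfolding E_def using exponential_dominates[OF r] m by (simp add: s_def)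
  moreover have "s ^ (2 * r + 2) = real m ^ r * s\<^sup>2"
    unfolding m2 by (simp add: power_add power_mult power2_eq_square)
  ultimately have dom: "(2 * 2 ^ r * real m ^ r) * (768 * s\<^sup>2) \<le> E" by simp
  have pos: "1 \<le> 2 * 2 ^ r * real m ^ r"
  proof -
    have "1 * 1 \<le> 2 ^ r * real m ^ r"
      using s by (intro mult_mono one_le_power) (auto simp: m2 intro: order_trans[of 1 "16 * 16"] simp: power2_eq_square intro!: mult_mono)
    then show ?thesis by simp
  qed
  have "768 * s\<^sup>2 \<le> E / (2 * 2 ^ r * real m ^ r)"
    using dom pos by (simp add: pos_le_divide_eq mult.commute)
  then have "768 * s\<^sup>2 * (1 / E) \<le> E / (2 * 2 ^ r * real m ^ r) * (1 / E)"
    using E by (intro mult_right_mono) auto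
  moreover have "exp (- (164 / 100 * s)) = 1 / E" unfolding E_def exp_minus by (rule inverse_eq_divide)
  ultimately have bound: "768 * s\<^sup>2 * exp (- (164 / 100 * s)) \<le> 1 / (2 * 2 ^ r * real m ^ r)"
    using E by (simp only:) simp
  also have "\<dots> \<le> 1"
    using pos by (simp only: divide_le_eq_1_pos[OF less_le_trans[OF zero_less_one pos]])
  finally have "768 * s\<^sup>2 * exp (- (164 / 100 * s)) \<le> 1" .
  with ln_num_overpartitions[of m] s bound show ?thesis unfolding s_def by linarith
qed

section \<open>Comparison with the explicit constants\<close>

lemma C_bounds:
  assumes "2 \<le> r"
  shows "3 / 4 \<le> C r" "C r \<le> fact (r - 1)"
proof -
  obtain k where r: "r = Suc (Suc k)" using assms by (metis add_2_eq_Suc le_Suc_ex)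
  have p: "1 / 2 \<le> pochhammer (1 / 2 :: real) (Suc k)" "pochhammer (1 / 2 :: real) (Suc k) \<le> fact (Suc k) / 2"
    by (rule pochhammer_half_bounds)+
  have "3 / 2 * (1 / 2) \<le> pi / 2 * pochhammer (1 / 2) (Suc k)"
    using p(1) pi_gt3 by (intro mult_mono) auto
  then show "3 / 4 \<le> C r" by (simp add: C_def r)
  have "pi / 2 * pochhammer (1 / 2) (Suc k) \<le> 2 * (fact (Suc k) / 2)"
    using p pi_less_4 by (intro mult_mono) auto
  then show "C r \<le> fact (r - 1)" by (simp add: C_def r)
qed

text \<open>This is the quadratic loss in \<open>ln (1 + x) \<ge> x - x^2\<close>. It is beaten by
  the contribution of \<open>ln m\<close> because \<open>C r \<le> (r-1)!\<close> and
  \<open>64 (r-1)! \<le> n^(r-1)\<close>.\<close>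

lemma C_square_small:
  assumes r: "2 \<le> r" and n: "4 * (real r)\<^sup>2 \<le> sqrt (real n)"
  shows "(C r * sqrt (real n) / real n ^ r)\<^sup>2 \<le> fact (r - 1) / 64 / real n ^ r"
proof -
  have n0: "0 < real n" using n_pos[OF r n] by simp
  obtain k where k: "r = Suc (Suc k)" using r by (metis add_2_eq_Suc le_Suc_ex)
  have "fact (r - 1) \<le> real r ^ (r - 1)"
  proof -
    have "fact (r - 1) \<le> real ((r - 1) ^ (r - 1))" using fact_le_power[of "r - 1", where 'a = real] by simp
    also have "\<dots> \<le> real r ^ (r - 1)" by (simp add: power_mono)
    finally show ?thesis .
  qed
  also have "\<dots> \<le> real n ^ (r - 1) / 64"
  proof -
    have "real r * 64 \<le> real n"
    proof -
      have "(real r)\<^sup>2 * 64 \<le> real n" using r_square_over_n[OF r n] n0 by (simp add: field_simps)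
      moreover have "real r * 1 \<le> (real r)\<^sup>2" unfolding power2_eq_square using r by (intro mult_left_mono) auto
      ultimately show ?thesis by linarith
    qed
    then have "(real r * 64) ^ Suc k \<le> real n ^ Suc k" by (intro power_mono) auto
    moreover have "real r ^ Suc k * 64 \<le> (real r * 64) ^ Suc k"
      unfolding power_mult_distrib using one_le_power[of "64::real" k] by (intro mult_left_mono) auto
    ultimately show ?thesis unfolding k by simp
  qed
  finally have f: "fact (r - 1) \<le> real n ^ (r - 1) / 64" .
  have C0: "0 \<le> C r" using C_bounds(1)[OF r] by simp
  have "(C r * sqrt (real n) / real n ^ r)\<^sup>2 = C r * C r * real n / (real n ^ r * real n ^ r)"
    by (simp add: power_divide power_mult_distrib) (simp add: power2_eq_square)
  also have "\<dots> \<le> fact (r - 1) * (real n ^ (r - 1) / 64) * real n / (real n ^ r * real n ^ r)"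
    using C_bounds(2)[OF r] f C0 by (intro divide_right_mono mult_right_mono mult_mono) auto
  also have "real n ^ r = real n ^ (r - 1) * real n" unfolding k by simp
  then have "fact (r - 1) * (real n ^ (r - 1) / 64) * real n / (real n ^ r * real n ^ r) = fact (r - 1) / 64 / real n ^ r"
    using n0 by simp
  finally show ?thesis .
qed

text \<open>The first bound says that \<open>1 + C1 r\<close> is at most
  \<open>C r * sqrt n\<close>, hence positivity of the lower estimate. The second follows from the
  summand \<open>4 r^2 C r\<close> in \<open>C1 r\<close>.\<close>

lemma sqrt_ge_of_N_le:
  assumes "2 \<le> r" "N r \<le> int n"
  shows "(1 + C1 r) / C r \<le> sqrt (real n)" "4 * (real r)\<^sup>2 \<le> sqrt (real n)"
proof -
  have C: "0 < C r" using C_bounds(1)[OF assms(1)] by simp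
  have "N2 r \<le> int n" using assms(2) by (simp add: N_def)
  then have "((1 + C1 r) / C r)\<^sup>2 \<le> real n" unfolding N2_def by (simp add: ceiling_le_iff)
  then show 1: "(1 + C1 r) / C r \<le> sqrt (real n)" by (rule real_le_rsqrt)
  have "4 * (real r)\<^sup>2 * C r \<le> 1 + C1 r" by (simp add: C1_def)
  then have "4 * (real r)\<^sup>2 \<le> (1 + C1 r) / C r" using C by (simp add: pos_le_divide_eq)
  with 1 show "4 * (real r)\<^sup>2 \<le> sqrt (real n)" by linarith
qed

text \<open>In the upper bound 63/64 belongs to \<open>ln m\<close>, 1/10 to the correction
  \<open>ln (1 - 1/(pi sqrt m))\<close> and 1/2 to the exponentially small error. In the lower bound
  the nonnegative correction is dropped.\<close>

lemma fwd_diff_ln_num_overpartitions_bounds: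
  assumes r: "2 \<le> r" and n: "4 * (real r)\<^sup>2 \<le> sqrt (real n)"
  defines "x \<equiv> C r * sqrt (real n) / real n ^ r"
  defines "T \<equiv> (-1) ^ (r - 1) * (fwd_diff ^^ r) (\<lambda>m. ln (real (num_overpartitions m))) n"
  shows "T \<le> x - (fact (r - 1) * (63 / 64 - 1 / 10) - 1 / 2) / real n ^ r"
    and "x * (1 - (real r)\<^sup>2 / real n) - (fact (r - 1) + 1 / 2) / real n ^ r \<le> T"
proof -
  define \<epsilon> where "\<epsilon> m = ln (real (num_overpartitions m)) -
      (pi * sqrt (real m) - ln 8 - ln (real m) + ln (1 - 1 / (pi * sqrt (real m))))" for m
  have n0: "0 < real n" using n_pos[OF r n] by simp
  define D where "D f = (-1) ^ (r - 1) * (fwd_diff ^^ r) f n" for f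
  have "(\<lambda>m. ln (real (num_overpartitions m))) =
      (\<lambda>m. (((pi * sqrt (real m) + - ln 8) + (-1) * ln (real m)) + ln (1 - 1 / (pi * sqrt (real m)))) + \<epsilon> m)"
    by (simp add: \<epsilon>_def)
  then have T: "T = D (\<lambda>m. pi * sqrt (real m)) - D (\<lambda>m. ln (real m)) + D (\<lambda>m. ln (1 - 1 / (pi * sqrt (real m)))) + D \<epsilon>"
    using r unfolding T_def D_def
    by (simp only: fwd_diff_funpow_add fwd_diff_funpow_const fwd_diff_funpow_cmult[of _ "-1"]) (simp add: algebra_simps)
  have "\<bar>(fwd_diff ^^ r) \<epsilon> n\<bar> \<le> 2 ^ r * (1 / (2 * 2 ^ r * real n ^ r))"
  proof (rule abs_fwd_diff_funpow_le)
    fix m assume m: "n \<le> m"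
    have "\<bar>\<epsilon> m\<bar> \<le> 1 / (2 * 2 ^ r * real m ^ r)"
      unfolding \<epsilon>_def by (rule ln_num_overpartitions_error[OF r]) (use n m order_trans[OF n, of "sqrt (real m)"] in simp)
    also have "\<dots> \<le> 1 / (2 * 2 ^ r * real n ^ r)"
      using m n0 by (intro divide_left_mono mult_left_mono power_mono) auto
    finally show "\<bar>\<epsilon> m\<bar> \<le> 1 / (2 * 2 ^ r * real n ^ r)" .
  qed
  then have err: "\<bar>D \<epsilon>\<bar> \<le> 1 / 2 / real n ^ r" by (simp add: D_def abs_mult power_abs)
  note b = fwd_diff_sqrt_bounds[OF r n, folded D_def x_def] fwd_diff_ln_bounds[OF r n, folded D_def]
    fwd_diff_correction_bounds[OF r n, folded D_def]
  have "T \<le> x - fact (r - 1) / real n ^ r * (63 / 64) + fact (r - 1) / 10 / real n ^ r + 1 / 2 / real n ^ r"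
    unfolding T using b err by linarith
  also have "\<dots> = x - (fact (r - 1) * (63 / 64 - 1 / 10) - 1 / 2) / real n ^ r"
    by (simp add: diff_divide_distrib add_divide_distrib)
  finally show "T \<le> x - (fact (r - 1) * (63 / 64 - 1 / 10) - 1 / 2) / real n ^ r" .
  have "x * (1 - (real r)\<^sup>2 / real n) - fact (r - 1) / real n ^ r - 1 / 2 / real n ^ r \<le> T"
    unfolding T using b err by linarith
  then show "x * (1 - (real r)\<^sup>2 / real n) - (fact (r - 1) + 1 / 2) / real n ^ r \<le> T"
    by (simp add: add_divide_distrib)
qed

text \<open>The logarithms are removed by \<open>ln (1 + y) \<le> y\<close> below and
  \<open>ln (1 + x) \<ge> x - x^2\<close> above, so it suffices to place the difference between
  \<open>y\<close> and \<open>x - x^2\<close>.\<close>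

theorem theorem1p6:
  fixes r n :: nat
  assumes "r \<ge> 2" and "int n \<ge> N r"
  shows "0 < ln (1 + C r / real n powr (real r - 1 / 2) - C1 r / real n ^ r)
       \<and> ln (1 + C r / real n powr (real r - 1 / 2) - C1 r / real n ^ r)
           < (-1) ^ (r - 1) * (fwd_diff ^^ r) (\<lambda>m. ln (real (num_overpartitions m))) n
       \<and> (-1) ^ (r - 1) * (fwd_diff ^^ r) (\<lambda>m. ln (real (num_overpartitions m))) n
           < ln (1 + C r / real n powr (real r - 1 / 2))"
proof -
  note r = assms(1)
  define s where "s = sqrt (real n)"
  define T where "T = (-1) ^ (r - 1) * (fwd_diff ^^ r) (\<lambda>m. ln (real (num_overpartitions m))) n"
  define x where "x = C r * s / real n ^ r"
  note n = sqrt_ge_of_N_le(2)[OF assms]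
  have n0: "0 < real n" using n_pos[OF r n] by simp
  have q0: "0 < real n ^ r" using n0 by simp
  have s: "16 \<le> s" "s * s = real n" using sqrt_n_ge[OF r n] by (auto simp: s_def)
  have C0: "3 / 4 \<le> C r" by (rule C_bounds(1)[OF r])
  note bounds = fwd_diff_ln_num_overpartitions_bounds[OF r n, folded s_def, folded x_def T_def]
  have x: "C r / real n powr (real r - 1 / 2) = x"
  proof -
    have "real n powr (real r - 1 / 2) = real n ^ r / s"
      using n0 by (simp add: powr_diff powr_realpow powr_half_sqrt s_def)
    then show ?thesis by (simp add: x_def)
  qed
  have x0: "0 < x" unfolding x_def using C0 s q0 by (intro divide_pos_pos mult_pos_pos) auto
  have fact1: "1 \<le> (fact (r - 1) :: real)" by simp
  have lower_pos: "C1 r / real n ^ r < x"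
  proof -
    have "1 + C1 r \<le> C r * s"
      using sqrt_ge_of_N_le(1)[OF assms] C0 by (simp add: s_def pos_divide_le_eq mult.commute)
    then have "C1 r < C r * s" by linarith
    then show ?thesis unfolding x_def using q0 by (rule divide_strict_right_mono)
  qed
  define y where "y = x - C1 r / real n ^ r"
  have y: "0 < y" using lower_pos by (simp add: y_def)
  have "ln (1 + y) \<le> y" using y by (intro ln_add_one_self_le_self) simp
  also have "y < T"
  proof -
    \<comment> \<open>The summand \<open>4 r^2 C r\<close> of \<open>C1 r\<close> has to cover the
      mean value loss \<open>C r * r^2\<close> and the error 1/2; the factor 4 leaves ample
      room.\<close>
    have "C r * (real r)\<^sup>2 + fact (r - 1) + 1 / 2 < C1 r"
    proof -
      have "2 * 2 \<le> (real r)\<^sup>2" unfolding power2_eq_square using r by (intro mult_mono) auto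
      then have "3 / 4 * 4 \<le> C r * (real r)\<^sup>2" using C0 by (intro mult_mono) auto
      then show ?thesis by (simp add: C1_def)
    qed
    moreover have "x * ((real r)\<^sup>2 / real n) \<le> C r * (real r)\<^sup>2 / real n ^ r"
    proof -
      have "s / real n \<le> 1" using s by (simp flip: s(2) add: divide_le_eq)
      then have "C r * (real r)\<^sup>2 / real n ^ r * (s / real n) \<le> C r * (real r)\<^sup>2 / real n ^ r * 1"
        using C0 by (intro mult_left_mono) auto
      then show ?thesis by (simp add: x_def mult_ac)
    qed
    ultimately have "x * ((real r)\<^sup>2 / real n) + (fact (r - 1) + 1 / 2) / real n ^ r < C1 r / real n ^ r"
      using q0 divide_strict_right_mono[of "C r * (real r)\<^sup>2 + fact (r - 1) + 1 / 2" "C1 r" "real n ^ r"]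
      by (simp add: add_divide_distrib)
    moreover have "x * (1 - (real r)\<^sup>2 / real n) = x - x * ((real r)\<^sup>2 / real n)"
      by (simp only: right_diff_distrib mult_1_right)
    ultimately show ?thesis using bounds(2) unfolding y_def by linarith
  qed
  finally have lower: "ln (1 + y) < T" .
  have x2: "x\<^sup>2 \<le> fact (r - 1) / 64 / real n ^ r"
    using C_square_small[OF r n] by (simp only: x_def s_def)
  have "T \<le> x - (fact (r - 1) * (63 / 64 - 1 / 10) - 1 / 2) / real n ^ r" by (rule bounds(1))
  also have "\<dots> < x - x\<^sup>2"
  proof -
    \<comment> \<open>The logarithmic contribution, even for the smallest factorial, outweighs the
      correction, the error and the quadratic loss together.\<close>
    have "f / 64 < f * (63 / 64 - 1 / 10) - 1 / 2" if "1 \<le> f" for f :: real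
      using that by simp
    from this[OF fact1] have "fact (r - 1) / 64 < fact (r - 1) * (63 / 64 - 1 / 10) - (1 / 2 :: real)" .
    then have "fact (r - 1) / 64 / real n ^ r < (fact (r - 1) * (63 / 64 - 1 / 10) - 1 / 2) / real n ^ r"
      using q0 by (rule divide_strict_right_mono)
    with x2 show ?thesis by linarith
  qed
  also have "\<dots> \<le> ln (1 + x)"
  proof (rule ln_one_plus_pos_lower_bound)
    have "fact (r - 1) \<le> real n ^ r"
    proof -
      have "fact (r - 1) \<le> real ((r - 1) ^ (r - 1))" using fact_le_power[of "r - 1", where 'a = real] by simp
      also have "\<dots> \<le> real n ^ (r - 1)"
      proof -
        have "real r \<le> (real r)\<^sup>2" unfolding power2_eq_square using r by simp
        also have "\<dots> \<le> (real r)\<^sup>2 * 64" by simp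
        also have "\<dots> \<le> real n" using r_square_over_n[OF r n] n0 by (simp add: field_simps)
        finally have "r - 1 \<le> n" by simp
        then show ?thesis by (simp add: power_mono flip: of_nat_power)
      qed
      also have "\<dots> \<le> real n ^ r" using n0 by (intro power_increasing) auto
      finally show ?thesis .
    qed
    moreover have "fact (r - 1) / 64 \<le> (fact (r - 1) :: real)" by simp
    ultimately have "fact (r - 1) / 64 \<le> real n ^ r" by (rule order_trans[rotated])
    then have "fact (r - 1) / 64 / real n ^ r \<le> 1"
      by (simp only: divide_le_eq_1_pos[OF q0])
    then have "x\<^sup>2 \<le> 1\<^sup>2" using x2 by simp
    then show "x \<le> 1" by (rule power2_le_imp_le) simp
  qed (use x0 in simp)
  finally have upper: "T < ln (1 + x)" .
  have "0 < ln (1 + y)" using y by simp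
  with lower upper show ?thesis
    unfolding x T_def[symmetric] by (simp add: y_def add_diff_eq)
qed



end
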